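(* Let $X=(X_1,X_2)$ be a stationary bivariate random closed set in $\mathbb{R}^d$ with strictly positive volume fractions $p_1(0,i)=\mathbb{P}(0\in X_i)$, $i=1,2$. Then the associated random coverage measure $\Psi=(\ell(X_1\cap\cdot),\ell(X_2\cap\cdot))$ is coverage-reweighted moment stationary and the following hold. (1) The cross statistics are $$K_{12}(t)=\frac{\mathbb{E}\left(\ell(X_2\cap B(0,t))\mid0\in X_1\right)}{p_1(0,2)},$$ $$J_{12}(t)=\frac{\mathbb{E}\left(1\{0\in X_1\}\exp\left[-\ell(X_2\cap B(0,t))/p_1(0,2)\right]\right)}{p_1(0,1)\,\mathbb{E}\left(\exp\left[-\ell(X_2\cap B(0,t))/p_1(0,2)\right]\right)}.$$ (2) Use a subscript $sX$ to denote that the statistic is evaluated for the scaled random closed set $sX$, and let $u_t^0(x,i)=1\{(x,i)\in B(0,t)\times\{2\}\}/p_1(x,i)$. Then $$\lim_{s\to\infty}L^{(0,1)}(s^du_t^0)=\frac{1-T_{12}(t)}{p_1(0,1)}$$ and, for $t>0$, $$\lim_{s\to\infty}J_{12;sX}(st)=\frac{\mathbb{P}(X_2\cap B(0,t)=\emptyset\mid0\in X_1)}{\mathbb{P}(X_2\cap B(0,t)=\emptyset)}=\mathbb{E}\left(\frac{1\{0\in X_1\}}{p_1(0,1)}\,\Big|\,X_2\cap B(0,t)=\emptyset\right)$$ whenever $\mathbb{P}(X_2\cap B(0,t)=\emptyset)\ne0$.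
   Context: $\ell$ is Lebesgue measure on $\mathbb{R}^d$; $B(a,t)$ is the closed ball of radius $t\ge0$ centred at $a\in\mathbb{R}^d$. A bivariate random closed set $X=(X_1,X_2)$ is stationary if its joint distribution is invariant under common translations of its components. Scaling by a scalar $s>0$: $sX=(sX_1,sX_2)$ with $sX_i=\{sx:x\in X_i\}$. The random coverage measure of $X$ is $\Psi=(\Psi_1,\Psi_2)$ with $\Psi_i(B)=\ell(X_i\cap B)$. The hitting intensity is $$T_{12}(t)=\mathbb{E}\left[\frac1{\ell(B)}\int_B1\{X_2\cap B(x,t)\ne\emptyset\}\,d\Psi_1(x)\right],$$ where $B$ is any bounded Borel set of positive volume $\ell(B)$ (by stationarity the definition does not depend on $B$). Random measures. A bivariate random measure $\Psi=(\Psi_1,\Psi_2)$ is a measurable map from a probability space into the locally finite Borel measures on $\mathbb{R}^d\times\{1,2\}$; $\Psi_i(B)$ is the mass of $B\times\{i\}$. Its $k$-th order moment measure is given by $\mu^{(k)}((B_1\times\{i_1\})\times\cdots\times(B_k\times\{i_k\}))=\mathbb{E}(\Psi_{i_1}(B_1)\cdots\Psi_{i_k}(B_k))$, provided this is finite for bounded Borel sets. If it equals $\int_{B_1}\cdots\int_{B_k}p_k((x_1,i_1),\dots,(x_k,i_k))\,dx_1\cdots dx_k$, then $p_k$ is called the $k$-point coverage function; for the coverage measure of a random closed set, $p_k((x_1,i_1),\dots,(x_k,i_k))=\mathbb{P}(x_1\in X_{i_1};\dots;x_k\in X_{i_k})$. Cumulant densities. Assume that the moment measures exist and are absolutely continuous,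 and that $p_1>0$. The coverage-reweighted cumulant densities $\xi_k$ are defined recursively by $\xi_1\equiv1$ and, for $k\ge2$, $$\frac{p_k((x_1,i_1),\dots,(x_k,i_k))}{p_1(x_1,i_1)\cdots p_1(x_k,i_k)}=\sum_{m=1}^k\sum_{D_1,\dots,D_m}\prod_{j=1}^m\xi_{|D_j|}(\{(x_l,i_l):l\in D_j\}),$$ the inner sum being over all partitions of $\{1,\dots,k\}$ into $m$ non-empty sets $D_1,\dots,D_m$, where $|D_j|$ is the cardinality of $D_j$. $\Psi$ is coverage-reweighted moment stationary if its coverage function exists and is bounded away from zero, $\inf p_1(x,i)>0$, and its coverage-reweighted cumulant densities $\xi_k$ exist and are translation invariant: $\xi_k((x_1+a,i_1),\dots,(x_k+a,i_k))=\xi_k((x_1,i_1),\dots,(x_k,i_k))$ for all $a\in\mathbb{R}^d$, all labels $i_j$ and almost all $x_j\in\mathbb{R}^d$. Cross $K$-function: for $t\ge0$, $K_{12}(t)=\int_{B(0,t)}(1+\xi_2((0,1),(x,2)))\,dx$. Cross $J$-function: $$J_{12}(t)=1+\sum_{k=1}^\infty\frac{(-1)^k}{k!}\int_{B(0,t)}\cdots\int_{B(0,t)}\xi_{k+1}((0,1),(x_1,2),\dots,(x_k,2))\,dx_1\cdots dx_k,$$ defined for all $t\ge0$ for which the series is absolutely convergent. Palm distributions. $P^{(x,i)}$, with expectation $\mathbb{E}^{(x,i)}$, is defined uniquely up to a $\mu^{(1)}$-null set by $\mathbb{E}[\sum_i\int g((x,i),\Psi)\,d\Psi_i(x)]=\sum_i\int\mathbb{E}^{(x,i)}[g((x,i),\Psi)]\,d\mu^{(1)}(x,i)$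 for all non-negative measurable $g$. For the coverage measure of a stationary random closed set with positive volume fractions, the Palm distribution $P^{(0,1)}$ amounts to conditioning on $0\in X_1$. The Laplace functional is $L(u)=\mathbb{E}\exp[-\sum_i\int u(x,i)\,d\Psi_i(x)]$, and $L^{(0,1)}$ is the Laplace functional of $\Psi$ under $P^{(0,1)}$.
   Formalization: In (2), (1−T12(t))/p1(0,1) is corrected to 1−T12(t)/p1(0,1); both s→∞ limits assume that X_2 is a.s. the support of its coverage measure; the L limit is for t>0; J12 is taken where its series converges absolutely (for all large s in the limit). *)

theory Defs
  imports "HOL-Probability.Probability"
begin

text \<open>
  Components are labelled by the two-element type \<open>2\<close>, whose elements are \<open>1\<close> and \<open>2\<close>
  (\<open>2 = 0\<close>, \<open>1 \<noteq> 2\<close> in this type). Euclidean space of dimension \<open>d\<close> is a type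
  \<open>'a :: euclidean_space\<close> with \<open>d = DIM('a)\<close>.
\<close>

section \<open>Random closed sets\<close>

text \<open>The closed sets with the Borel \<open>\<sigma>\<close>-algebra of the Fell topology, which is generated by the
  hitting events of compact sets.\<close>

definition fell :: "'a::euclidean_space set measure" where
  "fell = sigma {F. closed F} {{F. closed F \<and> F \<inter> K \<noteq> {}} | K. compact K}"

definition random_closed_pair :: "'w measure \<Rightarrow> (2 \<Rightarrow> 'w \<Rightarrow> 'a::euclidean_space set) \<Rightarrow> bool" where
  "random_closed_pair M X \<longleftrightarrow> (\<forall>i. X i \<in> measurable M fell)"

definition joint_law :: "'w measure \<Rightarrow> (2 \<Rightarrow> 'w \<Rightarrow> 'a::euclidean_space set) \<Rightarrow> ('a set \<times> 'a set) measure" where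
  "joint_law M X = distr M (fell \<Otimes>\<^sub>M fell) (\<lambda>\<omega>. (X 1 \<omega>, X 2 \<omega>))"

definition translated :: "'a::euclidean_space \<Rightarrow> (2 \<Rightarrow> 'w \<Rightarrow> 'a set) \<Rightarrow> 2 \<Rightarrow> 'w \<Rightarrow> 'a set" where
  "translated a X i \<omega> = (\<lambda>x. x + a) ` X i \<omega>"

definition scaled :: "real \<Rightarrow> (2 \<Rightarrow> 'w \<Rightarrow> 'a::euclidean_space set) \<Rightarrow> 2 \<Rightarrow> 'w \<Rightarrow> 'a set" where
  "scaled s X i \<omega> = (\<lambda>x. s *\<^sub>R x) ` X i \<omega>"

definition stationary :: "'w measure \<Rightarrow> (2 \<Rightarrow> 'w \<Rightarrow> 'a::euclidean_space set) \<Rightarrow> bool" where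
  "stationary M X \<longleftrightarrow> (\<forall>a. joint_law M (translated a X) = joint_law M X)"

text \<open>Almost surely every neighbourhood of every point of \<open>F\<close> carries positive volume of \<open>F\<close>;
  that is, \<open>F\<close> is the support of its coverage measure.\<close>

definition locally_charged :: "'w measure \<Rightarrow> ('w \<Rightarrow> 'a::euclidean_space set) \<Rightarrow> bool" where
  "locally_charged M F \<longleftrightarrow>
    (AE \<omega> in M. \<forall>x\<in>F \<omega>. \<forall>r>0. measure lborel (F \<omega> \<inter> cball x r) > 0)"

section \<open>Bivariate random measures\<close>

definition marked_space :: "('a::euclidean_space \<times> 2) measure" where
  "marked_space = borel \<Otimes>\<^sub>M count_space UNIV"

definition locally_finite_measures :: "('a::euclidean_space \<times> 2) measure set" where
  "locally_finite_measures =
    {\<psi>. sets \<psi> = sets marked_space \<and>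
        (\<forall>B i. B \<in> sets borel \<and> bounded B \<longrightarrow> emeasure \<psi> (B \<times> {i}) < \<infinity>)}"

text \<open>The \<open>\<sigma>\<close>-algebra generated by the evaluations, as in \<^const>\<open>subprob_algebra\<close>.\<close>

definition lf_algebra :: "('a::euclidean_space \<times> 2) measure measure" where
  "lf_algebra =
    (SUP A \<in> sets marked_space. vimage_algebra locally_finite_measures (\<lambda>\<psi>. emeasure \<psi> A) borel)"

definition random_measure :: "'w measure \<Rightarrow> ('w \<Rightarrow> ('a::euclidean_space \<times> 2) measure) \<Rightarrow> bool" where
  "random_measure M \<Psi> \<longleftrightarrow> \<Psi> \<in> measurable M lf_algebra"

definition component :: "('a::euclidean_space \<times> 2) measure \<Rightarrow> 2 \<Rightarrow> 'a measure" where
  "component \<psi> i = measure_of UNIV (sets borel) (\<lambda>B. emeasure \<psi> (B \<times> {i}))"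

text \<open>The random coverage measure: its value on \<open>B \<times> {i}\<close> is the volume of \<open>X i \<inter> B\<close>.\<close>

definition coverage_measure ::
    "(2 \<Rightarrow> 'w \<Rightarrow> 'a::euclidean_space set) \<Rightarrow> 'w \<Rightarrow> ('a \<times> 2) measure" where
  "coverage_measure X \<omega> =
    density (lborel \<Otimes>\<^sub>M count_space UNIV) (\<lambda>(x, i). indicator (X i \<omega>) x)"

text \<open>The \<open>k\<close>-th order moment measure of \<open>(B 0 \<times> {i 0}) \<times> \<dots> \<times> (B (k-1) \<times> {i (k-1)})\<close>.\<close>

definition moment ::
    "'w measure \<Rightarrow> ('w \<Rightarrow> ('a::euclidean_space \<times> 2) measure) \<Rightarrow> nat \<Rightarrow> (nat \<Rightarrow> 2) \<Rightarrow> (nat \<Rightarrow> 'a set) \<Rightarrow> ennreal"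
  where
  "moment M \<Psi> k i B = (\<integral>\<^sup>+\<omega>. (\<Prod>j<k. emeasure (\<Psi> \<omega>) (B j \<times> {i j})) \<partial>M)"

abbreviation marked_tuple :: "nat \<Rightarrow> (nat \<Rightarrow> 'a) \<Rightarrow> (nat \<Rightarrow> 2) \<Rightarrow> ('a \<times> 2) list" where
  "marked_tuple k x i \<equiv> map (\<lambda>j. (x j, i j)) [0..<k]"

text \<open>A function on lists of marked points represents a whole family of functions of \<open>k\<close> marked
  points, \<open>k\<close> being the length of the list. The predicate says that \<open>p\<close> is a (nonnegative) version
  of the family of \<open>k\<close>-point coverage functions; finiteness of the moments on bounded sets is
  included.\<close>

definition coverage_function ::
    "'w measure \<Rightarrow> ('w \<Rightarrow> ('a::euclidean_space \<times> 2) measure) \<Rightarrow> (('a \<times> 2) list \<Rightarrow> real) \<Rightarrow> bool"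
  where
  "coverage_function M \<Psi> p \<longleftrightarrow>
    (\<forall>zs. 0 \<le> p zs) \<and>
    (\<forall>k\<ge>1. \<forall>i.
      (\<lambda>x. p (marked_tuple k x i)) \<in> borel_measurable (\<Pi>\<^sub>M j\<in>{..<k}. lborel) \<and>
      (\<forall>B. (\<forall>j<k. B j \<in> sets borel \<and> bounded (B j)) \<longrightarrow>
        moment M \<Psi> k i B < \<infinity> \<and>
        moment M \<Psi> k i B =
          (\<integral>\<^sup>+x. ennreal (p (marked_tuple k x i)) * indicator (Pi\<^sub>E {..<k} B) x
             \<partial>(\<Pi>\<^sub>M j\<in>{..<k}. lborel))))"

text \<open>The pointwise version of the coverage function of a random closed set:
  \<open>P(x\<^sub>1 \<in> X i\<^sub>1; \<dots>; x\<^sub>k \<in> X i\<^sub>k)\<close>.\<close>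

definition cover_prob ::
    "'w measure \<Rightarrow> (2 \<Rightarrow> 'w \<Rightarrow> 'a::euclidean_space set) \<Rightarrow> ('a \<times> 2) list \<Rightarrow> real" where
  "cover_prob M X zs = \<P>(\<omega> in M. \<forall>(x, i)\<in>set zs. x \<in> X i \<omega>)"

section \<open>Coverage-reweighted cumulant densities\<close>

text \<open>The defining relation solved for the term of the one-block partition. The family of points
  indexed by a block \<open>D\<close> is the sublist \<^term>\<open>nths zs D\<close>.\<close>

function \<xi> :: "('z list \<Rightarrow> real) \<Rightarrow> 'z list \<Rightarrow> real" where
  "\<xi> p zs =
    (if length zs \<le> 1 then 1
     else p zs / (\<Prod>z\<leftarrow>zs. p [z]) -
       (\<Sum>P\<in>{P. partition_on {..<length zs} P \<and> P \<noteq> {{..<length zs}}}. \<Prod>D\<in>P. \<xi> p (nths zs D)))"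
  by auto

termination
proof (relation "inv_image less_than (\<lambda>(p, zs). length zs)", goal_cases)
  case 1
  show ?case by simp
next
  case (2 p zs P D)
  then have P: "partition_on {..<length zs} P" and neq: "P \<noteq> {{..<length zs}}" and D: "D \<in> P"
    by auto
  have sub: "D \<subseteq> {..<length zs}"
    using P D by (auto simp: partition_on_def)
  have "D \<noteq> {..<length zs}"
  proof
    assume eq: "D = {..<length zs}"
    have "E = D" if E: "E \<in> P" for E
    proof (rule ccontr)
      assume "E \<noteq> D"
      then have "E \<inter> D = {}"
        using P D E by (auto simp: partition_on_def disjoint_def)
      moreover have "E \<subseteq> D" "E \<noteq> {}"
        using P E eq by (auto simp: partition_on_def)
      ultimately show False by blast
    qed
    then have "P = {D}" using D by blast
    with neq eq show False by simp
  qed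
  with sub have "D \<subset> {..<length zs}" by blast
  then have "card D < length zs"
    using psubset_card_mono[of "{..<length zs}" D] by simp
  moreover have "{i. i < length zs \<and> i \<in> D} = D" using sub by auto
  ultimately show ?case by (simp add: length_nths)
qed

declare \<xi>.simps [simp del]

text \<open>The defining relation in its original form.\<close>

lemma \<xi>_singleton: "\<xi> p [z] = 1"
  by (subst \<xi>.simps) simp

lemma \<xi>_partitions:
  assumes "2 \<le> length zs"
  shows "p zs / (\<Prod>z\<leftarrow>zs. p [z]) =
    (\<Sum>P\<in>{P. partition_on {..<length zs} P}. \<Prod>D\<in>P. \<xi> p (nths zs D))"
proof -
  let ?A = "{..<length zs}"
  have fin: "finite {P. partition_on ?A P}"
    by (rule finitely_many_partition_on) simp
  have "?A \<noteq> {}" using assms by (auto simp: lessThan_empty_iff)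
  then have one: "partition_on ?A {?A}"
    by (auto simp: partition_on_def)
  have full: "nths zs ?A = zs" by (simp add: nths_all)
  have "(\<Sum>P\<in>{P. partition_on ?A P}. \<Prod>D\<in>P. \<xi> p (nths zs D)) =
      (\<Prod>D\<in>{?A}. \<xi> p (nths zs D)) +
      (\<Sum>P\<in>{P. partition_on ?A P} - {{?A}}. \<Prod>D\<in>P. \<xi> p (nths zs D))"
    using fin one by (intro sum.remove) auto
  also have "{P. partition_on ?A P} - {{?A}} = {P. partition_on ?A P \<and> P \<noteq> {?A}}"
    by auto
  also have "(\<Prod>D\<in>{?A}. \<xi> p (nths zs D)) = p zs / (\<Prod>z\<leftarrow>zs. p [z]) -
      (\<Sum>P\<in>{P. partition_on ?A P \<and> P \<noteq> {?A}}. \<Prod>D\<in>P. \<xi> p (nths zs D))"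
    using assms by (simp add: full \<xi>.simps[of p zs])
  finally show ?thesis by simp
qed

text \<open>Coverage-reweighted moment stationarity, for the version \<open>p\<close> of the coverage function.\<close>

definition crm_stationary ::
    "'w measure \<Rightarrow> ('w \<Rightarrow> ('a::euclidean_space \<times> 2) measure) \<Rightarrow> (('a \<times> 2) list \<Rightarrow> real) \<Rightarrow> bool"
  where
  "crm_stationary M \<Psi> p \<longleftrightarrow>
    random_measure M \<Psi> \<and> coverage_function M \<Psi> p \<and> (INF z. p [z]) > 0 \<and>
    (\<forall>k\<ge>1. \<forall>i a. AE x in (\<Pi>\<^sub>M j\<in>{..<k}. lborel).
       \<xi> p (marked_tuple k (\<lambda>j. x j + a) i) = \<xi> p (marked_tuple k x i))"

section \<open>Cross statistics\<close>

definition K12 :: "(('a::euclidean_space \<times> 2) list \<Rightarrow> real) \<Rightarrow> real \<Rightarrow> real" where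
  "K12 p t = (LINT x:cball 0 t|lborel. 1 + \<xi> p [(0, 1), (x, 2)])"

abbreviation J12_integrand ::
    "(('a::euclidean_space \<times> 2) list \<Rightarrow> real) \<Rightarrow> nat \<Rightarrow> (nat \<Rightarrow> 'a) \<Rightarrow> real" where
  "J12_integrand p k x \<equiv> \<xi> p ((0, 1) # marked_tuple k x (\<lambda>j. 2))"

definition J12_term :: "(('a::euclidean_space \<times> 2) list \<Rightarrow> real) \<Rightarrow> real \<Rightarrow> nat \<Rightarrow> real" where
  "J12_term p t k = (-1) ^ k / fact k *
    (LINT x:(Pi\<^sub>E {..<k} (\<lambda>j. cball 0 t))|(\<Pi>\<^sub>M j\<in>{..<k}. lborel). J12_integrand p k x)"

text \<open>The domain of the cross \<open>J\<close>-function: all integrals exist and the series converges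
  absolutely.\<close>

definition J12_defined :: "(('a::euclidean_space \<times> 2) list \<Rightarrow> real) \<Rightarrow> real \<Rightarrow> bool" where
  "J12_defined p t \<longleftrightarrow> 0 \<le> t \<and>
    (\<forall>k\<ge>1. set_integrable (\<Pi>\<^sub>M j\<in>{..<k}. lborel) (Pi\<^sub>E {..<k} (\<lambda>j. cball 0 t)) (J12_integrand p k)) \<and>
    summable (\<lambda>k. \<bar>J12_term p t (Suc k)\<bar>)"

definition J12 :: "(('a::euclidean_space \<times> 2) list \<Rightarrow> real) \<Rightarrow> real \<Rightarrow> real" where
  "J12 p t = 1 + (\<Sum>k. J12_term p t (Suc k))"

text \<open>The hitting intensity, computed with the window \<open>B\<close>.\<close>

definition T12 ::
    "'w measure \<Rightarrow> (2 \<Rightarrow> 'w \<Rightarrow> 'a::euclidean_space set) \<Rightarrow> 'a set \<Rightarrow> real \<Rightarrow> real" where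
  "T12 M X B t =
    (LINT \<omega>|M. 1 / measure lborel B *
       (LINT x:B|component (coverage_measure X \<omega>) 1. of_bool (X 2 \<omega> \<inter> cball x t \<noteq> {})))"

section \<open>Palm distributions and Laplace functionals\<close>

definition intensity_measure ::
    "'w measure \<Rightarrow> ('w \<Rightarrow> ('a::euclidean_space \<times> 2) measure) \<Rightarrow> ('a \<times> 2) measure" where
  "intensity_measure M \<Psi> =
    measure_of UNIV (sets marked_space) (\<lambda>A. \<integral>\<^sup>+\<omega>. emeasure (\<Psi> \<omega>) A \<partial>M)"

text \<open>\<open>Q (x, i)\<close> plays the role of \<open>P\<^bsup>(x,i)\<^esup>\<close>, as a law on the space of locally finite measures.\<close>

definition palm_family ::
    "'w measure \<Rightarrow> ('w \<Rightarrow> ('a::euclidean_space \<times> 2) measure) \<Rightarrow>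
      ('a \<times> 2 \<Rightarrow> ('a \<times> 2) measure measure) \<Rightarrow> bool" where
  "palm_family M \<Psi> Q \<longleftrightarrow>
    Q \<in> measurable marked_space (prob_algebra lf_algebra) \<and>
    (\<forall>g::('a \<times> 2) \<times> ('a \<times> 2) measure \<Rightarrow> ennreal.
      g \<in> borel_measurable (marked_space \<Otimes>\<^sub>M lf_algebra) \<longrightarrow>
      (\<integral>\<^sup>+\<omega>. (\<integral>\<^sup>+z. g (z, \<Psi> \<omega>) \<partial>\<Psi> \<omega>) \<partial>M) =
      (\<integral>\<^sup>+z. (\<integral>\<^sup>+\<psi>. g (z, \<psi>) \<partial>Q z) \<partial>intensity_measure M \<Psi>))"

text \<open>Palm families are unique only up to null sets of points. For a stationary random measure
  with positive intensities, compatibility with translations singles out the version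
  whose value at a fixed point such as \<open>(0, 1)\<close> is well defined.\<close>

definition translation_covariant ::
    "('a::euclidean_space \<times> 2 \<Rightarrow> ('a \<times> 2) measure measure) \<Rightarrow> bool" where
  "translation_covariant Q \<longleftrightarrow>
    (\<forall>x a i. Q (x + a, i) =
      distr (Q (x, i)) lf_algebra (\<lambda>\<psi>. distr \<psi> marked_space (\<lambda>(y, j). (y + a, j))))"

text \<open>Conditioning on \<open>x \<in> X i\<close>.\<close>

definition palm_by_conditioning ::
    "'w measure \<Rightarrow> (2 \<Rightarrow> 'w \<Rightarrow> 'a::euclidean_space set) \<Rightarrow> 'a \<times> 2 \<Rightarrow> ('a \<times> 2) measure measure" where
  "palm_by_conditioning M X =
    (\<lambda>(x, i). distr (uniform_measure M {\<omega> \<in> space M. x \<in> X i \<omega>}) lf_algebra (coverage_measure X))"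

text \<open>The Laplace functional of a random measure with law \<open>Q\<close>, for bounded nonnegative \<open>u\<close> with
  bounded support.\<close>

definition laplace :: "('a::euclidean_space \<times> 2) measure measure \<Rightarrow> ('a \<times> 2 \<Rightarrow> real) \<Rightarrow> real" where
  "laplace Q u = (LINT \<psi>|Q. exp (- (LINT z|\<psi>. u z)))"

definition u0 :: "(('a::euclidean_space \<times> 2) list \<Rightarrow> real) \<Rightarrow> real \<Rightarrow> 'a \<times> 2 \<Rightarrow> real" where
  "u0 p t z = indicator (cball 0 t \<times> {2}) z / p [z]"

end

theory Submission
  imports Defs
begin

text \<open>
  Write \<open>V\<close> for the volume of \<open>X 2\<close> in the ball of radius \<open>t\<close> around the origin, \<open>p\<close> for the coverage
  function and \<open>v i\<close> for the volume fractions.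

  By Fubini's theorem, integrating \<open>p\<close> over tuples of points in the ball yields the moments of \<open>V\<close>,
  possibly restricted to the event \<open>0 \<in> X 1\<close> (\<open>set_integral_cover_tuple\<close>). This proves that \<open>p\<close> is the
  coverage function and gives the formula for \<open>K12\<close>. Translation invariance of \<open>p\<close>, and with it of the
  cumulant densities, is stationarity of the pair.

  For \<open>J12\<close>, sort the partitions in the cumulant relation of the point \<open>(0, 1)\<close> and \<open>n\<close> points of
  label \<open>2\<close> according to the block of \<open>(0, 1)\<close>. This block contributes a cumulant, and the remaining
  blocks sum up to the reweighted coverage probability of the remaining points (\<open>reweighted_Cons\<close>).
  After integration the summands depend only on the size of the block, which leaves a binomial
  convolution. Consequently the exponential generating series of the integrals on the left, which is
  the expectation of \<open>exp (- V / v 2)\<close> on \<open>0 \<in> X 1\<close> divided by \<open>v 1\<close>, is the product of \<open>J12\<close> and of the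
  expectation of \<open>exp (- V / v 2)\<close> (\<open>J12_eq\<close>).

  Campbell's formula for the coverage measure shows that conditioning on \<open>x \<in> X i\<close> is a translation
  covariant Palm family. Palm families are only determined almost everywhere, but averaging over
  \<open>x\<close> in a ball shows that all covariant ones have the same Laplace transform at the origin
  (\<open>palm_ball_average\<close>).

  For the limits, \<open>exp (- s\<^sup>d V / v 2)\<close> tends to the indicator of \<open>V = 0\<close>. If \<open>X 2\<close> is the support of its
  coverage measure, \<open>V = 0\<close> means that \<open>X 2\<close> misses the open ball. It then misses the closed ball
  almost surely: otherwise the origin would be at distance exactly \<open>t\<close> from \<open>X 2\<close>, and by stationarity
  the probability of this is the mean volume fraction of the set of points at distance \<open>t\<close> from
  \<open>X 2\<close>, which is a null set (\<open>negligible_sphere_around_closed_set\<close>).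
\<close>

section \<open>Closed sets and their hitting events\<close>

lemma space_fell [simp]: "space fell = {F. closed F}"
  unfolding fell_def by (rule space_measure_of) auto

lemma sets_fell_hitting [measurable]:
  "compact K \<Longrightarrow> {F. closed F \<and> F \<inter> K \<noteq> {}} \<in> sets fell"
  unfolding fell_def by (subst sets_measure_of) auto

lemma measurable_fellI:
  assumes "\<And>\<omega>. \<omega> \<in> space N \<Longrightarrow> closed (f \<omega>)"
    and "\<And>K. compact K \<Longrightarrow> Measurable.pred N (\<lambda>\<omega>. f \<omega> \<inter> K \<noteq> {})"
  shows "f \<in> measurable N fell"
  unfolding fell_def
proof (rule measurable_measure_of)
  show "f \<in> space N \<rightarrow> {F. closed F}" using assms(1) by auto
next
  fix A assume "A \<in> {{F. closed F \<and> F \<inter> K \<noteq> {}} | K. compact (K::'b set)}"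
  then obtain K where A: "A = {F. closed F \<and> F \<inter> K \<noteq> {}}" and K: "compact K" by auto
  have "f -` A \<inter> space N = {\<omega>\<in>space N. f \<omega> \<inter> K \<noteq> {}}" using assms(1) A by auto
  then show "f -` A \<inter> space N \<in> sets N" using assms(2)[OF K] by simp
qed auto

lemma measurable_hits_compact:
  assumes f: "f \<in> measurable N fell" and K: "compact K"
  shows "Measurable.pred N (\<lambda>\<omega>. f \<omega> \<inter> K \<noteq> {})"
proof -
  have "{\<omega>\<in>space N. f \<omega> \<inter> K \<noteq> {}} = f -` {F. closed F \<and> F \<inter> K \<noteq> {}} \<inter> space N"
    using measurable_space[OF f] by auto
  also have "\<dots> \<in> sets N" by (intro measurable_sets[OF f] sets_fell_hitting K)
  finally show ?thesis by (simp add: pred_def)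
qed

lemma measurable_affine_image:
  fixes f :: "'w \<Rightarrow> 'a::euclidean_space set"
  assumes f: "f \<in> measurable N fell" and s: "s \<noteq> 0"
  shows "(\<lambda>\<omega>. (\<lambda>x. s *\<^sub>R x + a) ` f \<omega>) \<in> measurable N fell"
proof (rule measurable_fellI)
  fix \<omega> assume "\<omega> \<in> space N"
  then have "closed ((+) a ` (*\<^sub>R) s ` f \<omega>)"
    using measurable_space[OF f] by (intro closed_translation closed_scaling) auto
  then show "closed ((\<lambda>x. s *\<^sub>R x + a) ` f \<omega>)" by (simp add: image_image add.commute)
next
  fix K :: "'a set" assume K: "compact K"
  let ?K = "(\<lambda>x. (1/s) *\<^sub>R (x - a)) ` K"
  have "compact ?K" using K by (intro compact_continuous_image continuous_intros)
  then have "Measurable.pred N (\<lambda>\<omega>. f \<omega> \<inter> ?K \<noteq> {})" by (rule measurable_hits_compact[OF f])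
  moreover have "f \<omega> \<inter> ?K \<noteq> {} \<longleftrightarrow> (\<lambda>x. s *\<^sub>R x + a) ` f \<omega> \<inter> K \<noteq> {}" for \<omega>
  proof
    assume "f \<omega> \<inter> ?K \<noteq> {}"
    then obtain k where k: "k \<in> K" "(1/s) *\<^sub>R (k - a) \<in> f \<omega>" by auto
    have "s *\<^sub>R ((1/s) *\<^sub>R (k - a)) + a = k" using s by simp
    with k show "(\<lambda>x. s *\<^sub>R x + a) ` f \<omega> \<inter> K \<noteq> {}" by (metis IntI empty_iff imageI)
  next
    assume "(\<lambda>x. s *\<^sub>R x + a) ` f \<omega> \<inter> K \<noteq> {}"
    then obtain x where x: "x \<in> f \<omega>" "s *\<^sub>R x + a \<in> K" by auto
    have "(1/s) *\<^sub>R ((s *\<^sub>R x + a) - a) = x" using s by simp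
    with x show "f \<omega> \<inter> ?K \<noteq> {}" by (metis (no_types, lifting) IntI empty_iff image_eqI)
  qed
  ultimately show "Measurable.pred N (\<lambda>\<omega>. (\<lambda>x. s *\<^sub>R x + a) ` f \<omega> \<inter> K \<noteq> {})" by simp
qed

text \<open>A closed set that comes arbitrarily close to a ball hits it, so hitting a moving ball is
  decided by countably many fixed balls with slightly larger radius.\<close>

lemma hits_cball_iff_dense:
  fixes F :: "'a::euclidean_space set"
  assumes "closed F" and D: "\<And>A. open A \<Longrightarrow> A \<noteq> {} \<Longrightarrow> \<exists>d\<in>D. d \<in> A"
  shows "F \<inter> cball x t \<noteq> {} \<longleftrightarrow>
    (\<forall>n. \<exists>q\<in>D. dist x q < 1 / Suc n \<and> F \<inter> cball q (t + 1 / Suc n) \<noteq> {})"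
    (is "_ \<longleftrightarrow> ?R")
proof
  assume "F \<inter> cball x t \<noteq> {}"
  then obtain y where y: "y \<in> F" "dist x y \<le> t" by auto
  show ?R
  proof
    fix n
    obtain q where q: "q \<in> D" "q \<in> ball x (1 / Suc n)"
      using D[of "ball x (1 / Suc n)"] by auto
    have "dist q y \<le> t + 1 / Suc n"
      using dist_triangle[of q y x] q y by (simp add: dist_commute)
    with q y show "\<exists>q\<in>D. dist x q < 1 / Suc n \<and> F \<inter> cball q (t + 1 / Suc n) \<noteq> {}"
      by (intro bexI[of _ q]) auto
  qed
next
  assume R: ?R
  then have ne: "F \<noteq> {}" by blast
  have "infdist x F \<le> t + e" if "e > 0" for e
  proof -
    have "0 < e / 2" using that by simp
    then obtain n where n: "1 / real (Suc n) < e / 2" by (rule nat_approx_posE)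
    obtain q y where qy: "dist x q < 1 / Suc n" "y \<in> F" "dist q y \<le> t + 1 / Suc n"
      using R[rule_format, of n] by auto
    have "infdist x F \<le> dist x y" using qy by (intro infdist_le)
    also have "\<dots> \<le> dist x q + dist q y" by (rule dist_triangle)
    finally show ?thesis using qy n by linarith
  qed
  then have "infdist x F \<le> t" by (rule field_le_epsilon)
  moreover obtain y where "y \<in> F" "infdist x F = dist x y"
    using infdist_attains_inf[OF assms(1) ne] by metis
  ultimately show "F \<inter> cball x t \<noteq> {}" by auto
qed

lemma measurable_hits_cball [measurable (raw)]:
  assumes f [measurable]: "f \<in> measurable N fell" and g [measurable]: "g \<in> measurable N borel"
  shows "Measurable.pred N (\<lambda>\<omega>. f \<omega> \<inter> cball (g \<omega>) t \<noteq> {})"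
proof -
  obtain D :: "'b set" where D: "countable D" "\<And>A. open A \<Longrightarrow> A \<noteq> {} \<Longrightarrow> \<exists>d\<in>D. d \<in> A"
    using countable_dense_exists by blast
  have cl: "\<omega> \<in> space N \<Longrightarrow> closed (f \<omega>)" for \<omega>
    using measurable_space[OF f] by auto
  have hit: "Measurable.pred N (\<lambda>\<omega>. f \<omega> \<inter> cball q r \<noteq> {})" for q r
    by (rule measurable_hits_compact[OF f]) simp
  note hit [measurable]
  have "Measurable.pred N (\<lambda>\<omega>. \<forall>n. \<exists>q\<in>D. dist (g \<omega>) q < 1 / Suc n \<and> f \<omega> \<inter> cball q (t + 1 / Suc n) \<noteq> {})"
    using D(1) by measurable
  also have "?this \<longleftrightarrow> ?thesis"
    by (rule measurable_cong) (subst hits_cball_iff_dense[OF cl D(2)]; simp)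
  finally show ?thesis .
qed

lemma measurable_misses_cball [measurable (raw)]:
  assumes [measurable]: "f \<in> measurable N fell" "g \<in> measurable N borel"
  shows "Measurable.pred N (\<lambda>\<omega>. f \<omega> \<inter> cball (g \<omega>) t = {})"
proof -
  have "Measurable.pred N (\<lambda>\<omega>. \<not> (f \<omega> \<inter> cball (g \<omega>) t \<noteq> {}))" by measurable
  then show ?thesis by simp
qed

lemma measurable_mem_closed_set [measurable (raw)]:
  assumes [measurable]: "f \<in> measurable N fell" "g \<in> measurable N borel"
  shows "Measurable.pred N (\<lambda>\<omega>. g \<omega> \<in> f \<omega>)"
proof -
  have "Measurable.pred N (\<lambda>\<omega>. f \<omega> \<inter> cball (g \<omega>) 0 \<noteq> {})" by measurable
  also have "(\<lambda>\<omega>. f \<omega> \<inter> cball (g \<omega>) 0 \<noteq> {}) = (\<lambda>\<omega>. g \<omega> \<in> f \<omega>)" by auto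
  finally show ?thesis .
qed

lemma measurable_volume [measurable (raw)]:
  assumes f [measurable]: "f \<in> measurable N fell" and [measurable]: "A \<in> sets borel"
  shows "(\<lambda>\<omega>. emeasure lborel (f \<omega> \<inter> A)) \<in> borel_measurable N"
proof -
  have "(\<lambda>\<omega>. \<integral>\<^sup>+x. of_bool (x \<in> f \<omega>) * indicator A x \<partial>lborel) \<in> borel_measurable N"
    unfolding of_bool_def by measurable
  also have "?this \<longleftrightarrow> ?thesis"
  proof (rule measurable_cong)
    fix \<omega> assume "\<omega> \<in> space N"
    then have "closed (f \<omega>)" using measurable_space[OF f] by auto
    then have "f \<omega> \<inter> A \<in> sets lborel" by simp
    then have "emeasure lborel (f \<omega> \<inter> A) = (\<integral>\<^sup>+x. indicator (f \<omega> \<inter> A) x \<partial>lborel)" by simp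
    then show "(\<integral>\<^sup>+x. of_bool (x \<in> f \<omega>) * indicator A x \<partial>lborel) = emeasure lborel (f \<omega> \<inter> A)"
      by (auto intro!: nn_integral_cong simp: indicator_def)
  qed
  finally show ?thesis .
qed

lemma measurable_volume' [measurable (raw)]:
  assumes [measurable]: "f \<in> measurable N fell" "A \<in> sets borel"
  shows "(\<lambda>\<omega>. measure lborel (f \<omega> \<inter> A)) \<in> borel_measurable N"
  unfolding measure_def by measurable

lemma measurable_hits_ball:
  assumes f [measurable]: "f \<in> measurable N fell" and g [measurable]: "g \<in> measurable N borel"
  shows "Measurable.pred N (\<lambda>\<omega>. f \<omega> \<inter> ball (g \<omega>) t \<noteq> {})"
proof -
  have "F \<inter> ball x t \<noteq> {} \<longleftrightarrow> (\<exists>n. F \<inter> cball x (t - 1 / Suc n) \<noteq> {})" for F and x :: 'b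
  proof
    assume "F \<inter> ball x t \<noteq> {}"
    then obtain y where y: "y \<in> F" "dist x y < t" by auto
    then have "0 < t - dist x y" by simp
    then obtain n where "1 / real (Suc n) < t - dist x y" by (rule nat_approx_posE)
    with y show "\<exists>n. F \<inter> cball x (t - 1 / Suc n) \<noteq> {}" by (intro exI[of _ n]) auto
  next
    assume "\<exists>n. F \<inter> cball x (t - 1 / Suc n) \<noteq> {}"
    then obtain n y where y: "y \<in> F" "dist x y \<le> t - 1 / real (Suc n)" by auto
    have "0 < 1 / real (Suc n)" by simp
    with y have "dist x y < t" by linarith
    with y show "F \<inter> ball x t \<noteq> {}" by auto
  qed
  moreover have "Measurable.pred N (\<lambda>\<omega>. \<exists>n. f \<omega> \<inter> cball (g \<omega>) (t - 1 / Suc n) \<noteq> {})"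
    by measurable
  ultimately show ?thesis by simp
qed

lemma measurable_touches:
  assumes [measurable]: "f \<in> measurable N fell" "g \<in> measurable N borel"
  shows "Measurable.pred N (\<lambda>\<omega>. f \<omega> \<inter> cball (g \<omega>) t \<noteq> {} \<and> f \<omega> \<inter> ball (g \<omega>) t = {})"
proof -
  note [measurable] = measurable_hits_ball[OF assms]
  have "Measurable.pred N (\<lambda>\<omega>. f \<omega> \<inter> cball (g \<omega>) t \<noteq> {} \<and> \<not> (f \<omega> \<inter> ball (g \<omega>) t \<noteq> {}))"
    by measurable
  then show ?thesis by simp
qed

section \<open>Distance spheres around a closed set\<close>

text \<open>Seen from a point of a set of small diameter, moving away strictly increases the distance to
  that set. Hence every ray from that point meets the set of points at distance \<open>t\<close> only once.\<close>

lemma negligible_sphere_around_small_set: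
  fixes F :: "'a::euclidean_space set"
  assumes F: "closed F" "F \<subseteq> cball a e" "F \<noteq> {}" and e: "0 < e" "2 * e < t"
  shows "negligible {x. infdist x F = t}"
proof (rule starlike_negligible_strong[of _ a])
  show "closed {x. infdist x F = t}"
    by (intro closed_Collect_eq continuous_intros)
next
  fix c :: real and x
  assume c: "0 \<le> c" "c < 1" and x: "a + x \<in> {x. infdist x F = t}"
  show "a + c *\<^sub>R x \<notin> {x. infdist x F = t}"
  proof
    assume cx: "a + c *\<^sub>R x \<in> {x. infdist x F = t}"
    obtain y where y: "y \<in> F" "infdist (a + x) F = dist (a + x) y"
      using infdist_attains_inf[OF F(1,3)] by metis
    define v where "v = a - y"
    have v: "norm v \<le> e" using y F(2) by (auto simp: v_def dist_norm)
    have t1: "norm (v + x) = t" using y x by (simp add: v_def dist_norm algebra_simps)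
    have "t \<le> dist (a + c *\<^sub>R x) y" using infdist_le[OF y(1)] cx by auto
    then have t2: "t \<le> norm (v + c *\<^sub>R x)" by (simp add: v_def dist_norm algebra_simps)
    have nx: "norm x > e" using norm_triangle_ineq[of v x] t1 v e by linarith
    \<comment> \<open>Since \<open>v + x\<close> and \<open>v + c x\<close> are longer than \<open>2e\<close>, both \<open>x\<close> and \<open>c x\<close> are longer than \<open>v\<close>.\<close>
    have cnx: "c * norm x > e"
      using norm_triangle_ineq[of v "c *\<^sub>R x"] t2 v e c by simp
    have "(norm (v + c *\<^sub>R x))\<^sup>2 \<ge> (norm (v + x))\<^sup>2" using t1 t2 by (intro power_mono) auto
    moreover have "(norm (v + x))\<^sup>2 - (norm (v + c *\<^sub>R x))\<^sup>2
        = (1 - c) * (2 * (v \<bullet> x) + (1 + c) * (norm x)\<^sup>2)"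
      unfolding power2_norm_eq_inner by (simp add: algebra_simps inner_commute power2_eq_square)
    moreover have "2 * (v \<bullet> x) + (1 + c) * (norm x)\<^sup>2 > 0"
    proof -
      have "v \<bullet> x \<ge> - (norm v * norm x)" using norm_cauchy_schwarz[of "-v" x] by simp
      moreover have "norm v * norm x \<le> e * norm x" using v by (intro mult_right_mono) auto
      moreover have "2 * (e * norm x) < (1 + c) * (norm x)\<^sup>2"
      proof -
        have "2 * e < (1 + c) * norm x" using nx cnx by (simp add: algebra_simps)
        then have "2 * e * norm x < (1 + c) * norm x * norm x"
          using nx e by (intro mult_strict_right_mono) auto
        then show ?thesis by (simp add: power2_eq_square)
      qed
      ultimately show ?thesis by linarith
    qed
    moreover have "1 - c > 0" using c by simp
    ultimately show False by (smt (verit) mult_pos_pos)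
  qed
qed

text \<open>A closed set is a countable union of closed pieces of small diameter, and a point at
  distance \<open>t\<close> from the set is at distance \<open>t\<close> from the piece that contains a nearest point.\<close>

lemma negligible_sphere_around_closed_set:
  fixes F :: "'a::euclidean_space set"
  assumes F: "closed F" and t: "0 < t"
  shows "negligible {x. F \<inter> cball x t \<noteq> {} \<and> F \<inter> ball x t = {}}"
proof -
  obtain D :: "'a set" where D: "countable D" "\<And>A. open A \<Longrightarrow> A \<noteq> {} \<Longrightarrow> \<exists>d\<in>D. d \<in> A"
    using countable_dense_exists by blast
  define e where "e = t / 3"
  define N where "N = (\<Union>q\<in>{q\<in>D. F \<inter> cball q e \<noteq> {}}. {x. infdist x (F \<inter> cball q e) = t})"
  have e: "0 < e" "2 * e < t" using t by (auto simp: e_def)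
  have "negligible N"
    unfolding N_def using D(1) F e
    by (intro negligible_countable_Union) (auto intro!: negligible_sphere_around_small_set)
  moreover have "{x. F \<inter> cball x t \<noteq> {} \<and> F \<inter> ball x t = {}} \<subseteq> N"
  proof
    fix x assume "x \<in> {x. F \<inter> cball x t \<noteq> {} \<and> F \<inter> ball x t = {}}"
    then obtain y where y: "y \<in> F" "dist x y \<le> t" and far: "\<And>z. z \<in> F \<Longrightarrow> t \<le> dist x z"
      by (fastforce simp: not_less)
    obtain q where q: "q \<in> D" "q \<in> ball y e" using D(2)[of "ball y e"] e by auto
    have yq: "y \<in> F \<inter> cball q e" using q y by (simp add: dist_commute)
    have "infdist x (F \<inter> cball q e) \<le> t" using infdist_le[OF yq, of x] y by simp
    moreover have "t \<le> infdist x (F \<inter> cball q e)"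
      using yq far by (auto simp: infdist_def intro!: cINF_greatest)
    ultimately have "infdist x (F \<inter> cball q e) = t" by simp
    then show "x \<in> N" using q yq unfolding N_def by blast
  qed
  ultimately show ?thesis by (rule negligible_subset)
qed

section \<open>Splitting off the cumulant of a distinguished point\<close>

abbreviation subtuple :: "(nat \<Rightarrow> 'z) \<Rightarrow> nat set \<Rightarrow> 'z list" where
  "subtuple z A \<equiv> map z (sorted_list_of_set A)"

text \<open>The left-hand side of the relation that defines the cumulant densities.\<close>

definition reweighted :: "('z list \<Rightarrow> real) \<Rightarrow> 'z list \<Rightarrow> real" where
  "reweighted p zs = p zs / (\<Prod>z\<leftarrow>zs. p [z])"

lemma sorted_list_of_set_strict_mono_image:
  fixes f :: "nat \<Rightarrow> nat"
  assumes "finite A" "strict_mono_on A f"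
  shows "sorted_list_of_set (f ` A) = map f (sorted_list_of_set A)"
proof -
  have "sorted_wrt (<) (map f (sorted_list_of_set A))"
    unfolding sorted_wrt_map
  proof (rule sorted_wrt_mono_rel[rotated])
    show "sorted_wrt (<) (sorted_list_of_set A)" by (rule strict_sorted_list_of_set)
  qed (use assms in \<open>simp add: strict_mono_on_def\<close>)
  moreover have "set (map f (sorted_list_of_set A)) = f ` A" using assms by simp
  ultimately show ?thesis
    by (metis sorted_list_of_set.idem_if_sorted_distinct strict_sorted_iff)
qed

lemma nths_eq_subtuple:
  assumes "D \<subseteq> {..<length xs}"
  shows "nths xs D = subtuple ((!) xs) D"
proof -
  have "nths xs D = nths (map ((!) xs) [0..<length xs]) D" by (simp add: map_nth)
  also have "\<dots> = map ((!) xs) (nths [0..<length xs] D)" by (rule nths_map)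
  also have "nths [0..<length xs] D = sorted_list_of_set D"
  proof -
    have "sorted_wrt (<) (nths [0..<length xs] D)"
      by (simp add: strict_sorted_iff sorted_nths distinct_nthsI)
    moreover have "set (nths [0..<length xs] D) = D"
      using assms by (auto simp: set_nths) (metis add_0 lessThan_iff nth_upt subsetD)
    ultimately show ?thesis
      by (metis sorted_list_of_set.idem_if_sorted_distinct strict_sorted_iff)
  qed
  finally show ?thesis .
qed

lemma partition_on_singleton_iff: "partition_on {a} P \<longleftrightarrow> P = {{a}}"
proof
  assume P: "partition_on {a} P"
  then have "D = {a}" if "D \<in> P" for D
    using that by (metis Sup_upper partition_onD1 partition_onD3 subset_singletonD)
  moreover have "P \<noteq> {}" using P by (auto simp: partition_on_def)
  ultimately show "P = {{a}}" by auto
qed (simp add: partition_on_space)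

lemma image_blocks_nonempty: "partition_on B P \<Longrightarrow> (`) h ` P - {{}} = (`) h ` P"
  by (auto simp: partition_on_def)

text \<open>Sums over partitions may be transported along an injection.\<close>

lemma sum_partitions_image:
  fixes g :: "'b set \<Rightarrow> 'c::comm_semiring_1"
  assumes e: "inj_on e A"
  shows "(\<Sum>P\<in>{P. partition_on (e ` A) P}. \<Prod>D\<in>P. g D) =
    (\<Sum>P\<in>{P. partition_on A P}. \<Prod>D\<in>P. g (e ` D))"
proof -
  have inj: "inj_on ((`) e) (Pow A)" using e by (simp add: inj_on_image_Pow)
  have sub: "P \<subseteq> Pow A" if "partition_on A P" for P
    using that by (auto simp: partition_on_def)
  note ne = image_blocks_nonempty
  have "bij_betw ((`) ((`) e)) {P. partition_on A P} {P. partition_on (e ` A) P}"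
    unfolding bij_betw_def
  proof
    show "inj_on ((`) ((`) e)) {P. partition_on A P}"
      using inj_on_image_Pow[OF inj] by (rule inj_on_subset) (use sub in blast)
    show "(`) ((`) e) ` {P. partition_on A P} = {P. partition_on (e ` A) P}"
    proof (intro equalityI subsetI)
      fix Q assume "Q \<in> (`) ((`) e) ` {P. partition_on A P}"
      then obtain P where P: "partition_on A P" "Q = (`) e ` P" by auto
      show "Q \<in> {P. partition_on (e ` A) P}"
        using partition_on_inj_image[OF P(1) e] ne[OF P(1), of e] P(2) by simp
    next
      fix Q assume "Q \<in> {P. partition_on (e ` A) P}"
      then have Q: "partition_on (e ` A) Q" by simp
      let ?h = "inv_into A e"
      have "partition_on (?h ` e ` A) ((`) ?h ` Q)"
        using partition_on_inj_image[OF Q inj_on_inv_into[OF subset_refl]] ne[OF Q, of ?h] by simp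
      then have P: "partition_on A ((`) ?h ` Q)" using e by simp
      have "e ` ?h ` D = D" if "D \<in> Q" for D
        using Q that by (intro image_inv_into_cancel[OF refl]) (auto simp: partition_on_def)
      then have "Q = (`) e ` (`) ?h ` Q" by (auto simp: image_image)
      with P show "Q \<in> (`) ((`) e) ` {P. partition_on A P}" by blast
    qed
  qed
  then have "(\<Sum>P\<in>{P. partition_on (e ` A) P}. \<Prod>D\<in>P. g D) =
      (\<Sum>P\<in>{P. partition_on A P}. \<Prod>D\<in>(`) e ` P. g D)"
    by (rule sum.reindex_bij_betw[symmetric])
  also have "\<dots> = (\<Sum>P\<in>{P. partition_on A P}. \<Prod>D\<in>P. g (e ` D))"
  proof (rule sum.cong[OF refl])
    fix P assume "P \<in> {P. partition_on A P}"
    then have "inj_on ((`) e) P" using sub inj by (auto intro: inj_on_subset)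
    then show "(\<Prod>D\<in>(`) e ` P. g D) = (\<Prod>D\<in>P. g (e ` D))" by (simp add: prod.reindex)
  qed
  finally show ?thesis .
qed

text \<open>The defining relation of the cumulants for the subfamily indexed by \<open>A\<close>, with blocks that are
  subsets of \<open>A\<close> itself: the increasing enumeration of \<open>A\<close> translates the positions in the list of
  the subfamily. In this form, partitions of different subfamilies can be combined.\<close>

lemma reweighted_eq_sum_partitions:
  assumes A: "finite A" and p: "p [] = 1" "\<And>z. p [z] \<noteq> 0"
  shows "reweighted p (subtuple z A) = (\<Sum>P\<in>{P. partition_on A P}. \<Prod>D\<in>P. \<xi> p (subtuple z D))"
proof (cases "2 \<le> card A")
  case False
  then consider "A = {}" | a where "A = {a}"
    using A by (metis card_0_eq card_1_singletonE less_2_cases not_le One_nat_def)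
  then show ?thesis
  proof cases
    case 1 then show ?thesis by (simp add: reweighted_def p partition_on_empty)
  next
    case 2 then show ?thesis by (simp add: reweighted_def p partition_on_singleton_iff \<xi>_singleton)
  qed
next
  case True
  let ?xs = "subtuple z A" and ?n = "{..<card A}"
  define e where "e = (!) (sorted_list_of_set A)"
  have e_mono: "strict_mono_on ?n e"
  proof (rule strict_mono_onI)
    fix i j assume "i \<in> ?n" "j \<in> ?n" "i < j"
    then show "e i < e j"
      unfolding e_def using A by (intro sorted_wrt_nth_less[OF strict_sorted_list_of_set]) auto
  qed
  have e_image: "e ` ?n = A"
  proof -
    have "A = set (sorted_list_of_set A)" using A by simp
    also have "\<dots> = {sorted_list_of_set A ! i | i. i < card A}" by (simp add: set_conv_nth)
    finally show ?thesis by (auto simp: e_def)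
  qed
  have sub: "nths ?xs D = subtuple z (e ` D)" if "D \<subseteq> ?n" for D
  proof -
    have "nths ?xs D = map z (nths (sorted_list_of_set A) D)" by (rule nths_map)
    also have "nths (sorted_list_of_set A) D = subtuple e D"
      unfolding e_def using that by (intro nths_eq_subtuple) simp
    also have "\<dots> = sorted_list_of_set (e ` D)"
      using that e_mono finite_subset[OF that]
      by (intro sorted_list_of_set_strict_mono_image[symmetric]) (auto simp: strict_mono_on_def)
    finally show ?thesis .
  qed
  have "reweighted p ?xs = (\<Sum>P\<in>{P. partition_on ?n P}. \<Prod>D\<in>P. \<xi> p (nths ?xs D))"
    unfolding reweighted_def using \<xi>_partitions[of ?xs p] True by simp
  also have "\<dots> = (\<Sum>P\<in>{P. partition_on ?n P}. \<Prod>D\<in>P. \<xi> p (subtuple z (e ` D)))"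
    by (intro sum.cong prod.cong refl arg_cong[of _ _ "\<xi> p"] sub) (auto simp: partition_on_def)
  also have "\<dots> = (\<Sum>P\<in>{P. partition_on (e ` ?n) P}. \<Prod>D\<in>P. \<xi> p (subtuple z D))"
    using e_mono by (intro sum_partitions_image[symmetric] strict_mono_on_imp_inj_on)
  finally show ?thesis by (simp add: e_image)
qed

text \<open>A partition of \<open>insert a A\<close> is given by the rest \<open>S\<close> of the block of \<open>a\<close> together with a
  partition of \<open>A - S\<close>.\<close>

lemma sum_partitions_insert:
  fixes g :: "'b set \<Rightarrow> 'c::comm_semiring_1"
  assumes A: "finite A" "a \<notin> A"
  shows "(\<Sum>P\<in>{P. partition_on (insert a A) P}. \<Prod>D\<in>P. g D) =
    (\<Sum>S\<in>Pow A. g (insert a S) * (\<Sum>P\<in>{P. partition_on (A - S) P}. \<Prod>D\<in>P. g D))"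
proof -
  have fresh: "insert a S \<notin> P" "a \<notin> \<Union>P" "disjnt (insert a S) (\<Union>P)"
    if "S \<subseteq> A" "partition_on (A - S) P" for S P
    using that A partition_onD1[OF that(2)] by (auto simp: disjnt_def)
  have "(\<Sum>S\<in>Pow A. g (insert a S) * (\<Sum>P\<in>{P. partition_on (A - S) P}. \<Prod>D\<in>P. g D)) =
      (\<Sum>(S, P)\<in>Sigma (Pow A) (\<lambda>S. {P. partition_on (A - S) P}). g (insert a S) * (\<Prod>D\<in>P. g D))"
    using A by (simp add: sum_distrib_left sum.Sigma finitely_many_partition_on)
  also have "\<dots> = (\<Sum>P\<in>{P. partition_on (insert a A) P}. \<Prod>D\<in>P. g D)"
  proof (rule sum.reindex_bij_witness[of _
        "\<lambda>P. (\<Union>{D\<in>P. a \<in> D} - {a}, {D\<in>P. a \<notin> D})" "\<lambda>(S, P). insert (insert a S) P"], goal_cases)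
    case (1 SP)
    then obtain S P where SP: "SP = (S, P)" "S \<subseteq> A" "partition_on (A - S) P" by auto
    have "{D \<in> insert (insert a S) P. a \<in> D} = {insert a S}"
      "{D \<in> insert (insert a S) P. a \<notin> D} = P"
      using fresh[OF SP(2,3)] by auto
    then show ?case using SP A by auto
  next
    case (2 SP)
    then obtain S P where SP: "SP = (S, P)" "S \<subseteq> A" "partition_on (A - S) P" by auto
    have "insert a A - insert a S = A - S" using A by auto
    then show ?case using SP fresh[OF SP(2,3)] by (auto simp: partition_on_insert)
  next
    case (3 P)
    then have P: "partition_on (insert a A) P" by simp
    then obtain D where D: "D \<in> P" "a \<in> D" by (auto simp: partition_on_def)
    have uniq: "{E\<in>P. a \<in> E} = {D}"
      using P D by (auto simp: partition_on_def pairwise_def disjnt_def)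
    have "insert a (D - {a}) = D" using D by auto
    moreover have "insert D {E\<in>P. a \<notin> E} = P" using D uniq by auto
    ultimately show ?case using uniq by simp
  next
    case (4 P)
    then have P: "partition_on (insert a A) P" by simp
    then obtain D where D: "D \<in> P" "a \<in> D" by (auto simp: partition_on_def)
    have uniq: "{E\<in>P. a \<in> E} = {D}"
      using P D by (auto simp: partition_on_def pairwise_def disjnt_def)
    have ins: "insert D {E\<in>P. a \<notin> E} = P" using D uniq by auto
    have "disjnt D (\<Union>{E\<in>P. a \<notin> E})"
      using P D by (auto simp: partition_on_def pairwise_def disjnt_def)
    then have "partition_on (insert a A - D) {E\<in>P. a \<notin> E}" "D \<subseteq> insert a A"
      using P ins partition_on_insert[of D "{E\<in>P. a \<notin> E}" "insert a A"] by auto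
    moreover have "insert a A - D = A - (D - {a})" using D A by auto
    ultimately show ?case using uniq by auto
  next
    case (5 SP)
    then obtain S P where SP: "SP = (S, P)" "S \<subseteq> A" "partition_on (A - S) P" by auto
    have "finite P" using A SP by (auto intro: finite_elements)
    then show ?case using fresh(1)[OF SP(2,3)] SP by simp
  qed
  finally show ?thesis by simp
qed

text \<open>The classical recursion of moments and cumulants: the block of the distinguished point
  contributes a cumulant, and the remaining points contribute their full reweighted moment.\<close>

lemma reweighted_Cons:
  assumes p: "p [] = 1" "\<And>z. p [z] \<noteq> 0"
  shows "reweighted p (y # map w [0..<n]) =
    (\<Sum>S\<in>Pow {..<n}. \<xi> p (y # subtuple w S) * reweighted p (subtuple w ({..<n} - S)))"
proof -
  define z where "z = case_nat y w"
  have sub0: "subtuple z (Suc ` S) = subtuple w S" if "finite S" for S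
    using that by (simp add: sorted_list_of_set_strict_mono_image strict_mono_on_def z_def)
  have sub1: "subtuple z (insert 0 (Suc ` S)) = y # subtuple w S" if "finite S" for S
  proof -
    have "sorted_list_of_set (insert 0 (Suc ` S)) = 0 # sorted_list_of_set (Suc ` S)"
    proof -
      have "insort 0 (sorted_list_of_set (Suc ` S)) = 0 # sorted_list_of_set (Suc ` S)"
        by (cases "sorted_list_of_set (Suc ` S)") auto
      then show ?thesis using that by (subst sorted_list_of_set_insert) auto
    qed
    then show ?thesis using sub0[OF that] by (simp add: z_def)
  qed
  have full: "sorted_list_of_set {..<n} = [0..<n]"
    by (simp add: lessThan_atLeast0)
  have "reweighted p (y # map w [0..<n]) = reweighted p (subtuple z (insert 0 (Suc ` {..<n})))"
    using sub1[of "{..<n}"] full by simp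
  also have "\<dots> = (\<Sum>P\<in>{P. partition_on (insert 0 (Suc ` {..<n})) P}. \<Prod>D\<in>P. \<xi> p (subtuple z D))"
    by (intro reweighted_eq_sum_partitions p) simp
  also have "\<dots> = (\<Sum>S\<in>Pow (Suc ` {..<n}). \<xi> p (subtuple z (insert 0 S)) *
      (\<Sum>P\<in>{P. partition_on (Suc ` {..<n} - S) P}. \<Prod>D\<in>P. \<xi> p (subtuple z D)))"
    by (intro sum_partitions_insert) auto
  also have "\<dots> = (\<Sum>S\<in>Pow (Suc ` {..<n}). \<xi> p (subtuple z (insert 0 S)) *
      reweighted p (subtuple z (Suc ` {..<n} - S)))"
    by (simp add: reweighted_eq_sum_partitions p)
  also have "Pow (Suc ` {..<n}) = (`) Suc ` Pow {..<n}" by (simp add: image_Pow_surj)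
  also have "(\<Sum>S\<in>(`) Suc ` Pow {..<n}. \<xi> p (subtuple z (insert 0 S)) *
      reweighted p (subtuple z (Suc ` {..<n} - S))) =
    (\<Sum>S\<in>Pow {..<n}. \<xi> p (subtuple z (insert 0 (Suc ` S))) *
      reweighted p (subtuple z (Suc ` {..<n} - Suc ` S)))"
    by (subst sum.reindex) (auto intro!: inj_on_image_Pow)
  also have "\<dots> = (\<Sum>S\<in>Pow {..<n}. \<xi> p (y # subtuple w S) * reweighted p (subtuple w ({..<n} - S)))"
  proof (intro sum.cong refl)
    fix S assume "S \<in> Pow {..<n}"
    then have "finite S" by (auto intro: finite_subset)
    moreover have "Suc ` {..<n} - Suc ` S = Suc ` ({..<n} - S)" by auto
    ultimately show "\<xi> p (subtuple z (insert 0 (Suc ` S))) * reweighted p (subtuple z (Suc ` {..<n} - Suc ` S)) =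
      \<xi> p (y # subtuple w S) * reweighted p (subtuple w ({..<n} - S))"
      using sub1[of S] sub0[of "{..<n} - S"] by simp
  qed
  finally show ?thesis .
qed

section \<open>Locally finite bivariate measures\<close>

lemma sets_marked_lebesgue: "sets (lborel \<Otimes>\<^sub>M count_space UNIV) = sets marked_space"
  unfolding marked_space_def by (intro sets_pair_measure_cong) auto

lemma space_marked_space [simp]: "space marked_space = UNIV"
  by (simp add: marked_space_def space_pair_measure)

lemma measurable_marked_spaceI:
  assumes "\<And>i. (\<lambda>x. f (x, i)) \<in> measurable borel N"
  shows "f \<in> measurable marked_space N"
proof -
  have "(\<lambda>z. f (fst z, snd z)) \<in> measurable marked_space N"
  proof (rule measurable_compose_countable'[where I=UNIV and f="\<lambda>i z. f (fst z, i)" and g=snd])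
    fix i
    show "(\<lambda>z. f (fst z, i)) \<in> measurable marked_space N"
      unfolding marked_space_def by (rule measurable_compose[OF measurable_fst assms])
    show "snd \<in> measurable marked_space (count_space UNIV)"
      unfolding marked_space_def by simp
  qed (simp add: countable_finite)
  then show ?thesis by simp
qed

lemma measurable_marked_section:
  "f \<in> measurable marked_space N \<Longrightarrow> (\<lambda>x. f (x, i)) \<in> measurable borel N"
  by (erule measurable_compose[rotated]) (simp add: marked_space_def)

lemma sets_marked_section:
  "A \<in> sets marked_space \<Longrightarrow> {x. (x, i) \<in> A} \<in> sets borel"
  using measurable_sets[OF measurable_marked_section[of "\<lambda>z. z" marked_space i], of A]
  by (simp add: vimage_def)

lemma sets_marked_Times [simp]: "B \<in> sets borel \<Longrightarrow> B \<times> {i} \<in> sets marked_space"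
  unfolding marked_space_def by (intro pair_measureI) auto

lemma nn_integral_marked_lebesgue:
  assumes f: "f \<in> borel_measurable marked_space"
  shows "(\<integral>\<^sup>+z. f z \<partial>(lborel \<Otimes>\<^sub>M count_space UNIV)) = (\<Sum>i\<in>UNIV. \<integral>\<^sup>+x. f (x, i) \<partial>lborel)"
proof -
  interpret P: pair_sigma_finite lborel "count_space (UNIV :: 2 set)"
    by (intro pair_sigma_finite.intro sigma_finite_measure_count_space_finite)
       (auto simp: lborel.sigma_finite_measure_axioms)
  have "f \<in> borel_measurable (lborel \<Otimes>\<^sub>M count_space UNIV)"
    using f measurable_cong_sets[OF sets_marked_lebesgue refl] by blast
  from P.nn_integral_snd[OF this] show ?thesis
    by (simp add: nn_integral_count_space_finite)
qed

lemma space_lf_algebra [simp]: "space lf_algebra = locally_finite_measures"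
proof -
  have "{} \<in> sets marked_space" by simp
  then show ?thesis unfolding lf_algebra_def space_Sup_eq_UN by auto
qed

lemma measurable_lf_algebraI:
  assumes "\<And>\<omega>. \<omega> \<in> space N \<Longrightarrow> f \<omega> \<in> locally_finite_measures"
    and "\<And>A. A \<in> sets marked_space \<Longrightarrow> (\<lambda>\<omega>. emeasure (f \<omega>) A) \<in> borel_measurable N"
  shows "f \<in> measurable N lf_algebra"
  unfolding lf_algebra_def
  using assms sets.empty_sets[of marked_space]
  by (intro measurable_SUP2 measurable_vimage_algebra2) auto

lemma measurable_evaluation [measurable]:
  "A \<in> sets marked_space \<Longrightarrow> (\<lambda>\<psi>. emeasure \<psi> A) \<in> borel_measurable lf_algebra"
  unfolding lf_algebra_def by (auto intro!: measurable_Sup1 measurable_vimage_algebra1)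

text \<open>By continuity from above, the mass of a closed ball is an upper semicontinuous function of its
  centre. Hence countably many evaluations decide whether the mass of a moving ball is small.\<close>

lemma emeasure_ball_less_iff_dense:
  fixes \<psi> :: "('a::euclidean_space \<times> 2) measure"
  assumes \<psi>: "\<psi> \<in> locally_finite_measures"
    and D: "\<And>A. open A \<Longrightarrow> A \<noteq> {} \<Longrightarrow> \<exists>d\<in>D. d \<in> (A :: 'a set)"
  shows "emeasure \<psi> (cball x t \<times> {i}) < c \<longleftrightarrow>
    (\<exists>n. \<exists>q\<in>D. dist x q < 1 / Suc n \<and> emeasure \<psi> (cball q (t + 1 / Suc n) \<times> {i}) < c)"
proof
  have sets: "cball y r \<times> {i} \<in> sets \<psi>" for y r
    using \<psi> by (simp add: locally_finite_measures_def)
  {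
    assume lt: "emeasure \<psi> (cball x t \<times> {i}) < c"
    let ?A = "\<lambda>n. cball x (t + 2 / Suc n) \<times> {i}"
    have Int: "(\<Inter>n. ?A n) = cball x t \<times> {i}"
    proof (intro equalityI subsetI)
      fix z assume z: "z \<in> (\<Inter>n. ?A n)"
      then have "snd z = i" and d: "dist x (fst z) \<le> t + 2 / Suc n" for n by auto
      have "(\<lambda>n. t + 2 * (1 / real (Suc n))) \<longlonglongrightarrow> t + 2 * 0"
        by (intro tendsto_intros LIMSEQ_inverse_real_of_nat[unfolded inverse_eq_divide])
      then have "dist x (fst z) \<le> t" using d by (intro LIMSEQ_le_const[where X="\<lambda>n. t + 2 / Suc n"]) auto
      with \<open>snd z = i\<close> show "z \<in> cball x t \<times> {i}" by (cases z) auto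
    next
      fix z assume "z \<in> cball x t \<times> {i}"
      then have "dist x (fst z) \<le> t" "snd z = i" by auto
      moreover have "0 \<le> 2 / real (Suc n)" for n by simp
      ultimately have "dist x (fst z) \<le> t + 2 / real (Suc n)" for n by (smt (verit))
      with \<open>snd z = i\<close> show "z \<in> (\<Inter>n. ?A n)" by (cases z) auto
    qed
    have "(\<lambda>n. emeasure \<psi> (?A n)) \<longlonglongrightarrow> emeasure \<psi> (\<Inter>n. ?A n)"
    proof (rule Lim_emeasure_decseq)
      show "range ?A \<subseteq> sets \<psi>" using sets by auto
      show "decseq ?A"
      proof (rule decseq_SucI)
        fix n
        have "2 / real (Suc (Suc n)) \<le> 2 / real (Suc n)" by (intro divide_left_mono) auto
        then have "cball x (t + 2 / Suc (Suc n)) \<subseteq> cball x (t + 2 / Suc n)"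
          by (intro subset_cball) simp
        then show "?A (Suc n) \<le> ?A n" by (rule Sigma_mono) simp
      qed
      show "emeasure \<psi> (?A n) \<noteq> \<infinity>" for n
        using \<psi> by (simp add: locally_finite_measures_def less_top[symmetric])
    qed
    then have "(\<lambda>n. emeasure \<psi> (?A n)) \<longlonglongrightarrow> emeasure \<psi> (cball x t \<times> {i})" unfolding Int .
    from order_tendstoD(2)[OF this lt] obtain n where n: "emeasure \<psi> (?A n) < c" by (auto simp: eventually_sequentially)
    obtain q where q: "q \<in> D" "q \<in> ball x (1 / Suc n)"
      using D[of "ball x (1 / Suc n)"] by auto
    have sub: "cball q (t + 1 / Suc n) \<times> {i} \<subseteq> ?A n"
    proof -
      have "dist x y \<le> t + 2 / Suc n" if "dist q y \<le> t + 1 / Suc n" for y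
        using dist_triangle[of x y q] that q by (simp add: add_divide_distrib[symmetric])
      then show ?thesis by auto
    qed
    have "emeasure \<psi> (cball q (t + 1 / Suc n) \<times> {i}) < c"
      using emeasure_mono[OF sub sets] n by (rule le_less_trans)
    with q show "\<exists>n. \<exists>q\<in>D. dist x q < 1 / Suc n \<and> emeasure \<psi> (cball q (t + 1 / Suc n) \<times> {i}) < c"
      by (intro exI[of _ n] bexI[of _ q]) auto
  next
    assume "\<exists>n. \<exists>q\<in>D. dist x q < 1 / Suc n \<and> emeasure \<psi> (cball q (t + 1 / Suc n) \<times> {i}) < c"
    then obtain n q where q: "dist x q < 1 / Suc n" "emeasure \<psi> (cball q (t + 1 / Suc n) \<times> {i}) < c"
      by blast
    have "dist q y \<le> t + 1 / Suc n" if "dist x y \<le> t" for y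
      using dist_triangle[of q y x] that q(1) by (simp add: dist_commute)
    then have "cball x t \<times> {i} \<subseteq> cball q (t + 1 / Suc n) \<times> {i}" by auto
    from emeasure_mono[OF this sets] q(2) show "emeasure \<psi> (cball x t \<times> {i}) < c"
      by (rule le_less_trans)
  }
qed

lemma measurable_evaluation_cball:
  fixes f :: "'w \<Rightarrow> 'a::euclidean_space"
  assumes [measurable]: "f \<in> measurable N borel" and g [measurable]: "g \<in> measurable N lf_algebra"
  shows "(\<lambda>\<omega>. emeasure (g \<omega>) (cball (f \<omega>) t \<times> {i})) \<in> borel_measurable N"
proof (rule borel_measurableI_less)
  fix c
  obtain D :: "'a set" where D: "countable D" "\<And>A. open A \<Longrightarrow> A \<noteq> {} \<Longrightarrow> \<exists>d\<in>D. d \<in> A"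
    using countable_dense_exists by blast
  have [measurable]: "(\<lambda>\<omega>. emeasure (g \<omega>) (cball q r \<times> {i})) \<in> borel_measurable N" for q r
    by (rule measurable_compose[OF g measurable_evaluation]) simp
  have "Measurable.pred N (\<lambda>\<omega>. \<exists>n. \<exists>q\<in>D. dist (f \<omega>) q < 1 / Suc n \<and>
      emeasure (g \<omega>) (cball q (t + 1 / Suc n) \<times> {i}) < c)"
    using D(1) by measurable
  also have "?this \<longleftrightarrow> Measurable.pred N (\<lambda>\<omega>. emeasure (g \<omega>) (cball (f \<omega>) t \<times> {i}) < c)"
    using measurable_space[OF g]
    by (intro measurable_cong emeasure_ball_less_iff_dense[symmetric] D(2)) auto
  finally show "{\<omega>\<in>space N. emeasure (g \<omega>) (cball (f \<omega>) t \<times> {i}) < c} \<in> sets N"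
    by (simp add: pred_def)
qed

lemma measurable_measure_cball:
  fixes f :: "'w \<Rightarrow> 'a::euclidean_space"
  assumes "f \<in> measurable N borel" "g \<in> measurable N lf_algebra"
  shows "(\<lambda>\<omega>. measure (g \<omega>) (cball (f \<omega>) t \<times> {i})) \<in> borel_measurable N"
  unfolding measure_def by (intro borel_measurable_enn2real measurable_evaluation_cball assms)

section \<open>The coverage measure as a random measure\<close>

lemma sets_coverage_measure [simp]: "sets (coverage_measure X \<omega>) = sets marked_space"
  by (simp add: coverage_measure_def sets_marked_lebesgue)

lemma nn_integral_coverage_measure:
  assumes cl: "\<And>i. closed (X i \<omega>)" and f: "f \<in> borel_measurable marked_space"
  shows "(\<integral>\<^sup>+z. f z \<partial>coverage_measure X \<omega>) = (\<Sum>i\<in>UNIV. \<integral>\<^sup>+x. indicator (X i \<omega>) x * f (x, i) \<partial>lborel)"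
proof -
  have d: "(\<lambda>(x, i). indicator (X i \<omega>) x :: ennreal) \<in> borel_measurable marked_space"
    using cl by (intro measurable_marked_spaceI) auto
  have "(\<integral>\<^sup>+z. f z \<partial>coverage_measure X \<omega>) =
      (\<integral>\<^sup>+z. (case z of (x, i) \<Rightarrow> indicator (X i \<omega>) x) * f z \<partial>(lborel \<Otimes>\<^sub>M count_space UNIV))"
    unfolding coverage_measure_def
    using d f by (intro nn_integral_density) (simp_all add: measurable_cong_sets[OF sets_marked_lebesgue refl])
  also have "\<dots> = (\<Sum>i\<in>UNIV. \<integral>\<^sup>+x. indicator (X i \<omega>) x * f (x, i) \<partial>lborel)"
    by (subst nn_integral_marked_lebesgue) (use d f in auto)
  finally show ?thesis .
qed

lemma emeasure_coverage_measure:
  assumes cl: "\<And>i. closed (X i \<omega>)" and A: "A \<in> sets marked_space"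
  shows "emeasure (coverage_measure X \<omega>) A = (\<Sum>i\<in>UNIV. emeasure lborel (X i \<omega> \<inter> {x. (x, i) \<in> A}))"
proof -
  have "emeasure (coverage_measure X \<omega>) A = (\<integral>\<^sup>+z. indicator A z \<partial>coverage_measure X \<omega>)"
    using A by simp
  also have "\<dots> = (\<Sum>i\<in>UNIV. \<integral>\<^sup>+x. indicator (X i \<omega>) x * indicator A (x, i) \<partial>lborel)"
    using A cl by (intro nn_integral_coverage_measure) auto
  also have "\<dots> = (\<Sum>i\<in>UNIV. \<integral>\<^sup>+x. indicator (X i \<omega> \<inter> {x. (x, i) \<in> A}) x \<partial>lborel)"
    by (intro sum.cong nn_integral_cong refl) (auto simp: indicator_def)
  also have "\<dots> = (\<Sum>i\<in>UNIV. emeasure lborel (X i \<omega> \<inter> {x. (x, i) \<in> A}))"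
    using sets_marked_section[OF A] cl by (intro sum.cong refl nn_integral_indicator) auto
  finally show ?thesis .
qed

lemma emeasure_coverage_measure_Times:
  assumes cl: "\<And>i. closed (X i \<omega>)" and B: "B \<in> sets borel"
  shows "emeasure (coverage_measure X \<omega>) (B \<times> {i}) = emeasure lborel (X i \<omega> \<inter> B)"
proof -
  have "emeasure (coverage_measure X \<omega>) (B \<times> {i}) =
      (\<Sum>j\<in>UNIV. emeasure lborel (X j \<omega> \<inter> {x. (x, j) \<in> B \<times> {i}}))"
    using cl B by (intro emeasure_coverage_measure) auto
  also have "\<dots> = (\<Sum>j\<in>UNIV. if j = i then emeasure lborel (X i \<omega> \<inter> B) else 0)"
    by (intro sum.cong) auto
  finally show ?thesis by simp
qed

lemma measurable_coverage_measure:
  fixes X :: "2 \<Rightarrow> 'w \<Rightarrow> 'a::euclidean_space set"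
  assumes X: "\<And>i. X i \<in> measurable N fell"
  shows "coverage_measure X \<in> measurable N lf_algebra"
proof (rule measurable_lf_algebraI)
  have cl: "closed (X i \<omega>)" if "\<omega> \<in> space N" for i \<omega>
    using measurable_space[OF X that] by simp
  {
    fix \<omega> assume \<omega>: "\<omega> \<in> space N"
    have "emeasure (coverage_measure X \<omega>) (B \<times> {i}) < \<infinity>" if "B \<in> sets borel" "bounded B" for B i
    proof -
      have "emeasure (coverage_measure X \<omega>) (B \<times> {i}) = emeasure lborel (X i \<omega> \<inter> B)"
        using cl[OF \<omega>] that by (intro emeasure_coverage_measure_Times)
      also have "\<dots> \<le> emeasure lborel B" using that by (intro emeasure_mono) auto
      also have "\<dots> < \<infinity>" using emeasure_bounded_finite[OF that(2)] by simp
      finally show ?thesis .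
    qed
    then show "coverage_measure X \<omega> \<in> locally_finite_measures"
      by (simp add: locally_finite_measures_def)
  next
    fix A :: "('a \<times> 2) set" assume A: "A \<in> sets marked_space"
    have "(\<lambda>\<omega>. \<Sum>i\<in>UNIV. emeasure lborel (X i \<omega> \<inter> {x. (x, i) \<in> A})) \<in> borel_measurable N"
      using sets_marked_section[OF A] X by (intro borel_measurable_sum measurable_volume)
    also have "?this \<longleftrightarrow> (\<lambda>\<omega>. emeasure (coverage_measure X \<omega>) A) \<in> borel_measurable N"
      using cl A by (intro measurable_cong emeasure_coverage_measure[symmetric])
    finally show "(\<lambda>\<omega>. emeasure (coverage_measure X \<omega>) A) \<in> borel_measurable N" .
  }
qed

lemma measurable_mark_shift: "(\<lambda>(y, j). (y + a, j)) \<in> measurable marked_space marked_space"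
  unfolding marked_space_def by measurable

text \<open>Translation invariance of Lebesgue measure makes the passage from a closed set to its coverage
  measure commute with translations.\<close>

lemma distr_shift_coverage_measure:
  fixes X :: "2 \<Rightarrow> 'w \<Rightarrow> 'a::euclidean_space set"
  assumes cl: "\<And>i. closed (X i \<omega>)"
  shows "distr (coverage_measure X \<omega>) marked_space (\<lambda>(y, j). (y + a, j)) = coverage_measure (translated a X) \<omega>"
proof (rule measure_eqI)
  fix A assume "A \<in> sets (distr (coverage_measure X \<omega>) marked_space (\<lambda>(y, j). (y + a, j)))"
  then have A: "A \<in> sets marked_space" by simp
  let ?f = "\<lambda>(y::'a, j::2). (y + a, j)"
  have f: "?f \<in> measurable (coverage_measure X \<omega>) marked_space"
    using measurable_mark_shift[of a] by (simp add: measurable_cong_sets[OF sets_coverage_measure refl])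
  have sp: "space (coverage_measure X \<omega>) = UNIV"
    using sets_eq_imp_space_eq[OF sets_coverage_measure[of X \<omega>]] by simp
  have cl': "closed (translated a X i \<omega>)" for i
    using closed_translation[OF cl[of i], of a] by (simp add: translated_def add.commute)
  have "emeasure (distr (coverage_measure X \<omega>) marked_space ?f) A = emeasure (coverage_measure X \<omega>) (?f -` A)"
    using emeasure_distr[OF f A] sp by simp
  also have "\<dots> = (\<Sum>i\<in>UNIV. emeasure lborel (X i \<omega> \<inter> {x. (x, i) \<in> ?f -` A}))"
    using measurable_sets[OF f A] sp by (intro emeasure_coverage_measure cl) simp
  also have "\<dots> = (\<Sum>i\<in>UNIV. emeasure lborel (translated a X i \<omega> \<inter> {x. (x, i) \<in> A}))"
  proof (intro sum.cong refl)
    fix i :: 2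
    have B: "translated a X i \<omega> \<inter> {x. (x, i) \<in> A} \<in> sets borel"
      using cl' sets_marked_section[OF A] by auto
    have "emeasure lborel (translated a X i \<omega> \<inter> {x. (x, i) \<in> A}) =
        emeasure (distr lborel borel ((+) a)) (translated a X i \<omega> \<inter> {x. (x, i) \<in> A})"
      by (simp add: lborel_distr_plus)
    also have "\<dots> = emeasure lborel ((+) a -` (translated a X i \<omega> \<inter> {x. (x, i) \<in> A}))"
      using B by (subst emeasure_distr) auto
    also have "(+) a -` (translated a X i \<omega> \<inter> {x. (x, i) \<in> A}) = X i \<omega> \<inter> {x. (x, i) \<in> ?f -` A}"
      by (auto simp: translated_def add.commute)
    finally show "emeasure lborel (X i \<omega> \<inter> {x. (x, i) \<in> ?f -` A}) =
      emeasure lborel (translated a X i \<omega> \<inter> {x. (x, i) \<in> A})" by simp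
  qed
  also have "\<dots> = emeasure (coverage_measure (translated a X) \<omega>) A"
    using cl' A by (intro emeasure_coverage_measure[symmetric])
  finally show "emeasure (distr (coverage_measure X \<omega>) marked_space ?f) A =
    emeasure (coverage_measure (translated a X) \<omega>) A" .
qed simp

lemma measurable_measure_shift:
  "(\<lambda>\<psi>. distr \<psi> marked_space (\<lambda>(y, j). (y + a, j))) \<in> measurable lf_algebra (lf_algebra :: ('a::euclidean_space \<times> 2) measure measure)"
proof (rule measurable_lf_algebraI)
  let ?f = "\<lambda>(y::'a, j::2). (y + a, j)"
  have f: "?f \<in> measurable \<psi> marked_space" if "\<psi> \<in> locally_finite_measures" for \<psi>
    using measurable_mark_shift[of a] that
    by (simp add: locally_finite_measures_def measurable_cong_sets[OF _ refl, of \<psi> marked_space])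
  have sp: "space \<psi> = UNIV" if "\<psi> \<in> locally_finite_measures" for \<psi> :: "('a \<times> 2) measure"
    using that sets_eq_imp_space_eq[of \<psi> marked_space] by (simp add: locally_finite_measures_def)
  have em: "emeasure (distr \<psi> marked_space ?f) A = emeasure \<psi> (?f -` A)"
    if "\<psi> \<in> locally_finite_measures" "A \<in> sets marked_space" for \<psi> A
    using emeasure_distr[OF f that(2)] sp that by simp
  {
    fix \<psi> :: "('a \<times> 2) measure" assume "\<psi> \<in> space lf_algebra"
    then have \<psi>: "\<psi> \<in> locally_finite_measures" by simp
    have "emeasure (distr \<psi> marked_space ?f) (B \<times> {i}) < \<infinity>"
      if B: "B \<in> sets borel" "bounded B" for B i
    proof -
      have "?f -` (B \<times> {i}) = (\<lambda>x. x - a) ` B \<times> {i}"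
        by (auto simp: image_iff algebra_simps intro!: bexI[of _ "_ + a"])
      moreover have "(\<lambda>x. x - a) ` B = (\<lambda>x. x + a) -` B" by (auto simp: image_iff intro!: bexI[of _ "_ + a"])
      then have "(\<lambda>x. x - a) ` B \<in> sets borel"
        using measurable_sets_borel[of "\<lambda>x. x + a" borel B] B by simp
      moreover have "bounded ((\<lambda>x. x - a) ` B)"
        using B(2) bounded_translation_minus by blast
      ultimately show ?thesis using em[OF \<psi>, of "B \<times> {i}"] \<psi> B
        by (simp add: locally_finite_measures_def)
    qed
    then show "distr \<psi> marked_space ?f \<in> locally_finite_measures"
      by (simp add: locally_finite_measures_def)
  next
    fix A :: "('a \<times> 2) set" assume A: "A \<in> sets marked_space"
    have "?f -` A \<in> sets marked_space"
      using measurable_sets[OF measurable_mark_shift A] by simp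
    then have "(\<lambda>\<psi>. emeasure \<psi> (?f -` A)) \<in> borel_measurable lf_algebra" by simp
    also have "?this \<longleftrightarrow> (\<lambda>\<psi>. emeasure (distr \<psi> marked_space ?f) A) \<in> borel_measurable lf_algebra"
      using em A by (intro measurable_cong) simp
    finally show "(\<lambda>\<psi>. emeasure (distr \<psi> marked_space ?f) A) \<in> borel_measurable lf_algebra" .
  }
qed

section \<open>Coverage functions of random closed sets\<close>

locale closed_pair_space = prob_space M for M :: "'w measure" +
  fixes X :: "2 \<Rightarrow> 'w \<Rightarrow> 'a::euclidean_space set"
  assumes closed_pair: "random_closed_pair M X"
begin

lemma measurable_X [measurable]: "X i \<in> measurable M fell"
  using closed_pair by (simp add: random_closed_pair_def)

lemma closed_X: "\<omega> \<in> space M \<Longrightarrow> closed (X i \<omega>)"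
  using measurable_space[OF measurable_X] by auto

lemma cover_event [measurable]: "{\<omega>\<in>space M. x \<in> X i \<omega>} \<in> events"
  by measurable

text \<open>Fubini's theorem applied to the indicator that all points of a tuple are covered.\<close>

lemma nn_integral_cover_tuple:
  fixes i :: "'j \<Rightarrow> 2"
  assumes A [measurable]: "A \<in> events" and J: "finite J" and B: "\<And>j. j \<in> J \<Longrightarrow> B j \<in> sets borel"
  defines "cov \<equiv> \<lambda>x. {\<omega>\<in>A. \<forall>j\<in>J. x j \<in> X (i j) \<omega>}"
  shows "(\<integral>\<^sup>+x. ennreal (prob (cov x)) * indicator (Pi\<^sub>E J B) x \<partial>(\<Pi>\<^sub>M j\<in>J. lborel)) =
      (\<integral>\<^sup>+\<omega>. indicator A \<omega> * (\<Prod>j\<in>J. emeasure lborel (X (i j) \<omega> \<inter> B j)) \<partial>M)"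
    and "(\<lambda>x. prob (cov x)) \<in> borel_measurable (\<Pi>\<^sub>M j\<in>J. lborel)"
proof -
  let ?L = "\<Pi>\<^sub>M j\<in>J. (lborel :: 'a measure)"
  interpret L: product_sigma_finite "\<lambda>_::'j. lborel :: 'a measure"
    by (rule product_sigma_finite.intro) (rule lborel.sigma_finite_measure_axioms)
  interpret LJ: sigma_finite_measure ?L by (rule L.sigma_finite[OF J])
  interpret P: pair_sigma_finite M ?L
    by (intro pair_sigma_finite.intro sigma_finite_measure_axioms LJ.sigma_finite_measure_axioms)
  have coord: "(\<lambda>x. x j) \<in> measurable ?L borel" if "j \<in> J" for j
    using measurable_component_singleton[OF that, of "\<lambda>_. lborel"] by simp
  have comp: "(\<lambda>z. snd z j) \<in> measurable (M \<Otimes>\<^sub>M ?L) borel" if "j \<in> J" for j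
    by (rule measurable_compose[OF measurable_snd coord[OF that]])
  have ind: "(\<lambda>z. indicator {\<omega>. snd z j \<in> X (i j) \<omega>} (fst z) :: ennreal) \<in> borel_measurable (M \<Otimes>\<^sub>M ?L)"
    if "j \<in> J" for j
  proof -
    have "Measurable.pred (M \<Otimes>\<^sub>M ?L) (\<lambda>z. snd z j \<in> X (i j) (fst z))"
      by (intro measurable_mem_closed_set comp that measurable_compose[OF measurable_fst measurable_X])
    then show ?thesis unfolding indicator_def by simp
  qed
  have indB: "(\<lambda>x. indicator (B j) (x j) :: ennreal) \<in> borel_measurable ?L" if "j \<in> J" for j
    by (intro measurable_compose[OF coord[OF that]] borel_measurable_indicator B that)
  define h where "h \<omega> x = indicator A \<omega> * (\<Prod>j\<in>J. indicator {\<omega>. x j \<in> X (i j) \<omega>} \<omega> :: ennreal)" for \<omega> and x :: "'j \<Rightarrow> 'a"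
  have h: "case_prod h \<in> borel_measurable (M \<Otimes>\<^sub>M ?L)"
    unfolding h_def case_prod_beta using ind
    by (intro borel_measurable_times_ennreal borel_measurable_prod_ennreal) simp_all
  have h_swap: "(\<lambda>(x, \<omega>). h \<omega> x) \<in> borel_measurable (?L \<Otimes>\<^sub>M M)"
    using measurable_pair_swap[OF h] by (simp add: case_prod_beta)
  have cov_ev: "cov x \<in> events" for x
    unfolding cov_def using sets.sets_into_space[OF A] J
    by (auto intro!: sets.sets_Collect_finite_All' sets.sets_Collect simp: Collect_conj_eq[symmetric])
  have cov_eq: "ennreal (prob (cov x)) = (\<integral>\<^sup>+\<omega>. h \<omega> x \<partial>M)" for x
  proof -
    have "ennreal (prob (cov x)) = (\<integral>\<^sup>+\<omega>. indicator (cov x) \<omega> \<partial>M)"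
      using cov_ev by (simp add: emeasure_eq_measure)
    also have "\<dots> = (\<integral>\<^sup>+\<omega>. h \<omega> x \<partial>M)"
    proof (intro nn_integral_cong)
      fix \<omega>
      have "(\<Prod>j\<in>J. indicator {\<omega>. x j \<in> X (i j) \<omega>} \<omega> :: ennreal) = of_bool (\<forall>j\<in>J. x j \<in> X (i j) \<omega>)"
        using J by (induction J) (auto simp: indicator_def)
      then show "indicator (cov x) \<omega> = h \<omega> x" by (auto simp: h_def cov_def indicator_def)
    qed
    finally show ?thesis .
  qed
  have "(\<lambda>x. \<integral>\<^sup>+\<omega>. h \<omega> x \<partial>M) \<in> borel_measurable ?L"
    by (rule borel_measurable_nn_integral[OF h_swap])
  then have "(\<lambda>x. enn2real (\<integral>\<^sup>+\<omega>. h \<omega> x \<partial>M)) \<in> borel_measurable ?L" by measurable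
  then show "(\<lambda>x. prob (cov x)) \<in> borel_measurable ?L" by (simp flip: cov_eq)
  have indPi: "indicator (Pi\<^sub>E J B) x = (\<Prod>j\<in>J. indicator (B j) (x j) :: ennreal)" if "x \<in> space ?L" for x
  proof -
    have "(\<Prod>j\<in>J. indicator (B j) (x j) :: ennreal) = of_bool (\<forall>j\<in>J. x j \<in> B j)"
      using J by (induction J) (auto simp: indicator_def)
    then show ?thesis using that by (auto simp: space_PiM PiE_iff indicator_def)
  qed
  have indPi_meas: "(\<lambda>x. indicator (Pi\<^sub>E J B) x :: ennreal) \<in> borel_measurable ?L"
    using indB by (subst measurable_cong[OF indPi]) (auto intro!: borel_measurable_prod_ennreal)
  have "(\<integral>\<^sup>+x. ennreal (prob (cov x)) * indicator (Pi\<^sub>E J B) x \<partial>?L) =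
      (\<integral>\<^sup>+x. \<integral>\<^sup>+\<omega>. h \<omega> x * indicator (Pi\<^sub>E J B) x \<partial>M \<partial>?L)"
  proof (intro nn_integral_cong)
    fix x assume "x \<in> space ?L"
    then have "(\<lambda>\<omega>. h \<omega> x) \<in> borel_measurable M" using measurable_Pair2[OF h_swap] by simp
    then show "ennreal (prob (cov x)) * indicator (Pi\<^sub>E J B) x = (\<integral>\<^sup>+\<omega>. h \<omega> x * indicator (Pi\<^sub>E J B) x \<partial>M)"
      by (simp add: cov_eq nn_integral_multc)
  qed
  also have "\<dots> = (\<integral>\<^sup>+\<omega>. \<integral>\<^sup>+x. h \<omega> x * indicator (Pi\<^sub>E J B) x \<partial>?L \<partial>M)"
    using h indPi_meas by (intro P.Fubini') (auto simp: case_prod_beta)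
  also have "\<dots> = (\<integral>\<^sup>+\<omega>. indicator A \<omega> * (\<Prod>j\<in>J. emeasure lborel (X (i j) \<omega> \<inter> B j)) \<partial>M)"
  proof (intro nn_integral_cong)
    fix \<omega> assume \<omega>: "\<omega> \<in> space M"
    have S: "X (i j) \<omega> \<inter> B j \<in> sets lborel" if "j \<in> J" for j
      using closed_X[OF \<omega>] B[OF that] by auto
    have "(\<integral>\<^sup>+x. h \<omega> x * indicator (Pi\<^sub>E J B) x \<partial>?L) =
        (\<integral>\<^sup>+x. indicator A \<omega> * (\<Prod>j\<in>J. indicator (X (i j) \<omega> \<inter> B j) (x j)) \<partial>?L)"
    proof (intro nn_integral_cong)
      fix x assume x: "x \<in> space ?L"
      have "(\<Prod>j\<in>J. indicator {\<omega>. x j \<in> X (i j) \<omega>} \<omega>) * (\<Prod>j\<in>J. indicator (B j) (x j)) =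
          (\<Prod>j\<in>J. indicator (X (i j) \<omega> \<inter> B j) (x j) :: ennreal)"
        unfolding prod.distrib[symmetric] by (rule prod.cong) (auto simp: indicator_def)
      then show "h \<omega> x * indicator (Pi\<^sub>E J B) x =
          indicator A \<omega> * (\<Prod>j\<in>J. indicator (X (i j) \<omega> \<inter> B j) (x j))"
        by (simp only: h_def indPi[OF x] mult.assoc)
    qed
    also have "\<dots> = indicator A \<omega> * (\<integral>\<^sup>+x. (\<Prod>j\<in>J. indicator (X (i j) \<omega> \<inter> B j) (x j)) \<partial>?L)"
    proof (rule nn_integral_cmult)
      show "(\<lambda>x. \<Prod>j\<in>J. indicator (X (i j) \<omega> \<inter> B j) (x j) :: ennreal) \<in> borel_measurable ?L"
      proof (rule borel_measurable_prod_ennreal)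
        fix j assume j: "j \<in> J"
        show "(\<lambda>x. indicator (X (i j) \<omega> \<inter> B j) (x j) :: ennreal) \<in> borel_measurable ?L"
          using S[OF j] by (intro measurable_compose[OF coord[OF j]] borel_measurable_indicator) simp
      qed
    qed
    also have "(\<integral>\<^sup>+x. (\<Prod>j\<in>J. indicator (X (i j) \<omega> \<inter> B j) (x j)) \<partial>?L) =
        (\<Prod>j\<in>J. \<integral>\<^sup>+x. indicator (X (i j) \<omega> \<inter> B j) x \<partial>lborel)"
      using S by (intro L.product_nn_integral_prod J) auto
    also have "\<dots> = (\<Prod>j\<in>J. emeasure lborel (X (i j) \<omega> \<inter> B j))"
      using S by (intro prod.cong refl nn_integral_indicator)
    finally show "(\<integral>\<^sup>+x. h \<omega> x * indicator (Pi\<^sub>E J B) x \<partial>?L) =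
      indicator A \<omega> * (\<Prod>j\<in>J. emeasure lborel (X (i j) \<omega> \<inter> B j))" .
  qed
  finally show "(\<integral>\<^sup>+x. ennreal (prob (cov x)) * indicator (Pi\<^sub>E J B) x \<partial>?L) =
      (\<integral>\<^sup>+\<omega>. indicator A \<omega> * (\<Prod>j\<in>J. emeasure lborel (X (i j) \<omega> \<inter> B j)) \<partial>M)" .
qed

lemma cover_prob_map:
  "cover_prob M X (map (\<lambda>j. (x j, i j)) js) = prob {\<omega>\<in>space M. \<forall>j\<in>set js. x j \<in> X (i j) \<omega>}"
  unfolding cover_prob_def by (rule arg_cong[of _ _ prob]) auto

lemma cover_prob_Cons_map:
  "cover_prob M X ((y, l) # map (\<lambda>j. (x j, i j)) js) =
    prob {\<omega>\<in>{\<omega>\<in>space M. y \<in> X l \<omega>}. \<forall>j\<in>set js. x j \<in> X (i j) \<omega>}"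
  unfolding cover_prob_def by (rule arg_cong[of _ _ prob]) auto

lemma cover_prob_singleton: "cover_prob M X [(x, i)] = \<P>(\<omega> in M. x \<in> X i \<omega>)"
  by (simp add: cover_prob_def)

lemma cover_prob_Nil: "cover_prob M X [] = 1"
  by (simp add: cover_prob_def prob_space)

lemma coverage_function_cover_prob: "coverage_function M (coverage_measure X) (cover_prob M X)"
  unfolding coverage_function_def
proof (intro conjI allI impI)
  show "0 \<le> cover_prob M X zs" for zs by (simp add: cover_prob_def)
next
  fix k :: nat and i :: "nat \<Rightarrow> 2"
  note tuple = nn_integral_cover_tuple[of "space M" "{..<k}" _ i, OF sets.top finite_lessThan]
  have eq: "cover_prob M X (marked_tuple k x i) = prob {\<omega>\<in>space M. \<forall>j\<in>{..<k}. x j \<in> X (i j) \<omega>}" for x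
    unfolding cover_prob_map by (simp add: atLeast0LessThan)
  show "(\<lambda>x. cover_prob M X (marked_tuple k x i)) \<in> borel_measurable (\<Pi>\<^sub>M j\<in>{..<k}. lborel)"
    unfolding eq by (rule tuple(2)[of "\<lambda>_. {}"]) simp
  fix B assume B: "\<forall>j<k. B j \<in> sets borel \<and> bounded (B j :: 'a set)"
  have mom: "moment M (coverage_measure X) k i B =
      (\<integral>\<^sup>+\<omega>. indicator (space M) \<omega> * (\<Prod>j<k. emeasure lborel (X (i j) \<omega> \<inter> B j)) \<partial>M)"
    unfolding moment_def
    using B closed_X by (intro nn_integral_cong) (auto intro!: prod.cong emeasure_coverage_measure_Times)
  then show "moment M (coverage_measure X) k i B =
      (\<integral>\<^sup>+x. ennreal (cover_prob M X (marked_tuple k x i)) * indicator (Pi\<^sub>E {..<k} B) x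
        \<partial>(\<Pi>\<^sub>M j\<in>{..<k}. lborel))"
    unfolding eq by (subst tuple(1)) (use B in auto)
  have "moment M (coverage_measure X) k i B \<le> (\<integral>\<^sup>+\<omega>. (\<Prod>j<k. emeasure lborel (B j)) \<partial>M)"
    unfolding mom using B
    by (intro nn_integral_mono) (auto intro!: prod_mono_ennreal emeasure_mono)
  also have "\<dots> = (\<Prod>j<k. emeasure lborel (B j))" by (simp add: emeasure_space_1)
  also have "\<dots> < \<infinity>"
  proof -
    have "emeasure lborel (B j) \<noteq> top" if "j < k" for j
      using emeasure_bounded_finite[of "B j"] B that by simp
    then have "(\<Prod>j<k. emeasure lborel (B j)) \<noteq> top" by (simp add: ennreal_prod_eq_top)
    then show ?thesis by (simp add: less_top)
  qed
  finally show "moment M (coverage_measure X) k i B < \<infinity>" .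
qed

end

section \<open>Integrals over subtuples of independent coordinates\<close>

interpretation lborel_product: product_sigma_finite "\<lambda>_::nat. lborel :: 'a::euclidean_space measure"
  by (rule product_sigma_finite.intro) (rule lborel.sigma_finite_measure_axioms)

abbreviation lborel_power :: "nat set \<Rightarrow> (nat \<Rightarrow> 'a::euclidean_space) measure" where
  "lborel_power J \<equiv> \<Pi>\<^sub>M j\<in>J. lborel"

lemma distr_lborel_power_reindex:
  assumes e: "bij_betw e I J" and I: "finite I"
  shows "distr (lborel_power J) (lborel_power I) (\<lambda>x. \<lambda>i\<in>I. x (e i)) = (lborel_power I :: (nat \<Rightarrow> 'a::euclidean_space) measure)"
proof (rule lborel_product.PiM_eqI)
  let ?h = "\<lambda>x::nat \<Rightarrow> 'a. \<lambda>i\<in>I. x (e i)"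
  have J: "finite J" using e I bij_betw_finite by blast
  have eJ: "e i \<in> J" if "i \<in> I" for i using e that by (auto simp: bij_betw_def)
  have h: "?h \<in> measurable (lborel_power J) (lborel_power I)"
    using eJ by (intro measurable_restrict measurable_component_singleton)
  fix A :: "nat \<Rightarrow> 'a set" assume A: "\<And>i. i \<in> I \<Longrightarrow> A i \<in> sets lborel"
  define r where "r = inv_into I e"
  have r: "r (e i) = i" if "i \<in> I" for i using e that by (simp add: r_def bij_betw_def inv_into_f_f)
  have rJ: "r j \<in> I" "e (r j) = j" if "j \<in> J" for j
    using e that by (auto simp: r_def bij_betw_def inv_into_into f_inv_into_f)
  have pre: "?h -` Pi\<^sub>E I A \<inter> space (lborel_power J) = Pi\<^sub>E J (\<lambda>j. A (r j))"
  proof (intro equalityI subsetI)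
    fix x assume x: "x \<in> ?h -` Pi\<^sub>E I A \<inter> space (lborel_power J)"
    have "x j \<in> A (r j)" if "j \<in> J" for j
    proof -
      have "?h x (r j) \<in> A (r j)" using x rJ(1)[OF that] by (intro PiE_mem[of "?h x" I A]) auto
      then show ?thesis using rJ[OF that] by simp
    qed
    then show "x \<in> Pi\<^sub>E J (\<lambda>j. A (r j))" using x by (auto simp: space_PiM PiE_iff)
  next
    fix x assume x: "x \<in> Pi\<^sub>E J (\<lambda>j. A (r j))"
    have "x (e i) \<in> A i" if "i \<in> I" for i
      using PiE_mem[OF x eJ[OF that]] r[OF that] by simp
    then show "x \<in> ?h -` Pi\<^sub>E I A \<inter> space (lborel_power J)"
      using x by (auto simp: space_PiM PiE_iff)
  qed
  have "emeasure (distr (lborel_power J) (lborel_power I) ?h) (Pi\<^sub>E I A) =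
      emeasure (lborel_power J) (Pi\<^sub>E J (\<lambda>j. A (r j)))"
    using A I by (subst emeasure_distr[OF h]) (auto simp: pre intro!: sets_PiM_I_finite)
  also have "\<dots> = (\<Prod>j\<in>J. emeasure lborel (A (r j)))"
    using A rJ by (intro lborel_product.emeasure_PiM J) auto
  also have "\<dots> = (\<Prod>i\<in>I. emeasure lborel (A i))"
    using prod.reindex_bij_betw[OF e, of "\<lambda>j. emeasure lborel (A (r j))"] r by simp
  finally show "emeasure (distr (lborel_power J) (lborel_power I) ?h) (Pi\<^sub>E I A) =
    (\<Prod>i\<in>I. emeasure lborel (A i))" .
qed (use I in simp_all)

text \<open>The integral of a function of the coordinates in \<open>S\<close>, listed in increasing order, depends only
  on how many coordinates there are.\<close>

lemma set_integral_subtuple: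
  fixes F :: "'a::euclidean_space list \<Rightarrow> real"
  assumes S: "finite S"
    and F: "set_integrable (lborel_power {..<card S}) (Pi\<^sub>E {..<card S} (\<lambda>_. B)) (\<lambda>x. F (map x [0..<card S]))"
  shows "set_integrable (lborel_power S) (Pi\<^sub>E S (\<lambda>_. B)) (\<lambda>x. F (subtuple x S))"
    and "(LINT x:Pi\<^sub>E S (\<lambda>_. B)|lborel_power S. F (subtuple x S)) =
      (LINT x:Pi\<^sub>E {..<card S} (\<lambda>_. B)|lborel_power {..<card S}. F (map x [0..<card S]))"
proof -
  let ?I = "{..<card S}"
  let ?P = "lborel_power S" and ?Q = "lborel_power ?I"
  define e where "e = (!) (sorted_list_of_set S)"
  let ?h = "\<lambda>x::nat \<Rightarrow> 'a. \<lambda>i\<in>?I. x (e i)"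
  have e: "bij_betw e ?I S"
    unfolding e_def by (rule bij_betw_nth) (use S in auto)
  have eS: "e i \<in> S" if "i < card S" for i using e that by (auto simp: bij_betw_def)
  have map_e: "map e [0..<card S] = sorted_list_of_set S"
    unfolding e_def using S map_nth[of "sorted_list_of_set S"] by simp
  have h: "?h \<in> measurable ?P ?Q"
    using eS by (intro measurable_restrict measurable_component_singleton) auto
  have D: "distr ?P ?Q ?h = ?Q" by (rule distr_lborel_power_reindex[OF e]) simp
  let ?f = "\<lambda>x. indicator (Pi\<^sub>E ?I (\<lambda>_. B)) x *\<^sub>R F (map x [0..<card S])"
  let ?g = "\<lambda>x. indicator (Pi\<^sub>E S (\<lambda>_. B)) x *\<^sub>R F (subtuple x S)"
  have fh: "?f (?h x) = ?g x" if x: "x \<in> space ?P" for x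
  proof -
    have "map (?h x) [0..<card S] = map x (map e [0..<card S])" by simp
    then have "map (?h x) [0..<card S] = subtuple x S" by (simp only: map_e)
    moreover have "?h x \<in> Pi\<^sub>E ?I (\<lambda>_. B) \<longleftrightarrow> x \<in> Pi\<^sub>E S (\<lambda>_. B)"
    proof -
      have "(\<forall>i<card S. x (e i) \<in> B) \<longleftrightarrow> (\<forall>j\<in>e ` ?I. x j \<in> B)" by auto
      also have "e ` ?I = S" using e by (simp add: bij_betw_def)
      finally show ?thesis using x by (auto simp: space_PiM PiE_iff)
    qed
    ultimately show ?thesis by (simp add: indicator_def)
  qed
  have f: "integrable ?Q ?f" using F by (simp add: set_integrable_def)
  then have "integrable (distr ?P ?Q ?h) ?f" by (simp add: D)
  then have "integrable ?P (\<lambda>x. ?f (?h x))" by (rule integrable_distr[OF h])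
  then show "set_integrable ?P (Pi\<^sub>E S (\<lambda>_. B)) (\<lambda>x. F (subtuple x S))"
    unfolding set_integrable_def by (subst Bochner_Integration.integrable_cong[OF refl fh[symmetric]]) auto
  have "integral\<^sup>L ?Q ?f = integral\<^sup>L (distr ?P ?Q ?h) ?f" by (simp add: D)
  also have "\<dots> = (LINT x|?P. ?f (?h x))"
    using f by (intro integral_distr[OF h]) auto
  also have "\<dots> = integral\<^sup>L ?P ?g" by (rule Bochner_Integration.integral_cong[OF refl fh])
  finally show "(LINT x:Pi\<^sub>E S (\<lambda>_. B)|?P. F (subtuple x S)) =
      (LINT x:Pi\<^sub>E ?I (\<lambda>_. B)|?Q. F (map x [0..<card S]))"
    by (simp add: set_lebesgue_integral_def)
qed

lemma (in pair_sigma_finite) integral_product_of_functions: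
  fixes f :: "'a \<Rightarrow> real" and g :: "'b \<Rightarrow> real"
  assumes f: "integrable M1 f" and g: "integrable M2 g"
  shows "integrable (M1 \<Otimes>\<^sub>M M2) (\<lambda>z. f (fst z) * g (snd z))"
    and "(LINT z|(M1 \<Otimes>\<^sub>M M2). f (fst z) * g (snd z)) = (LINT x|M1. f x) * (LINT y|M2. g y)"
proof -
  have [measurable]: "f \<in> borel_measurable M1" "g \<in> borel_measurable M2" using f g by auto
  show int: "integrable (M1 \<Otimes>\<^sub>M M2) (\<lambda>z. f (fst z) * g (snd z))"
  proof (rule Fubini_integrable)
    show "integrable M1 (\<lambda>x. LINT y|M2. norm (f (fst (x, y)) * g (snd (x, y))))"
      using f by (simp add: abs_mult)
    show "AE x in M1. integrable M2 (\<lambda>y. f (fst (x, y)) * g (snd (x, y)))"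
      using g by simp
  qed measurable
  show "(LINT z|(M1 \<Otimes>\<^sub>M M2). f (fst z) * g (snd z)) = (LINT x|M1. f x) * (LINT y|M2. g y)"
    using integral_fst'[OF int] by simp
qed

text \<open>Functions of complementary groups of coordinates integrate independently, because Lebesgue
  measure on all coordinates is the product of those on the two groups.\<close>

lemma set_integral_subtuple_product:
  fixes F G :: "'a::euclidean_space list \<Rightarrow> real"
  assumes S: "S \<subseteq> {..<n}"
    and F: "set_integrable (lborel_power {..<card S}) (Pi\<^sub>E {..<card S} (\<lambda>_. B)) (\<lambda>x. F (map x [0..<card S]))"
    and G: "set_integrable (lborel_power {..<n - card S}) (Pi\<^sub>E {..<n - card S} (\<lambda>_. B))
      (\<lambda>x. G (map x [0..<n - card S]))"
  shows "set_integrable (lborel_power {..<n}) (Pi\<^sub>E {..<n} (\<lambda>_. B))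
      (\<lambda>x. F (subtuple x S) * G (subtuple x ({..<n} - S)))"
    and "(LINT x:Pi\<^sub>E {..<n} (\<lambda>_. B)|lborel_power {..<n}. F (subtuple x S) * G (subtuple x ({..<n} - S))) =
      (LINT x:Pi\<^sub>E {..<card S} (\<lambda>_. B)|lborel_power {..<card S}. F (map x [0..<card S])) *
      (LINT x:Pi\<^sub>E {..<n - card S} (\<lambda>_. B)|lborel_power {..<n - card S}. G (map x [0..<n - card S]))"
proof -
  let ?T = "{..<n} - S"
  have fin: "finite S" "finite ?T" using S finite_subset by auto
  have cardT: "card ?T = n - card S" using S fin by (simp add: card_Diff_subset)
  have un: "S \<union> ?T = {..<n}" and dis: "S \<inter> ?T = {}" using S by auto
  let ?P = "lborel_power S" and ?Q = "lborel_power ?T" and ?R = "lborel_power {..<n}"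
  interpret P: sigma_finite_measure ?P by (rule lborel_product.sigma_finite[OF fin(1)])
  interpret Q: sigma_finite_measure ?Q by (rule lborel_product.sigma_finite[OF fin(2)])
  interpret PQ: pair_sigma_finite ?P ?Q
    by (intro pair_sigma_finite.intro P.sigma_finite_measure_axioms Q.sigma_finite_measure_axioms)
  let ?f = "\<lambda>x. indicator (Pi\<^sub>E S (\<lambda>_. B)) x *\<^sub>R F (subtuple x S)"
  let ?g = "\<lambda>x. indicator (Pi\<^sub>E ?T (\<lambda>_. B)) x *\<^sub>R G (subtuple x ?T)"
  let ?h = "\<lambda>x. indicator (Pi\<^sub>E {..<n} (\<lambda>_. B)) x *\<^sub>R (F (subtuple x S) * G (subtuple x ?T))"
  have f: "integrable ?P ?f" using set_integral_subtuple(1)[OF fin(1) F] by (simp add: set_integrable_def)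
  have g: "integrable ?Q ?g"
    using set_integral_subtuple(1)[OF fin(2), of B G] G by (simp add: set_integrable_def cardT)
  have merge: "merge S ?T \<in> measurable (?P \<Otimes>\<^sub>M ?Q) ?R"
    using measurable_merge[of S ?T "\<lambda>_. lborel"] by (simp only: un)
  have D: "distr (?P \<Otimes>\<^sub>M ?Q) ?R (merge S ?T) = ?R"
    using lborel_product.distr_merge[OF dis fin] by (simp only: un)
  have split: "?h x = ?f (restrict x S) * ?g (restrict x ?T)" if x: "x \<in> space ?R" for x
  proof -
    have box: "x \<in> Pi\<^sub>E {..<n} (\<lambda>_. B) \<longleftrightarrow> restrict x S \<in> Pi\<^sub>E S (\<lambda>_. B) \<and> restrict x ?T \<in> Pi\<^sub>E ?T (\<lambda>_. B)"
      using x S by (auto simp: space_PiM PiE_iff subset_eq)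
    have tuples: "subtuple (restrict x S) S = subtuple x S" "subtuple (restrict x ?T) ?T = subtuple x ?T"
      using fin by auto
    show ?thesis unfolding tuples indicator_def box by auto
  qed
  have h_merge: "?h (merge S ?T z) = ?f (fst z) * ?g (snd z)" if z: "z \<in> space (?P \<Otimes>\<^sub>M ?Q)" for z
  proof -
    have "merge S ?T z \<in> space ?R" using measurable_space[OF merge z] .
    moreover have "restrict (merge S ?T z) S = fst z" "restrict (merge S ?T z) ?T = snd z"
      using z dis by (auto simp: space_pair_measure space_PiM PiE_restrict Int_commute)
    ultimately show ?thesis by (simp only: split)
  qed
  have h_meas: "?h \<in> borel_measurable ?R"
  proof -
    have "(\<lambda>x. ?f (restrict x S) * ?g (restrict x ?T)) \<in> borel_measurable ?R"
      using f g S
      by (intro borel_measurable_times measurable_compose[OF measurable_restrict_subset, of S "{..<n}"]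
            measurable_compose[OF measurable_restrict_subset, of ?T "{..<n}"]) auto
    then show ?thesis by (subst measurable_cong[OF split]) auto
  qed
  note fg = PQ.integral_product_of_functions[OF f g]
  have "integrable (?P \<Otimes>\<^sub>M ?Q) (\<lambda>z. ?h (merge S ?T z))"
    by (subst Bochner_Integration.integrable_cong[OF refl h_merge]) (use fg(1) in auto)
  then have "integrable (distr (?P \<Otimes>\<^sub>M ?Q) ?R (merge S ?T)) ?h"
    using h_meas by (subst integrable_distr_eq[OF merge]) auto
  then show "set_integrable ?R (Pi\<^sub>E {..<n} (\<lambda>_. B)) (\<lambda>x. F (subtuple x S) * G (subtuple x ?T))"
    unfolding D by (simp add: set_integrable_def)
  have "integral\<^sup>L ?R ?h = integral\<^sup>L (distr (?P \<Otimes>\<^sub>M ?Q) ?R (merge S ?T)) ?h" by (simp only: D)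
  also have "\<dots> = (LINT z|(?P \<Otimes>\<^sub>M ?Q). ?h (merge S ?T z))"
    by (rule integral_distr[OF merge h_meas])
  also have "\<dots> = (LINT z|(?P \<Otimes>\<^sub>M ?Q). ?f (fst z) * ?g (snd z))"
    by (rule Bochner_Integration.integral_cong[OF refl h_merge])
  also have "\<dots> = (LINT x|?P. ?f x) * (LINT y|?Q. ?g y)" by (rule fg(2))
  finally show "(LINT x:Pi\<^sub>E {..<n} (\<lambda>_. B)|?R. F (subtuple x S) * G (subtuple x ?T)) =
      (LINT x:Pi\<^sub>E {..<card S} (\<lambda>_. B)|lborel_power {..<card S}. F (map x [0..<card S])) *
      (LINT x:Pi\<^sub>E {..<n - card S} (\<lambda>_. B)|lborel_power {..<n - card S}. G (map x [0..<n - card S]))"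
    using set_integral_subtuple(2)[OF fin(1) F] set_integral_subtuple(2)[OF fin(2), of B G] G
    by (simp add: set_lebesgue_integral_def cardT)
qed

lemma sum_Pow_card:
  assumes "finite A"
  shows "(\<Sum>S\<in>Pow A. f (card S)) = (\<Sum>k\<le>card A. of_nat (card A choose k) * (f k :: 'c::comm_semiring_1))"
proof -
  have "(\<Sum>S\<in>Pow A. f (card S)) = (\<Sum>k\<le>card A. \<Sum>S\<in>{S\<in>Pow A. card S = k}. f (card S))"
    using assms by (intro sum.group[symmetric]) (auto intro: card_mono)
  also have "\<dots> = (\<Sum>k\<le>card A. of_nat (card A choose k) * f k)"
  proof (intro sum.cong refl)
    fix k
    have "(\<Sum>S\<in>{S\<in>Pow A. card S = k}. f (card S)) = of_nat (card {S\<in>Pow A. card S = k}) * f k"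
      by simp
    also have "card {S\<in>Pow A. card S = k} = card A choose k"
      using n_subsets[OF assms, of k] by (simp add: Pow_def)
    finally show "(\<Sum>S\<in>{S\<in>Pow A. card S = k}. f (card S)) = of_nat (card A choose k) * f k" .
  qed
  finally show ?thesis .
qed

section \<open>Moments of the covered volume and the cross statistics\<close>

context closed_pair_space
begin

lemma emeasure_covered_volume:
  assumes "B \<in> sets borel" "bounded B"
  shows "emeasure lborel (X i \<omega> \<inter> B) = ennreal (measure lborel (X i \<omega> \<inter> B))"
proof (cases "X i \<omega> \<inter> B \<in> sets lborel")
  case True
  have "emeasure lborel (X i \<omega> \<inter> B) \<le> emeasure lborel B" using assms by (intro emeasure_mono) auto
  also have "\<dots> < \<infinity>" by (rule emeasure_bounded_finite[OF assms(2)])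
  finally show ?thesis by (intro emeasure_eq_ennreal_measure) auto
next
  case False
  then show ?thesis by (simp add: emeasure_notin_sets measure_notin_sets)
qed

lemma covered_volume_le:
  assumes "B \<in> sets borel" "bounded B"
  shows "measure lborel (X i \<omega> \<inter> B) \<le> measure lborel B"
proof -
  have "emeasure lborel B < \<infinity>" by (rule emeasure_bounded_finite[OF assms(2)])
  then show ?thesis using assms unfolding measure_def
    by (intro enn2real_mono emeasure_mono) auto
qed

lemma integrable_volume_power:
  assumes [measurable]: "A \<in> events" "B \<in> sets borel" and "bounded B"
  shows "integrable M (\<lambda>\<omega>. indicator A \<omega> * measure lborel (X i \<omega> \<inter> B) ^ n :: real)"
proof (rule integrable_const_bound[of _ "measure lborel B ^ n"])
  have "norm (indicator A \<omega> * measure lborel (X i \<omega> \<inter> B) ^ n :: real) \<le> measure lborel B ^ n" for \<omega>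
    using covered_volume_le[OF assms(2,3), of i \<omega>]
    by (auto simp: indicator_def intro!: power_mono)
  then show "AE \<omega> in M. norm (indicator A \<omega> * measure lborel (X i \<omega> \<inter> B) ^ n :: real) \<le> measure lborel B ^ n"
    by simp
qed measurable

text \<open>Integrating the probability that \<open>n\<close> points are covered over all tuples in a window gives the
  \<open>n\<close>-th moment of the covered volume of the window, restricted to an event.\<close>

lemma set_integral_cover_tuple:
  fixes n :: nat and i :: 2
  assumes A [measurable]: "A \<in> events" and B: "B \<in> sets borel" "bounded B"
  defines "q \<equiv> \<lambda>x. prob {\<omega>\<in>A. \<forall>j\<in>{..<n}. x j \<in> X i \<omega>}"
  shows "set_integrable (lborel_power {..<n}) (Pi\<^sub>E {..<n} (\<lambda>_. B)) q"
    and "(LINT x:Pi\<^sub>E {..<n} (\<lambda>_. B)|lborel_power {..<n}. q x) =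
      (LINT \<omega>|M. indicator A \<omega> * measure lborel (X i \<omega> \<inter> B) ^ n)"
proof -
  let ?L = "lborel_power {..<n}" and ?B = "Pi\<^sub>E {..<n} (\<lambda>_. B)"
  note tuple = nn_integral_cover_tuple[OF A finite_lessThan, of n "\<lambda>_. B" "\<lambda>_. i"]
  have box: "?B \<in> sets ?L" using B by (intro sets_PiM_I_finite) auto
  have q [measurable]: "q \<in> borel_measurable ?L"
    unfolding q_def by (rule tuple(2)) (use B in auto)
  have meas: "(\<lambda>x. indicator ?B x *\<^sub>R q x) \<in> borel_measurable ?L"
    using box by (intro borel_measurable_scaleR borel_measurable_indicator q)
  have nonneg: "0 \<le> indicator ?B x *\<^sub>R q x" for x by (simp add: q_def)
  have rint: "integrable M (\<lambda>\<omega>. indicator A \<omega> * measure lborel (X i \<omega> \<inter> B) ^ n)"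
    using A B by (rule integrable_volume_power)
  have "(\<integral>\<^sup>+x. ennreal (indicator ?B x *\<^sub>R q x) \<partial>?L) = (\<integral>\<^sup>+x. ennreal (q x) * indicator ?B x \<partial>?L)"
    by (intro nn_integral_cong) (auto simp: indicator_def)
  also have "\<dots> = (\<integral>\<^sup>+\<omega>. indicator A \<omega> * (\<Prod>j<n. emeasure lborel (X i \<omega> \<inter> B)) \<partial>M)"
    unfolding q_def by (rule tuple(1)) (use B in auto)
  also have "\<dots> = (\<integral>\<^sup>+\<omega>. ennreal (indicator A \<omega> * measure lborel (X i \<omega> \<inter> B) ^ n) \<partial>M)"
    by (intro nn_integral_cong)
       (auto simp: emeasure_covered_volume[OF B] indicator_def ennreal_power)
  also have "\<dots> = ennreal (LINT \<omega>|M. indicator A \<omega> * measure lborel (X i \<omega> \<inter> B) ^ n)"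
    using rint by (intro nn_integral_eq_integral) auto
  finally have eq: "(\<integral>\<^sup>+x. ennreal (indicator ?B x *\<^sub>R q x) \<partial>?L) =
      ennreal (LINT \<omega>|M. indicator A \<omega> * measure lborel (X i \<omega> \<inter> B) ^ n)" .
  show "set_integrable ?L ?B q"
    unfolding set_integrable_def using meas nonneg eq by (intro integrableI_nonneg) auto
  show "(LINT x:?B|?L. q x) = (LINT \<omega>|M. indicator A \<omega> * measure lborel (X i \<omega> \<inter> B) ^ n)"
    unfolding set_lebesgue_integral_def
    unfolding integral_eq_nn_integral[OF meas AE_I2[OF nonneg]] eq
    by (intro enn2real_ennreal integral_nonneg_AE) auto
qed

text \<open>Expanding the exponential of the bounded random variable \<open>V/v\<close>.\<close>

lemma exp_volume_sums:
  fixes i :: 2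
  assumes A [measurable]: "A \<in> events" and B [measurable]: "B \<in> sets borel" "bounded B" and v: "0 < v"
  defines "e \<equiv> \<lambda>n. (-1) ^ n / fact n * ((LINT \<omega>|M. indicator A \<omega> * measure lborel (X i \<omega> \<inter> B) ^ n) / v ^ n)"
  shows "e sums (LINT \<omega>|M. indicator A \<omega> * exp (- (measure lborel (X i \<omega> \<inter> B) / v)))"
    and "summable (\<lambda>n. \<bar>e n\<bar>)"
proof -
  let ?V = "\<lambda>\<omega>. measure lborel (X i \<omega> \<inter> B)" and ?b = "measure lborel B"
  let ?f = "\<lambda>n \<omega>. (-1) ^ n / fact n / v ^ n * (indicator A \<omega> * ?V \<omega> ^ n) :: real"
  have int: "integrable M (?f n)" for n
    by (intro integrable_mult_right integrable_volume_power A B)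
  have f_eq: "?f n \<omega> = indicator A \<omega> * ((- (?V \<omega> / v)) ^ n /\<^sub>R fact n)" for n \<omega>
  proof -
    have "(- (?V \<omega> / v)) ^ n = (-1) ^ n * (?V \<omega> ^ n / v ^ n)"
      by (metis power_minus power_divide)
    then show ?thesis by (simp add: divide_inverse mult_ac)
  qed
  have bound: "norm (?f n \<omega>) \<le> (?b / v) ^ n /\<^sub>R fact n" for n \<omega>
  proof -
    have "norm (?f n \<omega>) = indicator A \<omega> * ((?V \<omega> / v) ^ n /\<^sub>R fact n)"
      unfolding f_eq using v by (simp add: abs_mult power_abs)
    also have "\<dots> \<le> 1 * ((?b / v) ^ n /\<^sub>R fact n)"
      using covered_volume_le[OF B, of i \<omega>] v
      by (intro mult_mono scaleR_left_mono power_mono divide_right_mono) (auto simp: indicator_def)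
    finally show ?thesis by simp
  qed
  have sum_b: "summable (\<lambda>n. (?b / v) ^ n /\<^sub>R fact n)" by (rule summable_exp_generic)
  have norm_int: "norm (LINT \<omega>|M. norm (?f n \<omega>)) \<le> (?b / v) ^ n /\<^sub>R fact n" for n
  proof -
    have "(LINT \<omega>|M. norm (?f n \<omega>)) \<le> (LINT \<omega>|M. (?b / v) ^ n /\<^sub>R fact n)"
      using int bound by (intro integral_mono integrable_norm) auto
    then show ?thesis by (simp add: prob_space integral_nonneg_AE)
  qed
  have sum_norm: "summable (\<lambda>n. LINT \<omega>|M. norm (?f n \<omega>))"
    by (rule summable_comparison_test'[OF sum_b, of 0]) (use norm_int in auto)
  have AE_sum: "AE \<omega> in M. summable (\<lambda>n. norm (?f n \<omega>))"
    by (intro AE_I2 summable_comparison_test'[OF sum_b, of 0]) (use bound in auto)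
  have e_eq: "e = (\<lambda>n. integral\<^sup>L M (?f n))"
    unfolding e_def integral_mult_right_zero by simp
  have "(\<Sum>n. ?f n \<omega>) = indicator A \<omega> * exp (- (?V \<omega> / v))" for \<omega>
    unfolding f_eq using sums_mult[OF exp_converges[of "- (?V \<omega> / v)"], of "indicator A \<omega>"]
    by (rule sums_unique[symmetric])
  then show "e sums (LINT \<omega>|M. indicator A \<omega> * exp (- (?V \<omega> / v)))"
    using sums_integral[OF int AE_sum sum_norm] by (simp only: e_eq)
  show "summable (\<lambda>n. \<bar>e n\<bar>)"
  proof (rule summable_comparison_test'[OF sum_norm, of 0])
    fix n
    have "\<bar>e n\<bar> \<le> (LINT \<omega>|M. norm (?f n \<omega>))"
      using integral_norm_bound[of M "?f n"] unfolding e_eq by simp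
    then show "norm \<bar>e n\<bar> \<le> (LINT \<omega>|M. norm (?f n \<omega>))" by simp
  qed
qed

end

text \<open>A setting that scaled copies visibly share, so that the representations of the cross
  statistics below apply to them as well.\<close>

locale constant_volume_fractions = closed_pair_space +
  fixes v :: "2 \<Rightarrow> real"
  assumes volume_fraction: "\<And>x i. cover_prob M X [(x, i)] = v i"
    and v_pos: "\<And>i. 0 < v i"
begin

lemma reweighted_cover_prob:
  "reweighted (cover_prob M X) zs = cover_prob M X zs / (\<Prod>z\<leftarrow>zs. v (snd z))"
proof -
  have "(\<Prod>z\<leftarrow>zs. cover_prob M X [z]) = (\<Prod>z\<leftarrow>zs. v (snd z))"
    by (intro arg_cong[of _ _ prod_list] map_cong refl) (simp add: volume_fraction split_paired_all)
  then show ?thesis by (simp add: reweighted_def)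
qed

lemma cover_prob_singleton_neq_0: "cover_prob M X [z] \<noteq> 0"
  using v_pos[of "snd z"] by (cases z) (simp add: volume_fraction)

lemma prod_list_label_2: "(\<Prod>z\<leftarrow>map (\<lambda>j. (x j, 2)) [0..<n]. v (snd z)) = v 2 ^ n"
  by (induction n) (simp_all add: o_def mult.commute)

lemma set_integral_reweighted:
  fixes B :: "'b set"
  assumes B: "B \<in> sets borel" "bounded B"
  shows "set_integrable (lborel_power {..<n}) (Pi\<^sub>E {..<n} (\<lambda>_. B))
      (\<lambda>x. reweighted (cover_prob M X) (map (\<lambda>j. (x j, 2)) [0..<n]))"
    and "set_integrable (lborel_power {..<n}) (Pi\<^sub>E {..<n} (\<lambda>_. B))
      (\<lambda>x. reweighted (cover_prob M X) ((y, l) # map (\<lambda>j. (x j, 2)) [0..<n]))"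
    and "(LINT x:Pi\<^sub>E {..<n} (\<lambda>_. B)|lborel_power {..<n}. reweighted (cover_prob M X) (map (\<lambda>j. (x j, 2)) [0..<n])) =
      (LINT \<omega>|M. indicator (space M) \<omega> * measure lborel (X 2 \<omega> \<inter> B) ^ n) / v 2 ^ n"
    and "(LINT x:Pi\<^sub>E {..<n} (\<lambda>_. B)|lborel_power {..<n}. reweighted (cover_prob M X) ((y, l) # map (\<lambda>j. (x j, 2)) [0..<n])) =
      (LINT \<omega>|M. indicator {\<omega>\<in>space M. y \<in> X l \<omega>} \<omega> * measure lborel (X 2 \<omega> \<inter> B) ^ n) / v 2 ^ n / v l"
proof -
  let ?q = "\<lambda>A x. prob {\<omega>\<in>A. \<forall>j\<in>{..<n}. x j \<in> X 2 \<omega>}"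
  have eq: "reweighted (cover_prob M X) (map (\<lambda>j. (x j, 2)) [0..<n]) = ?q (space M) x / v 2 ^ n" for x
    unfolding reweighted_cover_prob prod_list_label_2 cover_prob_map by (simp add: atLeast0LessThan)
  have eq': "reweighted (cover_prob M X) ((y, l) # map (\<lambda>j. (x j, 2)) [0..<n]) =
      ?q {\<omega>\<in>space M. y \<in> X l \<omega>} x / v 2 ^ n / v l" for x
    unfolding reweighted_cover_prob cover_prob_Cons_map list.map prod_list.Cons prod_list_label_2
    by (simp add: atLeast0LessThan)
  note tuple = set_integral_cover_tuple[OF _ B, of _ n 2]
  show "set_integrable (lborel_power {..<n}) (Pi\<^sub>E {..<n} (\<lambda>_. B))
      (\<lambda>x. reweighted (cover_prob M X) (map (\<lambda>j. (x j, 2)) [0..<n]))"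
    unfolding eq using tuple(1)[OF sets.top] by simp
  show "set_integrable (lborel_power {..<n}) (Pi\<^sub>E {..<n} (\<lambda>_. B))
      (\<lambda>x. reweighted (cover_prob M X) ((y, l) # map (\<lambda>j. (x j, 2)) [0..<n]))"
    unfolding eq' using tuple(1)[OF cover_event[of y l]] by simp
  show "(LINT x:Pi\<^sub>E {..<n} (\<lambda>_. B)|lborel_power {..<n}. reweighted (cover_prob M X) (map (\<lambda>j. (x j, 2)) [0..<n])) =
      (LINT \<omega>|M. indicator (space M) \<omega> * measure lborel (X 2 \<omega> \<inter> B) ^ n) / v 2 ^ n"
    unfolding eq set_integral_divide_zero by (subst tuple(2)) auto
  show "(LINT x:Pi\<^sub>E {..<n} (\<lambda>_. B)|lborel_power {..<n}. reweighted (cover_prob M X) ((y, l) # map (\<lambda>j. (x j, 2)) [0..<n])) =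
      (LINT \<omega>|M. indicator {\<omega>\<in>space M. y \<in> X l \<omega>} \<omega> * measure lborel (X 2 \<omega> \<inter> B) ^ n) / v 2 ^ n / v l"
    unfolding eq' set_integral_divide_zero by (subst tuple(2)) auto
qed

text \<open>For two points the cumulant relation says that \<open>1 + \<xi>\<close> is the reweighted pair probability, so
  this is the first moment of the covered volume of a ball.\<close>

lemma K12_eq:
  "K12 (cover_prob M X) t =
    (LINT \<omega>|M. indicator {\<omega>\<in>space M. 0 \<in> X 1 \<omega>} \<omega> * measure lborel (X 2 \<omega> \<inter> cball 0 t)) / v 2 / v 1"
proof -
  let ?p = "cover_prob M X"
  let ?f = "\<lambda>x. indicator (cball 0 t) x *\<^sub>R reweighted ?p [(0, 1), (x, 2)]"
  have pair: "1 + \<xi> ?p [(0, 1), (x, 2)] = reweighted ?p [(0, 1), (x, 2)]" for x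
    using reweighted_Cons[of ?p "(0, 1)" "\<lambda>_. (x, 2)" 1, OF cover_prob_Nil cover_prob_singleton_neq_0]
    by (simp add: lessThan_Suc Pow_insert \<xi>_singleton)
       (simp add: reweighted_def cover_prob_Nil cover_prob_singleton_neq_0)
  let ?g = "\<lambda>x. indicator (Pi\<^sub>E {0::nat} (\<lambda>_. cball 0 t)) x *\<^sub>R reweighted ?p [(0, 1), (x 0, 2)]"
  have one: "{..<Suc 0} = {0}" by auto
  have g: "?g \<in> borel_measurable (lborel_power {0})"
    using set_integral_reweighted(2)[of "cball 0 t" "Suc 0" 0 1]
    by (auto simp: one set_integrable_def)
  have "K12 ?p t = integral\<^sup>L lborel ?f"
    by (simp add: K12_def set_lebesgue_integral_def pair)
  also have "\<dots> = integral\<^sup>L lborel (\<lambda>x. ?g (\<lambda>i\<in>{0}. x))"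
    by (intro Bochner_Integration.integral_cong) (auto simp: indicator_def PiE_iff)
  also have "\<dots> = integral\<^sup>L (distr lborel (lborel_power {0}) (\<lambda>x. \<lambda>i\<in>{0}. x)) ?g"
    by (rule integral_distr[symmetric, OF _ g]) (intro measurable_restrict, simp)
  also have "distr lborel (lborel_power {0}) (\<lambda>x. \<lambda>i\<in>{0}. x) = lborel_power {0}"
    by (rule lborel_product.distr_component)
  also have "integral\<^sup>L (lborel_power {0}) ?g =
      (LINT \<omega>|M. indicator {\<omega>\<in>space M. 0 \<in> X 1 \<omega>} \<omega> * measure lborel (X 2 \<omega> \<inter> cball 0 t)) / v 2 / v 1"
    using set_integral_reweighted(4)[of "cball 0 t" "Suc 0" 0 1]
    by (simp add: one set_lebesgue_integral_def)
  finally show ?thesis .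
qed

text \<open>The expansion of the reweighted moments into cumulants of the distinguished point integrates
  to a binomial convolution, which is the Cauchy product of the two exponential generating
  series.\<close>

lemma J12_eq:
  assumes J: "J12_defined (cover_prob M X) t"
  shows "J12 (cover_prob M X) t * (LINT \<omega>|M. exp (- (measure lborel (X 2 \<omega> \<inter> cball 0 t) / v 2))) =
    (LINT \<omega>|M. indicator {\<omega>\<in>space M. 0 \<in> X 1 \<omega>} \<omega> * exp (- (measure lborel (X 2 \<omega> \<inter> cball 0 t) / v 2))) / v 1"
proof -
  let ?p = "cover_prob M X" and ?B = "cball 0 t :: 'b set" and ?A = "{\<omega>\<in>space M. 0 \<in> X 1 \<omega>}"
  let ?V = "\<lambda>\<omega>. measure lborel (X 2 \<omega> \<inter> ?B)"
  have B: "?B \<in> sets borel" "bounded ?B" by auto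
  define F where "F xs = \<xi> ?p ((0, 1) # map (\<lambda>x. (x, 2)) xs)" for xs
  define G where "G xs = reweighted ?p (map (\<lambda>x. (x, 2)) xs)" for xs
  define a where "a k = (LINT x:Pi\<^sub>E {..<k} (\<lambda>_. ?B)|lborel_power {..<k}. F (map x [0..<k]))" for k
  define b where "b k = (LINT x:Pi\<^sub>E {..<k} (\<lambda>_. ?B)|lborel_power {..<k}. G (map x [0..<k]))" for k
  define c where "c n = (LINT x:Pi\<^sub>E {..<n} (\<lambda>_. ?B)|lborel_power {..<n}.
    reweighted ?p ((0, 1) # map (\<lambda>j. (x j, 2)) [0..<n]))" for n
  have F_tuple: "F (map x [0..<k]) = J12_integrand ?p k x" for x k by (simp add: F_def o_def)
  have G_tuple: "G (map x [0..<k]) = reweighted ?p (map (\<lambda>j. (x j, 2)) [0..<k])" for x k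
    by (simp add: G_def o_def)
  have F_int: "set_integrable (lborel_power {..<k}) (Pi\<^sub>E {..<k} (\<lambda>_. ?B)) (\<lambda>x. F (map x [0..<k]))" for k
  proof (cases k)
    case 0
    then show ?thesis by (simp add: set_integrable_def PiM_empty integrable_count_space)
  next
    case (Suc m)
    then have "1 \<le> k" by simp
    then show ?thesis using J unfolding F_tuple J12_defined_def by blast
  qed
  have G_int: "set_integrable (lborel_power {..<k}) (Pi\<^sub>E {..<k} (\<lambda>_. ?B)) (\<lambda>x. G (map x [0..<k]))" for k
    unfolding G_tuple by (rule set_integral_reweighted(1)[OF B])
  have a0: "a 0 = 1"
    by (simp add: a_def F_def \<xi>_singleton set_lebesgue_integral_def PiM_empty lebesgue_integral_count_space_finite)
  have convolution: "c n = (\<Sum>k\<le>n. of_nat (n choose k) * (a k * b (n - k)))" for n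
  proof -
    have "c n = (LINT x|lborel_power {..<n}. (\<Sum>S\<in>Pow {..<n}. indicator (Pi\<^sub>E {..<n} (\<lambda>_. ?B)) x *\<^sub>R
        (F (subtuple x S) * G (subtuple x ({..<n} - S)))))"
      unfolding c_def set_lebesgue_integral_def scaleR_sum_right[symmetric]
      by (subst reweighted_Cons[OF cover_prob_Nil cover_prob_singleton_neq_0]) (simp add: F_def G_def o_def)
    also have "\<dots> = (\<Sum>S\<in>Pow {..<n}. LINT x:Pi\<^sub>E {..<n} (\<lambda>_. ?B)|lborel_power {..<n}.
        F (subtuple x S) * G (subtuple x ({..<n} - S)))"
      unfolding set_lebesgue_integral_def
      using set_integral_subtuple_product(1)[OF _ F_int G_int]
      by (intro Bochner_Integration.integral_sum) (auto simp: set_integrable_def)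
    also have "\<dots> = (\<Sum>S\<in>Pow {..<n}. a (card S) * b (n - card S))"
      unfolding a_def b_def
      by (intro sum.cong refl set_integral_subtuple_product(2)[OF _ F_int G_int]) auto
    also have "\<dots> = (\<Sum>k\<le>n. of_nat (n choose k) * (a k * b (n - k)))"
      using sum_Pow_card[of "{..<n}" "\<lambda>k. a k * b (n - k)"] by simp
    finally show ?thesis .
  qed
  define \<alpha> where "\<alpha> k = (-1) ^ k / fact k * a k" for k
  define \<beta> where "\<beta> k = (-1) ^ k / fact k * b k" for k
  have \<alpha>_J12: "\<alpha> k = J12_term ?p t k" for k
    unfolding \<alpha>_def a_def F_tuple J12_term_def ..
  have sum_\<alpha>: "summable (\<lambda>k. \<bar>\<alpha> k\<bar>)"
    using J unfolding \<alpha>_J12 J12_defined_def by (subst summable_Suc_iff[symmetric]) simp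
  have J12: "J12 ?p t = (\<Sum>k. \<alpha> k)"
  proof -
    have "summable \<alpha>" using sum_\<alpha> by (rule summable_rabs_cancel)
    then have "(\<Sum>k. \<alpha> k) = (\<Sum>k. \<alpha> (Suc k)) + \<alpha> 0" using suminf_split_head by fastforce
    then show ?thesis by (simp add: J12_def \<alpha>_J12 flip: \<alpha>_J12) (simp add: \<alpha>_def a0 \<alpha>_J12)
  qed
  have b_eq: "b n = (LINT \<omega>|M. indicator (space M) \<omega> * ?V \<omega> ^ n) / v 2 ^ n" for n
    unfolding b_def G_tuple by (rule set_integral_reweighted(3)[OF B])
  have c_eq: "c n = (LINT \<omega>|M. indicator ?A \<omega> * ?V \<omega> ^ n) / v 2 ^ n / v 1" for n
    unfolding c_def by (rule set_integral_reweighted(4)[OF B])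
  have \<beta>_sums: "\<beta> sums (LINT \<omega>|M. indicator (space M) \<omega> * exp (- (?V \<omega> / v 2)))"
    and sum_\<beta>: "summable (\<lambda>k. \<bar>\<beta> k\<bar>)"
    unfolding \<beta>_def b_eq using exp_volume_sums[OF sets.top B v_pos[of 2], of 2] by simp_all
  have c_sums: "(\<lambda>n. (-1) ^ n / fact n * c n) sums
      ((LINT \<omega>|M. indicator ?A \<omega> * exp (- (?V \<omega> / v 2))) / v 1)"
    using sums_divide[OF exp_volume_sums(1)[OF cover_event[of 0 1] B v_pos[of 2], of 2], of "v 1"]
    unfolding c_eq by (simp add: mult.assoc)
  have c_eq_Cauchy: "(\<lambda>n. (-1) ^ n / fact n * c n) = (\<lambda>n. \<Sum>k\<le>n. \<alpha> k * \<beta> (n - k))"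
  proof
    fix n
    have "(-1) ^ n / fact n * (of_nat (n choose k) * (a k * b (n - k))) = \<alpha> k * \<beta> (n - k)" if "k \<le> n" for k
    proof -
      have "(-1 :: real) ^ n = (-1) ^ k * (-1) ^ (n - k)" using that by (simp flip: power_add)
      then show ?thesis using that by (simp add: \<alpha>_def \<beta>_def binomial_fact field_simps)
    qed
    then show "(-1) ^ n / fact n * c n = (\<Sum>k\<le>n. \<alpha> k * \<beta> (n - k))"
      unfolding convolution sum_distrib_left by (intro sum.cong) auto
  qed
  have Cauchy: "(\<lambda>n. \<Sum>k\<le>n. \<alpha> k * \<beta> (n - k)) sums ((\<Sum>k. \<alpha> k) * (\<Sum>k. \<beta> k))"
    using sum_\<alpha> sum_\<beta> by (intro Cauchy_product_sums) auto
  have "(LINT \<omega>|M. indicator ?A \<omega> * exp (- (?V \<omega> / v 2))) / v 1 = J12 ?p t * (\<Sum>k. \<beta> k)"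
    unfolding J12 by (rule sums_unique2[OF c_sums[unfolded c_eq_Cauchy] Cauchy])
  also have "(\<Sum>k. \<beta> k) = (LINT \<omega>|M. indicator (space M) \<omega> * exp (- (?V \<omega> / v 2)))"
    using \<beta>_sums by (simp add: sums_iff)
  also have "\<dots> = (LINT \<omega>|M. exp (- (?V \<omega> / v 2)))"
    by (intro Bochner_Integration.integral_cong) auto
  finally show ?thesis by simp
qed

end

section \<open>Consequences of stationarity\<close>

text \<open>The recursion for the cumulants only refers to the coverage function, whose invariances they
  therefore inherit.\<close>

lemma \<xi>_map:
  assumes "\<And>zs. p (map f zs) = p zs"
  shows "\<xi> p (map f zs) = \<xi> p zs"
  using assms
proof (induction p zs rule: \<xi>.induct)
  case (1 p zs)
  have "p [f z] = p [z]" for z using "1.prems"[of "[z]"] by simp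
  then have prod: "(\<Prod>z\<leftarrow>map f zs. p [z]) = (\<Prod>z\<leftarrow>zs. p [z])" by (simp add: o_def)
  have "\<xi> p (nths (map f zs) D) = \<xi> p (nths zs D)"
    if "\<not> length zs \<le> 1" "P \<in> {P. partition_on {..<length zs} P \<and> P \<noteq> {{..<length zs}}}" "D \<in> P" for P D
    unfolding nths_map by (rule "1.IH"[OF that "1.prems"])
  then show ?case
    unfolding \<xi>.simps[of p "map f zs"] \<xi>.simps[of p zs] "1.prems" prod length_map
    by (auto intro!: sum.cong prod.cong)
qed

locale stationary_closed_pair = closed_pair_space +
  assumes stationary: "stationary M X"
    and volume_fraction_pos: "\<And>i. 0 < \<P>(\<omega> in M. 0 \<in> X i \<omega>)"
begin

lemma measurable_translated [measurable]: "translated a X i \<in> measurable M fell"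
  using measurable_affine_image[OF measurable_X, of 1 a i] by (simp add: translated_def[abs_def])

text \<open>Stationarity compares laws of pairs of closed sets, hence also the laws of all measurable
  functionals of the pair.\<close>

lemma distr_translated:
  assumes h: "h \<in> measurable (fell \<Otimes>\<^sub>M fell) N"
  shows "distr M N (\<lambda>\<omega>. h (translated a X 1 \<omega>, translated a X 2 \<omega>)) = distr M N (\<lambda>\<omega>. h (X 1 \<omega>, X 2 \<omega>))"
proof -
  have "distr (joint_law M (translated a X)) N h = distr (joint_law M X) N h"
    using stationary by (simp add: stationary_def)
  then show ?thesis
    unfolding joint_law_def by (simp add: distr_distr[OF h] o_def)
qed

lemma prob_translated:
  assumes Q: "Measurable.pred (fell \<Otimes>\<^sub>M fell) Q"
  shows "\<P>(\<omega> in M. Q (translated a X 1 \<omega>, translated a X 2 \<omega>)) = \<P>(\<omega> in M. Q (X 1 \<omega>, X 2 \<omega>))"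
proof -
  have "measure (distr M (count_space UNIV) (\<lambda>\<omega>. Q (translated a X 1 \<omega>, translated a X 2 \<omega>))) {True} =
      measure (distr M (count_space UNIV) (\<lambda>\<omega>. Q (X 1 \<omega>, X 2 \<omega>))) {True}"
    by (simp only: distr_translated[OF Q])
  moreover have "(\<lambda>\<omega>. Q (translated a X 1 \<omega>, translated a X 2 \<omega>)) \<in> measurable M (count_space UNIV)"
    "(\<lambda>\<omega>. Q (X 1 \<omega>, X 2 \<omega>)) \<in> measurable M (count_space UNIV)"
    by (rule measurable_compose[OF _ Q], measurable)+
  ultimately show ?thesis by (simp add: measure_distr vimage_def Int_def conj_commute)
qed

lemma mem_translated: "x + a \<in> translated a X i \<omega> \<longleftrightarrow> x \<in> X i \<omega>"
  by (auto simp: translated_def)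

lemma translated_Int_cball: "translated a X i \<omega> \<inter> cball (x + a) t = {} \<longleftrightarrow> X i \<omega> \<inter> cball x t = {}"
  by (auto simp: translated_def dist_norm)

lemma translated_Int_ball: "translated a X i \<omega> \<inter> ball (x + a) t = {} \<longleftrightarrow> X i \<omega> \<inter> ball x t = {}"
  by (auto simp: translated_def dist_norm)

text \<open>A pair of closed sets is read as a family indexed by labels by selecting a component.\<close>

lemma measurable_component_select [measurable]:
  "(\<lambda>F. if i = 1 then fst F else snd F) \<in> measurable (fell \<Otimes>\<^sub>M fell) fell"
  by simp

lemma component_select: "(if i = (1::2) then fst (Y 1 \<omega>, Y 2 \<omega>) else snd (Y 1 \<omega>, Y 2 \<omega>)) = Y i \<omega>"
  using exhaust_2[of i] by auto

lemma cover_prob_translate: "cover_prob M X (map (\<lambda>(x, i). (x + a, i)) zs) = cover_prob M X zs"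
proof -
  let ?Q = "\<lambda>F. \<forall>(x, i)\<in>set zs. x + a \<in> (if i = 1 then fst F else snd F)"
  have Q: "Measurable.pred (fell \<Otimes>\<^sub>M fell) ?Q"
    unfolding case_prod_beta
    by (intro pred_intros_finite measurable_mem_closed_set measurable_component_select) auto
  have "cover_prob M X (map (\<lambda>(x, i). (x + a, i)) zs) = \<P>(\<omega> in M. ?Q (X 1 \<omega>, X 2 \<omega>))"
    unfolding cover_prob_def component_select by (simp add: case_prod_beta)
  also have "\<dots> = \<P>(\<omega> in M. ?Q (translated a X 1 \<omega>, translated a X 2 \<omega>))"
    by (rule prob_translated[OF Q, symmetric])
  also have "\<dots> = cover_prob M X zs"
    unfolding cover_prob_def component_select by (simp only: mem_translated)
  finally show ?thesis .
qed

definition volume_fraction_at :: "2 \<Rightarrow> real" where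
  "volume_fraction_at i = \<P>(\<omega> in M. 0 \<in> X i \<omega>)"

end

sublocale stationary_closed_pair \<subseteq> constant_volume_fractions M X volume_fraction_at
proof
  show "cover_prob M X [(x, i)] = volume_fraction_at i" for x i
    using cover_prob_translate[of x "[(0, i)]"]
    by (simp add: cover_prob_singleton volume_fraction_at_def)
  show "0 < volume_fraction_at i" for i
    using volume_fraction_pos by (simp add: volume_fraction_at_def)
qed

context stationary_closed_pair
begin

abbreviation "v \<equiv> volume_fraction_at"

lemma prob_mem: "prob {\<omega>\<in>space M. x \<in> X i \<omega>} = v i"
  using volume_fraction[of x i] by (simp add: cover_prob_singleton)

lemma crm_stationary_cover_prob: "crm_stationary M (coverage_measure X) (cover_prob M X)"
  unfolding crm_stationary_def
proof (intro conjI allI impI)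
  show "random_measure M (coverage_measure X)"
    unfolding random_measure_def by (rule measurable_coverage_measure) (rule measurable_X)
  show "coverage_function M (coverage_measure X) (cover_prob M X)"
    by (rule coverage_function_cover_prob)
  have "min (v 1) (v 2) \<le> cover_prob M X [z]" for z
    using exhaust_2[of "snd z"] by (cases z) (auto simp: volume_fraction)
  then have "min (v 1) (v 2) \<le> (INF z. cover_prob M X [z])" by (intro cINF_greatest) auto
  then show "0 < (INF z. cover_prob M X [z])" using v_pos[of 1] v_pos[of 2] by linarith
next
  fix k :: nat and i :: "nat \<Rightarrow> 2" and a :: 'b
  have "\<xi> (cover_prob M X) (marked_tuple k (\<lambda>j. x j + a) i) = \<xi> (cover_prob M X) (marked_tuple k x i)" for x
    using \<xi>_map[of "cover_prob M X" "\<lambda>(x, i). (x + a, i)" "marked_tuple k x i", OF cover_prob_translate]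
    by (simp add: o_def)
  then show "AE x in (\<Pi>\<^sub>M j\<in>{..<k}. lborel). \<xi> (cover_prob M X) (marked_tuple k (\<lambda>j. x j + a) i) =
      \<xi> (cover_prob M X) (marked_tuple k x i)" by simp
qed

section \<open>Palm distributions\<close>

abbreviation "\<Psi> \<equiv> coverage_measure X"

lemma measurable_\<Psi> [measurable]: "\<Psi> \<in> measurable M lf_algebra"
  by (rule measurable_coverage_measure) (rule measurable_X)

text \<open>Campbell's formula: a point \<open>x\<close> contributes to the integral with respect to \<open>\<Psi>\<close> when it lies
  in \<open>X i\<close>, and Fubini's theorem moves the expectation inside.\<close>

lemma nn_integral_\<Psi>:
  assumes f: "case_prod f \<in> borel_measurable (M \<Otimes>\<^sub>M marked_space)"
  shows "(\<integral>\<^sup>+\<omega>. (\<integral>\<^sup>+z. f \<omega> z \<partial>\<Psi> \<omega>) \<partial>M) =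
    (\<Sum>i\<in>UNIV. \<integral>\<^sup>+x. (\<integral>\<^sup>+\<omega>. indicator {\<omega>. x \<in> X i \<omega>} \<omega> * f \<omega> (x, i) \<partial>M) \<partial>lborel)"
proof -
  interpret P: pair_sigma_finite M "lborel :: 'b measure"
    by (intro pair_sigma_finite.intro sigma_finite_measure_axioms lborel.sigma_finite_measure_axioms)
  have pair: "(\<lambda>z. (fst z, (snd z, i))) \<in> measurable (M \<Otimes>\<^sub>M lborel) (M \<Otimes>\<^sub>M marked_space)" for i :: 2
    unfolding marked_space_def by simp
  have fi: "(\<lambda>z. f (fst z) (snd z, i)) \<in> borel_measurable (M \<Otimes>\<^sub>M lborel)" for i
    using measurable_compose[OF pair f] by simp
  have mem: "Measurable.pred (M \<Otimes>\<^sub>M lborel) (\<lambda>z. snd z \<in> X i (fst z))" for i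
    by (intro measurable_mem_closed_set measurable_compose[OF measurable_fst measurable_X]) simp
  have h: "(\<lambda>z. indicator {\<omega>. snd z \<in> X i \<omega>} (fst z) * f (fst z) (snd z, i)) \<in> borel_measurable (M \<Otimes>\<^sub>M lborel)" for i
    using mem fi by (intro borel_measurable_times_ennreal) (auto simp: indicator_def)
  have "(\<integral>\<^sup>+\<omega>. (\<integral>\<^sup>+z. f \<omega> z \<partial>\<Psi> \<omega>) \<partial>M) =
      (\<integral>\<^sup>+\<omega>. (\<Sum>i\<in>UNIV. \<integral>\<^sup>+x. indicator {\<omega>. x \<in> X i \<omega>} \<omega> * f \<omega> (x, i) \<partial>lborel) \<partial>M)"
  proof (intro nn_integral_cong)
    fix \<omega> assume \<omega>: "\<omega> \<in> space M"
    have "f \<omega> \<in> borel_measurable marked_space" using measurable_Pair2[OF f \<omega>] by simp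
    from nn_integral_coverage_measure[of X \<omega>, OF closed_X[OF \<omega>] this]
    show "(\<integral>\<^sup>+z. f \<omega> z \<partial>\<Psi> \<omega>) = (\<Sum>i\<in>UNIV. \<integral>\<^sup>+x. indicator {\<omega>. x \<in> X i \<omega>} \<omega> * f \<omega> (x, i) \<partial>lborel)"
      by (simp add: indicator_def)
  qed
  also have "\<dots> = (\<Sum>i\<in>UNIV. \<integral>\<^sup>+\<omega>. (\<integral>\<^sup>+x. indicator {\<omega>. x \<in> X i \<omega>} \<omega> * f \<omega> (x, i) \<partial>lborel) \<partial>M)"
    using h by (intro nn_integral_sum lborel.borel_measurable_nn_integral) (simp add: case_prod_beta)
  also have "\<dots> = (\<Sum>i\<in>UNIV. \<integral>\<^sup>+x. (\<integral>\<^sup>+\<omega>. indicator {\<omega>. x \<in> X i \<omega>} \<omega> * f \<omega> (x, i) \<partial>M) \<partial>lborel)"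
    using h by (intro sum.cong refl P.Fubini'[symmetric]) (simp add: case_prod_beta)
  finally show ?thesis .
qed

lemma intensity_measure_eq:
  "intensity_measure M \<Psi> = density (lborel \<Otimes>\<^sub>M count_space UNIV) (\<lambda>z. ennreal (v (snd z)))"
proof -
  let ?N = "density (lborel \<Otimes>\<^sub>M count_space UNIV) (\<lambda>z::'b \<times> 2. ennreal (v (snd z)))"
  have sets: "sets ?N = sets marked_space" by (simp add: sets_marked_lebesgue)
  have space: "space ?N = UNIV" by (simp add: space_pair_measure)
  have d: "(\<lambda>z::'b \<times> 2. ennreal (v (snd z))) \<in> borel_measurable marked_space"
    by (rule measurable_marked_spaceI) simp
  have em: "(\<integral>\<^sup>+\<omega>. emeasure (\<Psi> \<omega>) A \<partial>M) = emeasure ?N A" if A: "A \<in> sets marked_space" for A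
  proof -
    have "(\<integral>\<^sup>+\<omega>. emeasure (\<Psi> \<omega>) A \<partial>M) = (\<integral>\<^sup>+\<omega>. (\<integral>\<^sup>+z. indicator A z \<partial>\<Psi> \<omega>) \<partial>M)"
      using A by simp
    also have "\<dots> = (\<Sum>i\<in>UNIV. \<integral>\<^sup>+x. (\<integral>\<^sup>+\<omega>. indicator {\<omega>. x \<in> X i \<omega>} \<omega> * indicator A (x, i) \<partial>M) \<partial>lborel)"
      using A by (intro nn_integral_\<Psi>) (simp add: case_prod_beta)
    also have "\<dots> = (\<Sum>i\<in>UNIV. \<integral>\<^sup>+x. ennreal (v i) * indicator A (x, i) \<partial>lborel)"
    proof (intro sum.cong refl nn_integral_cong)
      fix x :: 'b and i :: 2
      have "(\<integral>\<^sup>+\<omega>. indicator {\<omega>. x \<in> X i \<omega>} \<omega> * indicator A (x, i) \<partial>M) =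
          (\<integral>\<^sup>+\<omega>. indicator A (x, i) * indicator {\<omega>\<in>space M. x \<in> X i \<omega>} \<omega> \<partial>M)"
        by (intro nn_integral_cong) (auto simp: indicator_def)
      also have "\<dots> = ennreal (v i) * indicator A (x, i)"
        by (subst nn_integral_cmult_indicator) (auto simp: emeasure_eq_measure prob_mem mult.commute)
      finally show "(\<integral>\<^sup>+\<omega>. indicator {\<omega>. x \<in> X i \<omega>} \<omega> * indicator A (x, i) \<partial>M) =
        ennreal (v i) * indicator A (x, i)" .
    qed
    also have "\<dots> = (\<integral>\<^sup>+z. ennreal (v (snd z)) * indicator A z \<partial>(lborel \<Otimes>\<^sub>M count_space UNIV))"
      by (subst nn_integral_marked_lebesgue) (use A d in auto)
    also have "\<dots> = emeasure ?N A"
      using A d by (intro emeasure_density[symmetric])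
        (simp_all add: sets_marked_lebesgue measurable_cong_sets[OF sets_marked_lebesgue refl])
    finally show ?thesis .
  qed
  have "intensity_measure M \<Psi> = measure_of (space ?N) (sets ?N) (emeasure ?N)"
    unfolding intensity_measure_def space sets
    using em sets.space_closed[of marked_space] sets.sigma_sets_eq[of marked_space]
    by (intro measure_of_eq) auto
  then show ?thesis by (simp only: measure_of_of_measure)
qed

lemma nn_integral_intensity:
  assumes "f \<in> borel_measurable marked_space"
  shows "(\<integral>\<^sup>+z. f z \<partial>intensity_measure M \<Psi>) = (\<Sum>i\<in>UNIV. \<integral>\<^sup>+x. ennreal (v i) * f (x, i) \<partial>lborel)"
proof -
  have d: "(\<lambda>z::'b \<times> 2. ennreal (v (snd z))) \<in> borel_measurable marked_space"
    by (rule measurable_marked_spaceI) simp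
  have "(\<integral>\<^sup>+z. f z \<partial>intensity_measure M \<Psi>) =
      (\<integral>\<^sup>+z. ennreal (v (snd z)) * f z \<partial>(lborel \<Otimes>\<^sub>M count_space UNIV))"
    unfolding intensity_measure_eq
    using d assms by (intro nn_integral_density) (simp_all add: measurable_cong_sets[OF sets_marked_lebesgue refl])
  also have "\<dots> = (\<Sum>i\<in>UNIV. \<integral>\<^sup>+x. ennreal (v i) * f (x, i) \<partial>lborel)"
    by (subst nn_integral_marked_lebesgue) (use d assms in auto)
  finally show ?thesis .
qed

lemma sets_palm_by_conditioning [simp]: "sets (palm_by_conditioning M X z) = sets lf_algebra"
  by (cases z) (simp add: palm_by_conditioning_def)

lemma nn_integral_palm_by_conditioning:
  assumes f: "f \<in> borel_measurable lf_algebra"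
  shows "(\<integral>\<^sup>+\<psi>. f \<psi> \<partial>palm_by_conditioning M X (x, i)) =
    (\<integral>\<^sup>+\<omega>. indicator {\<omega>. x \<in> X i \<omega>} \<omega> * f (\<Psi> \<omega>) \<partial>M) / ennreal (v i)"
proof -
  let ?A = "{\<omega>\<in>space M. x \<in> X i \<omega>}"
  have \<Psi>: "\<Psi> \<in> measurable (uniform_measure M ?A) lf_algebra" by simp
  have "(\<integral>\<^sup>+\<psi>. f \<psi> \<partial>palm_by_conditioning M X (x, i)) = (\<integral>\<^sup>+\<omega>. f (\<Psi> \<omega>) \<partial>uniform_measure M ?A)"
    unfolding palm_by_conditioning_def using f by (simp add: nn_integral_distr[OF \<Psi>])
  also have "\<dots> = (\<integral>\<^sup>+\<omega>. f (\<Psi> \<omega>) * indicator ?A \<omega> \<partial>M) / emeasure M ?A"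
    using measurable_compose[OF measurable_\<Psi> f] by (intro nn_integral_uniform_measure) auto
  also have "(\<integral>\<^sup>+\<omega>. f (\<Psi> \<omega>) * indicator ?A \<omega> \<partial>M) = (\<integral>\<^sup>+\<omega>. indicator {\<omega>. x \<in> X i \<omega>} \<omega> * f (\<Psi> \<omega>) \<partial>M)"
    by (intro nn_integral_cong) (auto simp: indicator_def)
  finally show ?thesis by (simp add: emeasure_eq_measure prob_mem)
qed

lemma prob_space_palm_by_conditioning: "prob_space (palm_by_conditioning M X z)"
proof (cases z)
  case (Pair x i)
  let ?A = "{\<omega>\<in>space M. x \<in> X i \<omega>}"
  have "emeasure M ?A \<noteq> 0" "emeasure M ?A \<noteq> \<infinity>"
    using v_pos[of i] by (auto simp: emeasure_eq_measure prob_mem)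
  then interpret U: prob_space "uniform_measure M ?A" by (rule prob_space_uniform_measure)
  show ?thesis unfolding Pair palm_by_conditioning_def by (auto intro!: U.prob_space_distr)
qed

lemma measurable_palm_by_conditioning:
  "palm_by_conditioning M X \<in> measurable marked_space (prob_algebra lf_algebra)"
proof (intro measurable_prob_algebraI measurable_subprob_algebra)
  fix A :: "('b \<times> 2) measure set" assume A: "A \<in> sets lf_algebra"
  show "(\<lambda>z. emeasure (palm_by_conditioning M X z) A) \<in> borel_measurable marked_space"
  proof (rule measurable_marked_spaceI)
    fix i
    have mem: "Measurable.pred (borel \<Otimes>\<^sub>M M) (\<lambda>z. fst z \<in> X i (snd z))"
      by (intro measurable_mem_closed_set measurable_compose[OF measurable_snd measurable_X]) simp
    have ind: "(\<lambda>z. indicator A (\<Psi> (snd z)) :: ennreal) \<in> borel_measurable (borel \<Otimes>\<^sub>M M)"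
      using A by (intro measurable_compose[OF measurable_snd] measurable_compose[OF measurable_\<Psi>]) simp
    have "(\<lambda>x. \<integral>\<^sup>+\<omega>. indicator {\<omega>. x \<in> X i \<omega>} \<omega> * indicator A (\<Psi> \<omega>) \<partial>M) \<in> borel_measurable borel"
    proof (rule borel_measurable_nn_integral)
      have "(\<lambda>z. indicator {\<omega>. fst z \<in> X i \<omega>} (snd z) :: ennreal) \<in> borel_measurable (borel \<Otimes>\<^sub>M M)"
        using mem by (simp add: indicator_def)
      from borel_measurable_times_ennreal[OF this ind]
      show "(\<lambda>(x, \<omega>). indicator {\<omega>. x \<in> X i \<omega>} \<omega> * indicator A (\<Psi> \<omega>) :: ennreal) \<in> borel_measurable (borel \<Otimes>\<^sub>M M)"
        by (simp add: case_prod_beta)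
    qed
    then have "(\<lambda>x. (\<integral>\<^sup>+\<omega>. indicator {\<omega>. x \<in> X i \<omega>} \<omega> * indicator A (\<Psi> \<omega>) \<partial>M) / ennreal (v i)) \<in> borel_measurable borel"
      by measurable
    moreover have "emeasure (palm_by_conditioning M X (x, i)) A =
        (\<integral>\<^sup>+\<omega>. indicator {\<omega>. x \<in> X i \<omega>} \<omega> * indicator A (\<Psi> \<omega>) \<partial>M) / ennreal (v i)" for x
      using nn_integral_palm_by_conditioning[of "indicator A" x i] A by simp
    ultimately show "(\<lambda>x. emeasure (palm_by_conditioning M X (x, i)) A) \<in> borel_measurable borel"
      by simp
  qed
qed (auto simp: prob_space_palm_by_conditioning prob_space_imp_subprob_space)

text \<open>In Campbell's formula the expectation over the event \<open>x \<in> X i\<close> is the probability \<open>v i\<close> of this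
  event, which is the density of the intensity measure, times the conditional expectation.\<close>

lemma palm_family_palm_by_conditioning: "palm_family M \<Psi> (palm_by_conditioning M X)"
  unfolding palm_family_def
proof (intro conjI allI impI)
  show "palm_by_conditioning M X \<in> measurable marked_space (prob_algebra lf_algebra)"
    by (rule measurable_palm_by_conditioning)
  fix g :: "('b \<times> 2) \<times> ('b \<times> 2) measure \<Rightarrow> ennreal"
  assume g: "g \<in> borel_measurable (marked_space \<Otimes>\<^sub>M lf_algebra)"
  have section_g: "(\<lambda>\<psi>. g (z, \<psi>)) \<in> borel_measurable lf_algebra" for z
    using measurable_Pair2[OF g, of z] by simp
  have K: "palm_by_conditioning M X \<in> measurable marked_space (subprob_algebra lf_algebra)"
    using measurable_palm_by_conditioning by (rule measurable_prob_algebraD)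
  have inner: "(\<lambda>z. \<integral>\<^sup>+\<psi>. g (z, \<psi>) \<partial>palm_by_conditioning M X z) \<in> borel_measurable marked_space"
    by (rule nn_integral_measurable_subprob_algebra2[OF _ K]) (use g in simp)
  have pair: "(\<lambda>z. (snd z, \<Psi> (fst z))) \<in> measurable (M \<Otimes>\<^sub>M marked_space) (marked_space \<Otimes>\<^sub>M lf_algebra)"
    by measurable
  have "(\<integral>\<^sup>+\<omega>. (\<integral>\<^sup>+z. g (z, \<Psi> \<omega>) \<partial>\<Psi> \<omega>) \<partial>M) =
      (\<Sum>i\<in>UNIV. \<integral>\<^sup>+x. (\<integral>\<^sup>+\<omega>. indicator {\<omega>. x \<in> X i \<omega>} \<omega> * g ((x, i), \<Psi> \<omega>) \<partial>M) \<partial>lborel)"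
    using measurable_compose[OF pair g] by (intro nn_integral_\<Psi>) (simp add: case_prod_beta)
  also have "\<dots> = (\<Sum>i\<in>UNIV. \<integral>\<^sup>+x. ennreal (v i) * (\<integral>\<^sup>+\<psi>. g ((x, i), \<psi>) \<partial>palm_by_conditioning M X (x, i)) \<partial>lborel)"
  proof (intro sum.cong refl nn_integral_cong)
    fix x :: 'b and i :: 2
    show "(\<integral>\<^sup>+\<omega>. indicator {\<omega>. x \<in> X i \<omega>} \<omega> * g ((x, i), \<Psi> \<omega>) \<partial>M) =
        ennreal (v i) * (\<integral>\<^sup>+\<psi>. g ((x, i), \<psi>) \<partial>palm_by_conditioning M X (x, i))"
      using v_pos[of i]
      unfolding nn_integral_palm_by_conditioning[OF section_g] ennreal_times_divide mult.commute[of "ennreal (v i)"]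
      by (intro mult_divide_eq_ennreal[symmetric]) auto
  qed
  also have "\<dots> = (\<integral>\<^sup>+z. (\<integral>\<^sup>+\<psi>. g (z, \<psi>) \<partial>palm_by_conditioning M X z) \<partial>intensity_measure M \<Psi>)"
    by (rule nn_integral_intensity[OF inner, symmetric])
  finally show "(\<integral>\<^sup>+\<omega>. (\<integral>\<^sup>+z. g (z, \<Psi> \<omega>) \<partial>\<Psi> \<omega>) \<partial>M) =
    (\<integral>\<^sup>+z. (\<integral>\<^sup>+\<psi>. g (z, \<psi>) \<partial>palm_by_conditioning M X z) \<partial>intensity_measure M \<Psi>)" .
qed

end

section \<open>Laplace transforms of the covered volume and the hitting intensity\<close>

context closed_pair_space
begin

text \<open>As \<open>s\<close> grows, \<open>exp (- s\<^sup>d V / v)\<close> decreases to the indicator of \<open>V = 0\<close>, and \<open>1\<close> dominates.\<close>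

lemma tendsto_exp_volume:
  assumes A [measurable]: "A \<in> events" and B [measurable]: "B \<in> sets borel" and v: "0 < v" and d: "0 < (d::nat)"
  shows "((\<lambda>s. LINT \<omega>|M. indicator A \<omega> * exp (- (s ^ d * measure lborel (X i \<omega> \<inter> B) / v)))
    \<longlongrightarrow> prob {\<omega>\<in>A. measure lborel (X i \<omega> \<inter> B) = 0}) at_top"
proof -
  let ?V = "\<lambda>\<omega>. measure lborel (X i \<omega> \<inter> B)"
  let ?f = "\<lambda>\<omega>. indicator {\<omega>\<in>A. ?V \<omega> = 0} \<omega> :: real"
  have S [measurable]: "{\<omega>\<in>A. ?V \<omega> = 0} \<in> events"
  proof -
    have "{\<omega>\<in>A. ?V \<omega> = 0} = A \<inter> {\<omega>\<in>space M. ?V \<omega> = 0}" using sets.sets_into_space[OF A] by auto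
    also have "\<dots> \<in> events" by measurable
    finally show ?thesis .
  qed
  have "((\<lambda>s. LINT \<omega>|M. indicator A \<omega> * exp (- (s ^ d * ?V \<omega> / v))) \<longlongrightarrow> integral\<^sup>L M ?f) at_top"
  proof (rule integral_dominated_convergence_at_top)
    show "integrable M (\<lambda>_. 1 :: real)" by simp
    show "AE \<omega> in M. ((\<lambda>s. indicator A \<omega> * exp (- (s ^ d * ?V \<omega> / v))) \<longlongrightarrow> ?f \<omega>) at_top"
    proof (intro AE_I2)
      fix \<omega>
      show "((\<lambda>s. indicator A \<omega> * exp (- (s ^ d * ?V \<omega> / v))) \<longlongrightarrow> ?f \<omega>) at_top"
      proof (cases "\<omega> \<in> A \<and> ?V \<omega> \<noteq> 0")
        case True
        then have pos: "0 < ?V \<omega> / v" using v by (simp add: zero_less_measure_iff)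
        have "filterlim (\<lambda>s. (?V \<omega> / v) * s ^ d) at_top (at_top :: real filter)"
          using pos d by (intro filterlim_tendsto_pos_mult_at_top[OF tendsto_const] filterlim_pow_at_top filterlim_ident)
        then have "filterlim (\<lambda>s. - ((?V \<omega> / v) * s ^ d)) at_bot (at_top :: real filter)"
          by (simp add: filterlim_uminus_at_bot)
        then have "((\<lambda>s. exp (- ((?V \<omega> / v) * s ^ d))) \<longlongrightarrow> 0) (at_top :: real filter)"
          by (rule filterlim_compose[OF exp_at_bot])
        then show ?thesis using True by (simp add: mult.commute)
      next
        case False
        then show ?thesis by (auto simp: indicator_def)
      qed
    qed
    show "eventually (\<lambda>s. AE \<omega> in M. norm (indicator A \<omega> * exp (- (s ^ d * ?V \<omega> / v))) \<le> 1) (at_top :: real filter)"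
      using eventually_ge_at_top[of 0]
    proof eventually_elim
      case (elim s)
      have "norm (indicator A \<omega> * exp (- (s ^ d * ?V \<omega> / v))) \<le> 1" for \<omega>
        using elim v by (auto simp: indicator_def)
      then show ?case by simp
    qed
  qed measurable
  then show ?thesis by simp
qed

end

context stationary_closed_pair
begin

text \<open>By stationarity and Fubini's theorem, the probability that the origin is at distance exactly
  \<open>t\<close> from the random set is the mean volume per unit volume of a null set.\<close>

lemma AE_hits_cball_imp_hits_ball:
  assumes t: "0 < t"
  shows "AE \<omega> in M. X i \<omega> \<inter> cball 0 t \<noteq> {} \<longrightarrow> X i \<omega> \<inter> ball 0 t \<noteq> {}"
proof -
  let ?T = "\<lambda>F x. F \<inter> cball x t \<noteq> {} \<and> F \<inter> ball x t = {}"
  interpret P: pair_sigma_finite M "lborel :: 'b measure"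
    by (intro pair_sigma_finite.intro sigma_finite_measure_axioms lborel.sigma_finite_measure_axioms)
  have ev: "{\<omega>\<in>space M. ?T (X i \<omega>) x} \<in> events" for x
    using measurable_touches[OF measurable_X, of "\<lambda>_. x"] by (simp add: pred_def)
  have const: "\<P>(\<omega> in M. ?T (X i \<omega>) x) = \<P>(\<omega> in M. ?T (X i \<omega>) 0)" for x
  proof -
    let ?Q = "\<lambda>F. ?T (if i = 1 then fst F else snd F) x"
    have Q: "Measurable.pred (fell \<Otimes>\<^sub>M fell) ?Q"
      by (rule measurable_touches[OF measurable_component_select]) simp
    have "\<P>(\<omega> in M. ?T (X i \<omega>) x) = \<P>(\<omega> in M. ?T (translated x X i \<omega>) x)"
      using prob_translated[OF Q, of x] unfolding component_select by (rule sym)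
    also have "\<dots> = \<P>(\<omega> in M. ?T (X i \<omega>) 0)"
      using translated_Int_cball[of x i _ 0 t] translated_Int_ball[of x i _ 0 t] by simp
    finally show ?thesis .
  qed
  have meas: "(\<lambda>z. indicator {z. ?T (X i (fst z)) (snd z)} z :: ennreal) \<in> borel_measurable (M \<Otimes>\<^sub>M lborel)"
  proof -
    have "Measurable.pred (M \<Otimes>\<^sub>M lborel) (\<lambda>z. ?T (X i (fst z)) (snd z))"
      by (intro measurable_touches measurable_compose[OF measurable_fst measurable_X]) simp
    then show ?thesis by (simp add: indicator_def)
  qed
  have "(\<integral>\<^sup>+x. (\<integral>\<^sup>+\<omega>. indicator {z. ?T (X i (fst z)) (snd z)} (\<omega>, x) \<partial>M) \<partial>lborel) =
      (\<integral>\<^sup>+\<omega>. (\<integral>\<^sup>+x. indicator {z. ?T (X i (fst z)) (snd z)} (\<omega>, x) \<partial>lborel) \<partial>M)"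
    using meas by (intro P.Fubini') (simp add: case_prod_beta)
  also have "\<dots> = (\<integral>\<^sup>+\<omega>. 0 \<partial>M)"
  proof (intro nn_integral_cong)
    fix \<omega> assume \<omega>: "\<omega> \<in> space M"
    let ?S = "{x. ?T (X i \<omega>) x}"
    have S: "?S \<in> sets lborel"
    proof -
      have "(\<lambda>_. X i \<omega>) \<in> measurable borel fell" using closed_X[OF \<omega>] by simp
      from measurable_touches[OF this measurable_ident] show ?thesis by (simp add: pred_def)
    qed
    have "negligible ?S" using negligible_sphere_around_closed_set[OF closed_X[OF \<omega>] t] .
    then have "?S \<in> null_sets lborel"
      using S by (simp add: negligible_iff_null_sets null_sets_completion_iff)
    moreover have "(\<integral>\<^sup>+x. indicator {z. ?T (X i (fst z)) (snd z)} (\<omega>, x) \<partial>lborel) = (\<integral>\<^sup>+x. indicator ?S x \<partial>lborel)"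
      by (intro nn_integral_cong) (simp add: indicator_def)
    ultimately show "(\<integral>\<^sup>+x. indicator {z. ?T (X i (fst z)) (snd z)} (\<omega>, x) \<partial>lborel) = 0"
      using S by (simp add: null_setsD1)
  qed
  also have "\<dots> = 0" by simp
  finally have zero: "(\<integral>\<^sup>+x. (\<integral>\<^sup>+\<omega>. indicator {z. ?T (X i (fst z)) (snd z)} (\<omega>, x) \<partial>M) \<partial>lborel) = 0" .
  have "(\<integral>\<^sup>+\<omega>. indicator {z. ?T (X i (fst z)) (snd z)} (\<omega>, x) \<partial>M) = ennreal \<P>(\<omega> in M. ?T (X i \<omega>) 0)" for x
  proof -
    have "(\<integral>\<^sup>+\<omega>. indicator {z. ?T (X i (fst z)) (snd z)} (\<omega>, x) \<partial>M) = (\<integral>\<^sup>+\<omega>. indicator {\<omega>\<in>space M. ?T (X i \<omega>) x} \<omega> \<partial>M)"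
      by (intro nn_integral_cong) (simp add: indicator_def)
    also have "\<dots> = ennreal \<P>(\<omega> in M. ?T (X i \<omega>) x)"
      using ev by (simp add: emeasure_eq_measure)
    finally show ?thesis by (simp only: const[of x])
  qed
  with zero have "(\<integral>\<^sup>+x. ennreal \<P>(\<omega> in M. ?T (X i \<omega>) 0) \<partial>(lborel :: 'b measure)) = 0" by simp
  then have "\<P>(\<omega> in M. ?T (X i \<omega>) 0) = 0" by (simp add: ennreal_eq_0_iff measure_le_0_iff)
  then have "{\<omega>\<in>space M. ?T (X i \<omega>) 0} \<in> null_sets M"
    using ev by (intro null_setsI) (simp_all add: emeasure_eq_measure)
  from AE_not_in[OF this] AE_space show ?thesis by eventually_elim auto
qed

text \<open>A charged set that hits the open ball covers a positive volume of it. The remaining case, that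
  the set only touches the boundary sphere, has probability zero.\<close>

lemma volume_eq_0_iff_misses:
  assumes t: "0 < t" and charged: "locally_charged M (X i)"
  shows "AE \<omega> in M. measure lborel (X i \<omega> \<inter> cball 0 t) = 0 \<longleftrightarrow> X i \<omega> \<inter> cball 0 t = {}"
  using charged[unfolded locally_charged_def] AE_hits_cball_imp_hits_ball[OF t, of i] AE_space
proof eventually_elim
  case (elim \<omega>)
  show ?case
  proof
    assume zero: "measure lborel (X i \<omega> \<inter> cball 0 t) = 0"
    show "X i \<omega> \<inter> cball 0 t = {}"
    proof (rule ccontr)
      assume "X i \<omega> \<inter> cball 0 t \<noteq> {}"
      then obtain y where y: "y \<in> X i \<omega>" "norm y < t" using elim(2) by auto
      let ?r = "t - norm y"
      have r: "0 < ?r" using y by simp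
      have "cball y ?r \<subseteq> cball 0 t"
      proof
        fix z assume "z \<in> cball y ?r"
        then have "norm (z - y) \<le> t - norm y" by (simp add: dist_norm norm_minus_commute)
        then show "z \<in> cball 0 t" using norm_triangle_ineq[of "z - y" y] by simp
      qed
      then have "emeasure lborel (X i \<omega> \<inter> cball y ?r) \<le> emeasure lborel (X i \<omega> \<inter> cball 0 t)"
        using closed_X[OF elim(3)] by (intro emeasure_mono) auto
      also have "\<dots> = 0" using zero by (subst emeasure_covered_volume) auto
      finally have "measure lborel (X i \<omega> \<inter> cball y ?r) = 0" by (simp add: measure_def)
      moreover have "0 < measure lborel (X i \<omega> \<inter> cball y ?r)"
        by (rule elim(1)[rule_format, OF y(1) r])
      ultimately show False by simp
    qed
  qed simp
qed

lemma component_coverage_measure: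
  assumes \<omega>: "\<omega> \<in> space M"
  shows "component (\<Psi> \<omega>) i = density lborel (indicator (X i \<omega>))"
proof -
  let ?N = "density lborel (indicator (X i \<omega>) :: 'b \<Rightarrow> ennreal)"
  have "emeasure (\<Psi> \<omega>) (B \<times> {i}) = emeasure ?N B" if "B \<in> sets borel" for B
    using that closed_X[OF \<omega>]
    by (subst emeasure_coverage_measure_Times)
       (auto simp: emeasure_density indicator_inter_arith[symmetric])
  moreover have space_N: "space ?N = UNIV" "sets ?N = sets borel" by auto
  ultimately have "component (\<Psi> \<omega>) i = measure_of (space ?N) (sets ?N) (emeasure ?N)"
    unfolding component_def space_N
    using sets.sigma_sets_eq[of "borel :: 'b measure"] by (intro measure_of_eq) auto
  then show ?thesis by (simp only: measure_of_of_measure)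
qed

text \<open>By Fubini's theorem, the hitting intensity averages over the window the probability that \<open>x\<close>
  lies in \<open>X 1\<close> and the ball around \<open>x\<close> hits \<open>X 2\<close>; by stationarity it is the same for all \<open>x\<close>.\<close>

lemma T12_eq:
  assumes B: "B \<in> sets borel" "bounded B" "0 < measure lborel B"
  shows "T12 M X B t = \<P>(\<omega> in M. 0 \<in> X 1 \<omega> \<and> X 2 \<omega> \<inter> cball 0 t \<noteq> {})"
proof -
  let ?H = "\<lambda>\<omega> x. x \<in> X 1 \<omega> \<and> X 2 \<omega> \<inter> cball x t \<noteq> {}"
  let ?P0 = "\<P>(\<omega> in M. ?H \<omega> 0)"
  define h where "h \<omega> x = (of_bool (?H \<omega> x) * indicator B x :: ennreal)" for \<omega> x
  interpret P: pair_sigma_finite M "lborel :: 'b measure"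
    by (intro pair_sigma_finite.intro sigma_finite_measure_axioms lborel.sigma_finite_measure_axioms)
  have ev: "{\<omega>\<in>space M. ?H \<omega> x} \<in> events" for x by measurable
  have const: "\<P>(\<omega> in M. ?H \<omega> x) = ?P0" for x
  proof -
    let ?Q = "\<lambda>F. x \<in> fst F \<and> snd F \<inter> cball x t \<noteq> {}"
    have "Measurable.pred (fell \<Otimes>\<^sub>M fell) ?Q"
      by (intro pred_intros_logic measurable_mem_closed_set measurable_hits_cball) auto
    from prob_translated[OF this, of x] show ?thesis
      using translated_Int_cball[of x 2 _ 0 t] mem_translated[of 0 x 1] by simp
  qed
  have h_meas: "(\<lambda>z. h (fst z) (snd z)) \<in> borel_measurable (M \<Otimes>\<^sub>M lborel)"
  proof -
    have mem: "Measurable.pred (M \<Otimes>\<^sub>M lborel) (\<lambda>z. ?H (fst z) (snd z))"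
      by (intro pred_intros_logic measurable_mem_closed_set measurable_hits_cball
          measurable_compose[OF measurable_fst measurable_X]) auto
    have "(\<lambda>z. of_bool (?H (fst z) (snd z)) :: ennreal) \<in> borel_measurable (M \<Otimes>\<^sub>M lborel)"
      using mem by simp
    moreover have "(\<lambda>z. indicator B (snd z) :: ennreal) \<in> borel_measurable (M \<Otimes>\<^sub>M lborel)"
      using B by (intro measurable_compose[OF measurable_snd]) simp
    ultimately show ?thesis unfolding h_def by (rule borel_measurable_times_ennreal)
  qed
  have hx_meas: "h \<omega> \<in> borel_measurable lborel" if "\<omega> \<in> space M" for \<omega>
    using measurable_Pair2[OF h_meas that] by simp
  have inner: "(LINT x:B|component (\<Psi> \<omega>) 1. of_bool (X 2 \<omega> \<inter> cball x t \<noteq> {})) = enn2real (\<integral>\<^sup>+x. h \<omega> x \<partial>lborel)"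
    if \<omega>: "\<omega> \<in> space M" for \<omega>
  proof -
    have hit: "(\<lambda>x. of_bool (X 2 \<omega> \<inter> cball x t \<noteq> {}) :: real) \<in> borel_measurable lborel"
    proof -
      have "(\<lambda>_. X 2 \<omega>) \<in> measurable borel fell" using closed_X[OF \<omega>] by simp
      from measurable_hits_cball[OF this measurable_ident, of t] show ?thesis by simp
    qed
    have "(LINT x:B|component (\<Psi> \<omega>) 1. of_bool (X 2 \<omega> \<inter> cball x t \<noteq> {}) :: real) =
        (LINT x|density lborel (\<lambda>x. ennreal (indicator (X 1 \<omega>) x)). indicator B x * of_bool (X 2 \<omega> \<inter> cball x t \<noteq> {}))"
      unfolding component_coverage_measure[OF \<omega>] set_lebesgue_integral_def by (simp add: ennreal_indicator)
    also have "\<dots> = (LINT x|lborel. indicator (X 1 \<omega>) x * (indicator B x * of_bool (X 2 \<omega> \<inter> cball x t \<noteq> {})))"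
      using hit B closed_X[OF \<omega>] by (subst integral_density) auto
    also have "\<dots> = enn2real (\<integral>\<^sup>+x. ennreal (indicator (X 1 \<omega>) x * (indicator B x * of_bool (X 2 \<omega> \<inter> cball x t \<noteq> {}))) \<partial>lborel)"
      using hit B closed_X[OF \<omega>] by (intro integral_eq_nn_integral) auto
    also have "\<dots> = enn2real (\<integral>\<^sup>+x. h \<omega> x \<partial>lborel)"
      by (intro arg_cong[of _ _ enn2real] nn_integral_cong) (auto simp: h_def indicator_def)
    finally show ?thesis .
  qed
  have finite: "(\<integral>\<^sup>+x. h \<omega> x \<partial>lborel) < \<infinity>" for \<omega>
  proof -
    have "(\<integral>\<^sup>+x. h \<omega> x \<partial>lborel) \<le> (\<integral>\<^sup>+x. indicator B x \<partial>lborel)"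
      by (intro nn_integral_mono) (auto simp: h_def indicator_def)
    also have "\<dots> < \<infinity>" using B emeasure_bounded_finite by simp
    finally show ?thesis .
  qed
  have I_meas: "(\<lambda>\<omega>. \<integral>\<^sup>+x. h \<omega> x \<partial>lborel) \<in> borel_measurable M"
    using h_meas by (intro lborel.borel_measurable_nn_integral) (simp add: case_prod_beta)
  have "T12 M X B t = (LINT \<omega>|M. 1 / measure lborel B * enn2real (\<integral>\<^sup>+x. h \<omega> x \<partial>lborel))"
    unfolding T12_def by (intro Bochner_Integration.integral_cong refl) (simp only: inner)
  also have "\<dots> = 1 / measure lborel B * (LINT \<omega>|M. enn2real (\<integral>\<^sup>+x. h \<omega> x \<partial>lborel))"
    by (rule integral_mult_right_zero)
  also have "(LINT \<omega>|M. enn2real (\<integral>\<^sup>+x. h \<omega> x \<partial>lborel)) = enn2real (\<integral>\<^sup>+\<omega>. ennreal (enn2real (\<integral>\<^sup>+x. h \<omega> x \<partial>lborel)) \<partial>M)"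
    using I_meas by (intro integral_eq_nn_integral) auto
  also have "(\<integral>\<^sup>+\<omega>. ennreal (enn2real (\<integral>\<^sup>+x. h \<omega> x \<partial>lborel)) \<partial>M) = (\<integral>\<^sup>+\<omega>. (\<integral>\<^sup>+x. h \<omega> x \<partial>lborel) \<partial>M)"
    using finite by (intro nn_integral_cong) simp
  also have "\<dots> = (\<integral>\<^sup>+x. (\<integral>\<^sup>+\<omega>. h \<omega> x \<partial>M) \<partial>lborel)"
    using h_meas by (intro P.Fubini'[symmetric]) (simp add: case_prod_beta)
  also have "\<dots> = (\<integral>\<^sup>+x. ennreal ?P0 * indicator B x \<partial>lborel)"
  proof (intro nn_integral_cong)
    fix x :: 'b
    have "(\<integral>\<^sup>+\<omega>. h \<omega> x \<partial>M) = (\<integral>\<^sup>+\<omega>. indicator B x * indicator {\<omega>\<in>space M. ?H \<omega> x} \<omega> \<partial>M)"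
      by (intro nn_integral_cong) (auto simp: h_def indicator_def)
    also have "\<dots> = indicator B x * emeasure M {\<omega>\<in>space M. ?H \<omega> x}"
      by (rule nn_integral_cmult_indicator[OF ev])
    also have "\<dots> = ennreal ?P0 * indicator B x"
      by (simp only: emeasure_eq_measure const[of x] mult.commute)
    finally show "(\<integral>\<^sup>+\<omega>. h \<omega> x \<partial>M) = ennreal ?P0 * indicator B x" .
  qed
  also have "\<dots> = ennreal ?P0 * ennreal (measure lborel B)"
    using B emeasure_bounded_finite[OF B(2)]
    by (subst nn_integral_cmult_indicator) (auto simp: emeasure_eq_ennreal_measure)
  finally show ?thesis using B by (simp add: ennreal_mult[symmetric])
qed

end

section \<open>The Palm version at the origin\<close>

context stationary_closed_pair
begin

lemma emeasure_palm_by_conditioning: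
  assumes A: "A \<in> sets lf_algebra"
  shows "emeasure (palm_by_conditioning M X (x, i)) A = ennreal \<P>(\<omega> in M. x \<in> X i \<omega> \<and> \<Psi> \<omega> \<in> A) / ennreal (v i)"
proof -
  have "{\<omega>\<in>space M. x \<in> X i \<omega> \<and> \<Psi> \<omega> \<in> A} = {\<omega>\<in>space M. x \<in> X i \<omega>} \<inter> (\<Psi> -` A \<inter> space M)" by auto
  also have "\<dots> \<in> events" using measurable_sets[OF measurable_\<Psi> A] by auto
  finally have ev: "{\<omega>\<in>space M. x \<in> X i \<omega> \<and> \<Psi> \<omega> \<in> A} \<in> events" .
  have "emeasure (palm_by_conditioning M X (x, i)) A =
      (\<integral>\<^sup>+\<omega>. indicator {\<omega>. x \<in> X i \<omega>} \<omega> * indicator A (\<Psi> \<omega>) \<partial>M) / ennreal (v i)"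
    using nn_integral_palm_by_conditioning[of "indicator A" x i] A by simp
  also have "(\<integral>\<^sup>+\<omega>. indicator {\<omega>. x \<in> X i \<omega>} \<omega> * indicator A (\<Psi> \<omega>) \<partial>M) =
      (\<integral>\<^sup>+\<omega>. indicator {\<omega>\<in>space M. x \<in> X i \<omega> \<and> \<Psi> \<omega> \<in> A} \<omega> \<partial>M)"
    by (intro nn_integral_cong) (auto simp: indicator_def)
  finally show ?thesis using ev by (simp add: emeasure_eq_measure)
qed

text \<open>Conditioning the translated pair on \<open>x + a\<close> being covered is conditioning the original pair on
  \<open>x\<close> being covered and shifting its coverage measure; stationarity identifies the two pairs in
  law.\<close>

lemma translation_covariant_palm_by_conditioning: "translation_covariant (palm_by_conditioning M X)"
  unfolding translation_covariant_def
proof (intro allI measure_eqI)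
  fix x a :: 'b and i :: 2 and A
  let ?shift = "\<lambda>\<psi>::('b \<times> 2) measure. distr \<psi> marked_space (\<lambda>(y, j). (y + a, j))"
  assume "A \<in> sets (palm_by_conditioning M X (x + a, i))"
  then have A: "A \<in> sets lf_algebra" by simp
  have shift: "?shift \<in> measurable (palm_by_conditioning M X (x, i)) lf_algebra"
    using measurable_measure_shift[of a] by (simp add: measurable_cong_sets[OF sets_palm_by_conditioning refl])
  have space: "space (palm_by_conditioning M X (x, i)) = space lf_algebra"
    by (rule sets_eq_imp_space_eq) simp
  let ?Y = "\<lambda>(i::2) F. if i = 1 then fst F else snd F :: 'b set"
  let ?Q = "\<lambda>F. x + a \<in> (if i = 1 then fst F else snd F) \<and> coverage_measure ?Y F \<in> A"
  have Q: "Measurable.pred (fell \<Otimes>\<^sub>M fell) ?Q"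
  proof (intro pred_intros_logic measurable_mem_closed_set measurable_component_select)
    have "coverage_measure ?Y \<in> measurable (fell \<Otimes>\<^sub>M fell) lf_algebra"
      by (rule measurable_coverage_measure) simp
    then show "Measurable.pred (fell \<Otimes>\<^sub>M fell) (\<lambda>F. coverage_measure ?Y F \<in> A)"
      using A by (rule pred_sets2[rotated])
  qed simp
  have Y: "coverage_measure ?Y (Z 1 \<omega>, Z 2 \<omega>) = coverage_measure Z \<omega>" for Z :: "2 \<Rightarrow> 'a \<Rightarrow> 'b set" and \<omega>
    unfolding coverage_measure_def component_select ..
  have "\<P>(\<omega> in M. x + a \<in> X i \<omega> \<and> \<Psi> \<omega> \<in> A) =
      \<P>(\<omega> in M. x + a \<in> translated a X i \<omega> \<and> coverage_measure (translated a X) \<omega> \<in> A)"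
    using prob_translated[OF Q, of a] unfolding Y component_select by (rule sym)
  also have "\<dots> = \<P>(\<omega> in M. x \<in> X i \<omega> \<and> ?shift (\<Psi> \<omega>) \<in> A)"
    by (intro arg_cong[of _ _ prob] Collect_cong conj_cong refl)
       (simp_all only: mem_translated distr_shift_coverage_measure[of X, OF closed_X])
  also have "\<dots> = \<P>(\<omega> in M. x \<in> X i \<omega> \<and> \<Psi> \<omega> \<in> ?shift -` A \<inter> space lf_algebra)"
    using measurable_space[OF measurable_\<Psi>]
    by (intro arg_cong[of _ _ prob] Collect_cong conj_cong refl) auto
  finally show "emeasure (palm_by_conditioning M X (x + a, i)) A =
      emeasure (distr (palm_by_conditioning M X (x, i)) lf_algebra ?shift) A"
    using A measurable_sets[OF measurable_measure_shift A, of a]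
    by (simp add: emeasure_distr[OF shift A] space emeasure_palm_by_conditioning)
qed simp

lemma palm_familyD:
  assumes Q: "palm_family M \<Psi> Q"
  shows "sets (Q z) = sets lf_algebra" "prob_space (Q z)"
  using measurable_space[of Q marked_space "prob_algebra lf_algebra" z] Q
  by (auto simp: palm_family_def space_prob_algebra)

text \<open>Palm families agree only almost everywhere, but averaging the covariance relation over the
  unit ball determines the Palm version at the origin: all translates contribute the same amount.\<close>

lemma palm_ball_average:
  fixes c t :: real
  assumes Q: "palm_family M \<Psi> Q" and cov: "translation_covariant Q"
  defines "H \<equiv> \<lambda>\<psi> x. ennreal (exp (- (c * measure \<psi> (cball x t \<times> {2}))))"
  shows "(\<integral>\<^sup>+\<omega>. (\<integral>\<^sup>+z. indicator (cball 0 1 \<times> {1}) z * H (\<Psi> \<omega>) (fst z) \<partial>\<Psi> \<omega>) \<partial>M) =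
    ennreal (v 1) * emeasure lborel (cball 0 1 :: 'b set) * (\<integral>\<^sup>+\<psi>. H \<psi> 0 \<partial>Q (0, 1))"
proof -
  let ?g = "\<lambda>(z, \<psi>). indicator (cball 0 1 \<times> {1}) z * H \<psi> (fst z)"
  let ?K = "\<integral>\<^sup>+\<psi>. H \<psi> 0 \<partial>Q (0, 1)"
  have H_meas: "(\<lambda>\<psi>. H \<psi> x) \<in> borel_measurable lf_algebra" for x
  proof -
    note [measurable] = measurable_measure_cball[of "\<lambda>_. x" lf_algebra "\<lambda>\<psi>. \<psi>" t 2]
    show ?thesis unfolding H_def by measurable
  qed
  have H_joint: "(\<lambda>p. H (snd p) (fst (fst p))) \<in> borel_measurable (marked_space \<Otimes>\<^sub>M lf_algebra)"
  proof -
    have "(\<lambda>p. fst (fst p)) \<in> measurable (marked_space \<Otimes>\<^sub>M lf_algebra) borel"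
      unfolding marked_space_def by simp
    note [measurable] = measurable_measure_cball[OF this measurable_snd, of t 2]
    show ?thesis unfolding H_def by measurable
  qed
  have g: "?g \<in> borel_measurable (marked_space \<Otimes>\<^sub>M lf_algebra)"
    unfolding case_prod_beta
    by (intro borel_measurable_times_ennreal H_joint measurable_compose[OF measurable_fst borel_measurable_indicator]) simp
  have kernel: "Q \<in> measurable marked_space (subprob_algebra lf_algebra)"
    using Q by (simp add: palm_family_def measurable_prob_algebraD)
  have inner: "(\<lambda>z. \<integral>\<^sup>+\<psi>. ?g (z, \<psi>) \<partial>Q z) \<in> borel_measurable marked_space"
    by (rule nn_integral_measurable_subprob_algebra2[OF _ kernel]) (use g in simp)
  have invariant: "(\<integral>\<^sup>+\<psi>. H \<psi> x \<partial>Q (x, 1)) = ?K" for x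
  proof -
    let ?shift = "\<lambda>\<psi>::('b \<times> 2) measure. distr \<psi> marked_space (\<lambda>(y, j). (y + x, j))"
    have Qx: "Q (x, 1) = distr (Q (0, 1)) lf_algebra ?shift"
      using cov[unfolded translation_covariant_def, rule_format, of 0 x 1] by simp
    have shift: "?shift \<in> measurable (Q (0, 1)) lf_algebra"
      using measurable_measure_shift[of x] by (simp add: measurable_cong_sets[OF palm_familyD(1)[OF Q] refl])
    have "(\<integral>\<^sup>+\<psi>. H \<psi> x \<partial>Q (x, 1)) = (\<integral>\<^sup>+\<psi>. H (?shift \<psi>) x \<partial>Q (0, 1))"
      unfolding Qx by (rule nn_integral_distr[OF shift]) (simp add: H_meas)
    also have "\<dots> = ?K"
    proof (intro nn_integral_cong)
      fix \<psi> assume "\<psi> \<in> space (Q (0, 1))"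
      then have \<psi>: "sets \<psi> = sets marked_space"
        using sets_eq_imp_space_eq[OF palm_familyD(1)[OF Q]] by (auto simp: locally_finite_measures_def)
      have "(\<lambda>(y, j). (y + x, j)) \<in> measurable \<psi> marked_space"
        using measurable_mark_shift[of x] by (simp add: measurable_cong_sets[OF \<psi> refl])
      then have "measure (?shift \<psi>) (cball x t \<times> {2}) =
          measure \<psi> ((\<lambda>(y, j). (y + x, j)) -` (cball x t \<times> {2}) \<inter> space \<psi>)"
        by (intro measure_distr) simp_all
      also have "(\<lambda>(y, j). (y + x, j)) -` (cball x t \<times> {2}) \<inter> space \<psi> = cball 0 t \<times> {2}"
        using sets_eq_imp_space_eq[OF \<psi>] by (auto simp: dist_norm)
      finally show "H (?shift \<psi>) x = H \<psi> 0" by (simp add: H_def)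
    qed
    finally show ?thesis .
  qed
  have inner_eq: "(\<integral>\<^sup>+\<psi>. ?g ((x, i), \<psi>) \<partial>Q (x, i)) = indicator (cball 0 1 \<times> {1}) (x, i) * ?K" for x i
    using invariant[of x] by (simp add: indicator_def)
  have "(\<integral>\<^sup>+\<omega>. (\<integral>\<^sup>+z. indicator (cball 0 1 \<times> {1}) z * H (\<Psi> \<omega>) (fst z) \<partial>\<Psi> \<omega>) \<partial>M) =
      (\<integral>\<^sup>+\<omega>. (\<integral>\<^sup>+z. ?g (z, \<Psi> \<omega>) \<partial>\<Psi> \<omega>) \<partial>M)" by simp
  also have "\<dots> = (\<integral>\<^sup>+z. (\<integral>\<^sup>+\<psi>. ?g (z, \<psi>) \<partial>Q z) \<partial>intensity_measure M \<Psi>)"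
    using Q g unfolding palm_family_def by blast
  also have "\<dots> = (\<Sum>i\<in>UNIV. \<integral>\<^sup>+x. ennreal (v i) * (\<integral>\<^sup>+\<psi>. ?g ((x, i), \<psi>) \<partial>Q (x, i)) \<partial>lborel)"
    by (rule nn_integral_intensity[OF inner])
  also have "\<dots> = (\<Sum>i\<in>UNIV. \<integral>\<^sup>+x. (ennreal (v i) * ?K * of_bool (i = 1)) * indicator (cball 0 1 :: 'b set) x \<partial>lborel)"
    unfolding inner_eq
  proof (intro sum.cong nn_integral_cong refl)
    fix i :: 2 and x :: 'b
    show "ennreal (v i) * (indicator (cball 0 1 \<times> {1}) (x, i) * ?K) =
        ennreal (v i) * ?K * of_bool (i = 1) * indicator (cball 0 1) x"
      by (cases "i = 1") (simp_all add: indicator_def mult_ac)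
  qed
  also have "\<dots> = (\<Sum>i\<in>UNIV. ennreal (v i) * ?K * of_bool (i = 1) * emeasure lborel (cball 0 1 :: 'b set))"
    by (intro sum.cong refl nn_integral_cmult_indicator) simp
  also have "\<dots> = (\<Sum>i\<in>UNIV. if i = (1::2) then ennreal (v 1) * ?K * emeasure lborel (cball 0 1 :: 'b set) else 0)"
    by (intro sum.cong refl) auto
  also have "\<dots> = ennreal (v 1) * emeasure lborel (cball 0 1 :: 'b set) * ?K"
    by (simp add: mult_ac)
  finally show ?thesis .
qed

lemma u0_eq: "u0 (cover_prob M X) t z = indicator (cball 0 t \<times> {2}) z / v 2"
  by (cases z) (auto simp: u0_def volume_fraction indicator_def)

lemma laplace_u0_eq:
  assumes Q: "sets Q = sets lf_algebra"
  shows "laplace Q (\<lambda>z. s * u0 (cover_prob M X) t z) =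
    enn2real (\<integral>\<^sup>+\<psi>. ennreal (exp (- (s / v 2 * measure \<psi> (cball 0 t \<times> {2})))) \<partial>Q)"
proof -
  have "laplace Q (\<lambda>z. s * u0 (cover_prob M X) t z) =
      (LINT \<psi>|Q. exp (- (s / v 2 * measure \<psi> (cball 0 t \<times> {2}))))"
    unfolding laplace_def
  proof (intro Bochner_Integration.integral_cong refl arg_cong[of _ _ "\<lambda>x. exp (- x)"])
    fix \<psi> :: "('b \<times> 2) measure" assume "\<psi> \<in> space Q"
    then have \<psi>: "sets \<psi> = sets marked_space"
      using sets_eq_imp_space_eq[OF Q] by (auto simp: locally_finite_measures_def)
    have "(LINT z|\<psi>. s * u0 (cover_prob M X) t z) = (LINT z|\<psi>. s / v 2 * indicator (cball 0 t \<times> {2}) z)"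
      by (simp add: u0_eq)
    also have "\<dots> = s / v 2 * measure \<psi> (cball 0 t \<times> {2} \<inter> space \<psi>)" by simp
    also have "cball 0 t \<times> {2} \<inter> space \<psi> = cball 0 t \<times> {2}"
      using sets_eq_imp_space_eq[OF \<psi>] by simp
    finally show "(LINT z|\<psi>. s * u0 (cover_prob M X) t z) = s / v 2 * measure \<psi> (cball 0 t \<times> {2})" .
  qed
  also have "\<dots> = enn2real (\<integral>\<^sup>+\<psi>. ennreal (exp (- (s / v 2 * measure \<psi> (cball 0 t \<times> {2})))) \<partial>Q)"
  proof (rule integral_eq_nn_integral)
    note [measurable] = measurable_measure_cball[of "\<lambda>_. 0" lf_algebra "\<lambda>\<psi>. \<psi>" t 2]
    have "(\<lambda>\<psi>. exp (- (s / v 2 * measure \<psi> (cball 0 t \<times> {2})))) \<in> borel_measurable lf_algebra"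
      by measurable
    then show "(\<lambda>\<psi>. exp (- (s / v 2 * measure \<psi> (cball 0 t \<times> {2})))) \<in> borel_measurable Q"
      by (simp add: measurable_cong_sets[OF Q refl])
  qed simp
  finally show ?thesis .
qed

text \<open>The ball average is expressed through \<open>\<Psi>\<close> alone, so every covariant Palm family has the same
  Laplace transform at the origin as conditioning on \<open>0 \<in> X 1\<close>.\<close>

lemma laplace_palm:
  assumes Q: "palm_family M \<Psi> Q" and cov: "translation_covariant Q"
  shows "laplace (Q (0, 1)) (\<lambda>z. s * u0 (cover_prob M X) t z) =
    (LINT \<omega>|M. indicator {\<omega>\<in>space M. 0 \<in> X 1 \<omega>} \<omega> * exp (- (s * measure lborel (X 2 \<omega> \<inter> cball 0 t) / v 2))) / v 1"
proof -
  let ?P = "palm_by_conditioning M X"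
  let ?H = "\<lambda>\<psi>. ennreal (exp (- (s / v 2 * measure \<psi> (cball 0 t \<times> {2}))))"
  let ?A = "{\<omega>\<in>space M. 0 \<in> X 1 \<omega>}"
  let ?e = "\<lambda>\<omega>. exp (- (s * measure lborel (X 2 \<omega> \<inter> cball 0 t) / v 2))"
  let ?b = "emeasure lborel (cball 0 1 :: 'b set)"
  have "ennreal (v 1) * ?b * (\<integral>\<^sup>+\<psi>. ?H \<psi> \<partial>Q (0, 1)) = ennreal (v 1) * ?b * (\<integral>\<^sup>+\<psi>. ?H \<psi> \<partial>?P (0, 1))"
    using palm_ball_average[OF Q cov, of "s / v 2" t]
      palm_ball_average[OF palm_family_palm_by_conditioning translation_covariant_palm_by_conditioning, of "s / v 2" t]
    by simp
  moreover have "ennreal (v 1) * ?b \<noteq> 0" "ennreal (v 1) * ?b \<noteq> \<infinity>"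
  proof -
    have "0 < ?b" by (simp add: emeasure_cball)
    moreover have "?b < \<infinity>" using emeasure_bounded_finite[of "cball 0 1 :: 'b set"] by simp
    ultimately show "ennreal (v 1) * ?b \<noteq> 0" "ennreal (v 1) * ?b \<noteq> \<infinity>"
      using v_pos[of 1] by (auto simp: ennreal_mult_eq_top_iff)
  qed
  ultimately have eq: "(\<integral>\<^sup>+\<psi>. ?H \<psi> \<partial>Q (0, 1)) = (\<integral>\<^sup>+\<psi>. ?H \<psi> \<partial>?P (0, 1))"
    by (simp add: ennreal_mult_cancel_left)
  note [measurable] = measurable_measure_cball[of "\<lambda>_. 0" lf_algebra "\<lambda>\<psi>. \<psi>" t 2]
  have H_meas: "?H \<in> borel_measurable lf_algebra" by measurable
  have e_meas: "(\<lambda>\<omega>. indicator ?A \<omega> * ?e \<omega>) \<in> borel_measurable M" by measurable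
  have "(\<integral>\<^sup>+\<psi>. ?H \<psi> \<partial>?P (0, 1)) = (\<integral>\<^sup>+\<omega>. indicator {\<omega>. 0 \<in> X 1 \<omega>} \<omega> * ?H (\<Psi> \<omega>) \<partial>M) / ennreal (v 1)"
    by (rule nn_integral_palm_by_conditioning[OF H_meas])
  also have "(\<integral>\<^sup>+\<omega>. indicator {\<omega>. 0 \<in> X 1 \<omega>} \<omega> * ?H (\<Psi> \<omega>) \<partial>M) = (\<integral>\<^sup>+\<omega>. ennreal (indicator ?A \<omega> * ?e \<omega>) \<partial>M)"
  proof (intro nn_integral_cong)
    fix \<omega> assume \<omega>: "\<omega> \<in> space M"
    have "measure (\<Psi> \<omega>) (cball 0 t \<times> {2}) = measure lborel (X 2 \<omega> \<inter> cball 0 t)"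
      using emeasure_coverage_measure_Times[of X, OF closed_X[OF \<omega>], of "cball 0 t" 2] by (simp add: measure_def)
    then show "indicator {\<omega>. 0 \<in> X 1 \<omega>} \<omega> * ?H (\<Psi> \<omega>) = ennreal (indicator ?A \<omega> * ?e \<omega>)"
      using \<omega> by (simp add: indicator_def)
  qed
  finally have "laplace (Q (0, 1)) (\<lambda>z. s * u0 (cover_prob M X) t z) =
      enn2real ((\<integral>\<^sup>+\<omega>. ennreal (indicator ?A \<omega> * ?e \<omega>) \<partial>M) / ennreal (v 1))"
    unfolding laplace_u0_eq[OF palm_familyD(1)[OF Q]] eq by simp
  also have "\<dots> = enn2real (\<integral>\<^sup>+\<omega>. ennreal (indicator ?A \<omega> * ?e \<omega>) \<partial>M) / v 1"
    using v_pos[of 1] by (simp add: divide_ennreal_def enn2real_mult inverse_ennreal divide_inverse)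
  also have "enn2real (\<integral>\<^sup>+\<omega>. ennreal (indicator ?A \<omega> * ?e \<omega>) \<partial>M) = (LINT \<omega>|M. indicator ?A \<omega> * ?e \<omega>)"
    by (rule integral_eq_nn_integral[symmetric, OF e_meas]) simp
  finally show ?thesis .
qed

lemma prob_volume_eq_0:
  assumes t: "0 < t" and charged: "locally_charged M (X 2)" and A: "A \<in> events"
  shows "prob {\<omega>\<in>A. measure lborel (X 2 \<omega> \<inter> cball 0 t) = 0} = prob {\<omega>\<in>A. X 2 \<omega> \<inter> cball 0 t = {}}"
proof (rule finite_measure_eq_AE)
  show "AE \<omega> in M. (\<omega> \<in> {\<omega>\<in>A. measure lborel (X 2 \<omega> \<inter> cball 0 t) = 0}) =
      (\<omega> \<in> {\<omega>\<in>A. X 2 \<omega> \<inter> cball 0 t = {}})"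
    using volume_eq_0_iff_misses[OF t charged] by eventually_elim simp
  have "{\<omega>\<in>A. measure lborel (X 2 \<omega> \<inter> cball 0 t) = 0} = A \<inter> {\<omega>\<in>space M. measure lborel (X 2 \<omega> \<inter> cball 0 t) = 0}"
    "{\<omega>\<in>A. X 2 \<omega> \<inter> cball 0 t = {}} = A \<inter> {\<omega>\<in>space M. X 2 \<omega> \<inter> cball 0 t = {}}"
    using sets.sets_into_space[OF A] by auto
  moreover have "{\<omega>\<in>space M. measure lborel (X 2 \<omega> \<inter> cball 0 t) = 0} \<in> events"
    "{\<omega>\<in>space M. X 2 \<omega> \<inter> cball 0 t = {}} \<in> events" by measurable
  ultimately show "{\<omega>\<in>A. measure lborel (X 2 \<omega> \<inter> cball 0 t) = 0} \<in> events"
    "{\<omega>\<in>A. X 2 \<omega> \<inter> cball 0 t = {}} \<in> events" using A by auto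
qed

end

section \<open>Scaling\<close>

lemma scaled_Int_cball:
  assumes "0 < s"
  shows "scaled s X i \<omega> \<inter> cball 0 (s * t) = (*\<^sub>R) s ` (X i \<omega> \<inter> cball 0 t)"
  using assms by (auto simp: scaled_def)

lemma measure_scaled_Int_cball:
  fixes X :: "2 \<Rightarrow> 'w \<Rightarrow> 'a::euclidean_space set"
  assumes s: "0 < s" and cl: "closed (X i \<omega>)"
  shows "measure lborel (scaled s X i \<omega> \<inter> cball 0 (s * t)) = s ^ DIM('a) * measure lborel (X i \<omega> \<inter> cball 0 t)"
proof -
  have S: "X i \<omega> \<inter> cball 0 t \<in> sets borel" using cl by auto
  have "closed ((*\<^sub>R) s ` (X i \<omega> \<inter> cball 0 t))" using cl by (intro closed_scaling) auto
  then have "measure lborel ((*\<^sub>R) s ` (X i \<omega> \<inter> cball 0 t)) = measure lebesgue ((*\<^sub>R) s ` (X i \<omega> \<inter> cball 0 t))"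
    by (intro measure_completion[symmetric]) auto
  also have "\<dots> = s ^ DIM('a) * measure lebesgue (X i \<omega> \<inter> cball 0 t)"
    using measure_lebesgue_affine[of s 0 "X i \<omega> \<inter> cball 0 t"] s by simp
  also have "measure lebesgue (X i \<omega> \<inter> cball 0 t) = measure lborel (X i \<omega> \<inter> cball 0 t)"
    using S by (intro measure_completion) auto
  finally show ?thesis using s by (simp add: scaled_Int_cball)
qed

lemma (in constant_volume_fractions) constant_volume_fractions_scaled:
  assumes s: "0 < s"
  shows "constant_volume_fractions M (scaled s X) v"
proof (intro constant_volume_fractions.intro closed_pair_space.intro
    closed_pair_space_axioms.intro constant_volume_fractions_axioms.intro prob_space_axioms)
  show "random_closed_pair M (scaled s X)"
    unfolding random_closed_pair_def
    using measurable_affine_image[OF measurable_X, of s 0] s by (simp add: scaled_def[abs_def])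
  show "cover_prob M (scaled s X) [(x, i)] = v i" for x i
  proof -
    have "x \<in> scaled s X i \<omega> \<longleftrightarrow> (1 / s) *\<^sub>R x \<in> X i \<omega>" for \<omega>
      using s by (auto simp: scaled_def image_iff intro!: bexI[of _ "(1 / s) *\<^sub>R x"])
    then show ?thesis using volume_fraction[of "(1 / s) *\<^sub>R x" i] by (simp add: cover_prob_def)
  qed
  show "0 < v i" for i by (rule v_pos)
qed

section \<open>Cross statistics and their scaling limits\<close>

context prob_space
begin

lemma integral_uniform_measure:
  fixes f :: "'a \<Rightarrow> real"
  assumes A [measurable]: "A \<in> events" and f [measurable]: "f \<in> borel_measurable M" and pos: "0 < prob A"
  shows "(LINT \<omega>|uniform_measure M A. f \<omega>) = (LINT \<omega>|M. indicator A \<omega> * f \<omega>) / prob A"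
proof -
  have "indicator A \<omega> / emeasure M A = ennreal (indicator A \<omega> / prob A)" for \<omega>
    using pos by (auto simp: emeasure_eq_measure indicator_def divide_ennreal simp flip: ennreal_1)
  then have "uniform_measure M A = density M (\<lambda>\<omega>. ennreal (indicator A \<omega> / prob A))"
    unfolding uniform_measure_def by simp
  then show ?thesis by (simp add: integral_density)
qed

end

lemma (in closed_pair_space) expectation_exp_volume_pos:
  assumes B [measurable]: "B \<in> sets borel" "bounded B" and v: "0 < v"
  shows "0 < (LINT \<omega>|M. exp (- (measure lborel (X i \<omega> \<inter> B) / v)))"
proof -
  have "exp (- (measure lborel B / v)) \<le> (LINT \<omega>|M. exp (- (measure lborel (X i \<omega> \<inter> B) / v)))"
  proof (rule integral_ge_const)
    show "integrable M (\<lambda>\<omega>. exp (- (measure lborel (X i \<omega> \<inter> B) / v)))"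
      using v by (intro integrable_const_bound[of _ 1]) auto
    show "AE \<omega> in M. exp (- (measure lborel B / v)) \<le> exp (- (measure lborel (X i \<omega> \<inter> B) / v))"
      using covered_volume_le[OF B] v by (simp add: divide_right_mono)
  qed
  then show ?thesis using exp_gt_zero less_le_trans by blast
qed

lemma (in constant_volume_fractions) J12_quotient:
  assumes "J12_defined (cover_prob M X) t"
  shows "J12 (cover_prob M X) t =
    (LINT \<omega>|M. of_bool (0 \<in> X 1 \<omega>) * exp (- (measure lborel (X 2 \<omega> \<inter> cball 0 t) / v 2)))
      / (v 1 * (LINT \<omega>|M. exp (- (measure lborel (X 2 \<omega> \<inter> cball 0 t) / v 2))))"
proof -
  let ?E = "LINT \<omega>|M. exp (- (measure lborel (X 2 \<omega> \<inter> cball 0 t) / v 2))"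
  have "(LINT \<omega>|M. indicator {\<omega>\<in>space M. 0 \<in> X 1 \<omega>} \<omega> * exp (- (measure lborel (X 2 \<omega> \<inter> cball 0 t) / v 2))) =
      (LINT \<omega>|M. of_bool (0 \<in> X 1 \<omega>) * exp (- (measure lborel (X 2 \<omega> \<inter> cball 0 t) / v 2)))"
    by (intro Bochner_Integration.integral_cong) (auto simp: indicator_def)
  moreover have "?E > 0" using v_pos by (intro expectation_exp_volume_pos) auto
  ultimately show ?thesis using J12_eq[OF assms] v_pos[of 1] by (simp add: field_simps)
qed

context stationary_closed_pair
begin

lemma conditional_expectation_covered:
  assumes [measurable]: "f \<in> borel_measurable M"
  shows "(LINT \<omega>|uniform_measure M {\<omega>\<in>space M. 0 \<in> X i \<omega>}. f \<omega>) =
    (LINT \<omega>|M. indicator {\<omega>\<in>space M. 0 \<in> X i \<omega>} \<omega> * f \<omega>) / v i"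
  using integral_uniform_measure[OF cover_event assms, of 0 i] v_pos[of i] by (simp add: prob_mem)

lemma K12_conditional:
  "K12 (cover_prob M X) t =
    (LINT \<omega>|uniform_measure M {\<omega>\<in>space M. 0 \<in> X 1 \<omega>}. measure lborel (X 2 \<omega> \<inter> cball 0 t)) / v 2"
  by (subst conditional_expectation_covered) (auto simp: K12_eq)

lemma laplace_palm_tendsto:
  assumes t: "0 < t" and charged: "locally_charged M (X 2)"
    and Q: "palm_family M \<Psi> Q" "translation_covariant Q"
    and B: "B \<in> sets borel" "bounded B" "0 < measure lborel B"
  shows "((\<lambda>s. laplace (Q (0, 1)) (\<lambda>z. s ^ DIM('b) * u0 (cover_prob M X) t z))
    \<longlongrightarrow> 1 - T12 M X B t / v 1) at_top"
proof -
  let ?A = "{\<omega>\<in>space M. 0 \<in> X 1 \<omega>}"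
  have "((\<lambda>s. (LINT \<omega>|M. indicator ?A \<omega> * exp (- (s ^ DIM('b) * measure lborel (X 2 \<omega> \<inter> cball 0 t) / v 2))) / v 1)
      \<longlongrightarrow> prob {\<omega>\<in>?A. measure lborel (X 2 \<omega> \<inter> cball 0 t) = 0} / v 1) at_top"
    using v_pos by (intro tendsto_divide tendsto_exp_volume tendsto_const) (auto simp: less_imp_neq[symmetric])
  moreover have "prob {\<omega>\<in>?A. measure lborel (X 2 \<omega> \<inter> cball 0 t) = 0} / v 1 = 1 - T12 M X B t / v 1"
  proof -
    have [measurable]: "{\<omega>\<in>space M. 0 \<in> X 1 \<omega> \<and> X 2 \<omega> \<inter> cball 0 t \<noteq> {}} \<in> events"
      "{\<omega>\<in>?A. X 2 \<omega> \<inter> cball 0 t = {}} \<in> events"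
      by measurable
    have "prob ?A = prob ({\<omega>\<in>space M. 0 \<in> X 1 \<omega> \<and> X 2 \<omega> \<inter> cball 0 t \<noteq> {}} \<union> {\<omega>\<in>?A. X 2 \<omega> \<inter> cball 0 t = {}})"
      by (rule arg_cong[of _ _ prob]) auto
    also have "\<dots> = T12 M X B t + prob {\<omega>\<in>?A. X 2 \<omega> \<inter> cball 0 t = {}}"
      unfolding T12_eq[OF B] by (rule finite_measure_Union) auto
    finally have "v 1 = T12 M X B t + prob {\<omega>\<in>?A. measure lborel (X 2 \<omega> \<inter> cball 0 t) = 0}"
      by (simp only: prob_mem prob_volume_eq_0[OF t charged cover_event])
    then show ?thesis using v_pos[of 1] by (simp add: field_simps)
  qed
  ultimately show ?thesis by (simp only: laplace_palm[OF Q])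
qed

text \<open>Scaling by \<open>s\<close> multiplies the covered volume by the \<open>d\<close>-th power of \<open>s\<close> and preserves the volume
  fractions, so the quotient for the scaled pair consists of Laplace transforms of the original
  covered volume at large arguments.\<close>

lemma J12_scaled_tendsto:
  assumes t: "0 < t" and charged: "locally_charged M (X 2)"
    and miss: "\<P>(\<omega> in M. X 2 \<omega> \<inter> cball 0 t = {}) \<noteq> 0"
    and defd: "\<forall>\<^sub>F s in at_top. J12_defined (cover_prob M (scaled s X)) (s * t)"
  shows "((\<lambda>s. J12 (cover_prob M (scaled s X)) (s * t))
    \<longlongrightarrow> \<P>(\<omega> in M. X 2 \<omega> \<inter> cball 0 t = {} \<bar> 0 \<in> X 1 \<omega>) / \<P>(\<omega> in M. X 2 \<omega> \<inter> cball 0 t = {})) at_top"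
proof -
  let ?A = "{\<omega>\<in>space M. 0 \<in> X 1 \<omega>}"
  let ?e = "\<lambda>s \<omega>. exp (- (s ^ DIM('b) * measure lborel (X 2 \<omega> \<inter> cball 0 t) / v 2))"
  let ?N = "\<lambda>A s. LINT \<omega>|M. indicator A \<omega> * ?e s \<omega>"
  have lim: "(?N A \<longlongrightarrow> prob {\<omega>\<in>A. X 2 \<omega> \<inter> cball 0 t = {}}) at_top" if "A \<in> events" for A
    unfolding prob_volume_eq_0[OF t charged that, symmetric]
    using that v_pos by (intro tendsto_exp_volume) auto
  have quotient: "((\<lambda>s. ?N ?A s / (v 1 * ?N (space M) s))
      \<longlongrightarrow> prob {\<omega>\<in>?A. X 2 \<omega> \<inter> cball 0 t = {}} / (v 1 * \<P>(\<omega> in M. X 2 \<omega> \<inter> cball 0 t = {}))) at_top"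
    using v_pos[of 1] miss by (intro tendsto_divide tendsto_mult tendsto_const lim) auto
  have "\<forall>\<^sub>F s in at_top. ?N ?A s / (v 1 * ?N (space M) s) = J12 (cover_prob M (scaled s X)) (s * t)"
    using defd eventually_gt_at_top[of 0]
  proof eventually_elim
    case (elim s)
    interpret S: constant_volume_fractions M "scaled s X" v
      by (rule constant_volume_fractions_scaled[OF elim(2)])
    have mem: "0 \<in> scaled s X 1 \<omega> \<longleftrightarrow> 0 \<in> X 1 \<omega>" for \<omega>
      using elim(2) by (auto simp: scaled_def image_iff)
    have vol: "exp (- (measure lborel (scaled s X 2 \<omega> \<inter> cball 0 (s * t)) / v 2)) = ?e s \<omega>"
      if "\<omega> \<in> space M" for \<omega>
      by (simp add: measure_scaled_Int_cball[of s X, OF elim(2) closed_X[OF that]])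
    have "(LINT \<omega>|M. of_bool (0 \<in> scaled s X 1 \<omega>) * exp (- (measure lborel (scaled s X 2 \<omega> \<inter> cball 0 (s * t)) / v 2)))
        = ?N ?A s"
      by (intro Bochner_Integration.integral_cong refl) (simp add: mem vol indicator_def)
    moreover have "(LINT \<omega>|M. exp (- (measure lborel (scaled s X 2 \<omega> \<inter> cball 0 (s * t)) / v 2))) = ?N (space M) s"
      by (intro Bochner_Integration.integral_cong refl) (simp add: vol)
    ultimately show ?case by (simp only: S.J12_quotient[OF elim(1)])
  qed
  from Lim_transform_eventually[OF quotient this] show ?thesis
    by (simp add: cond_prob_def prob_mem conj_commute)
qed

lemma cond_prob_miss_quotient:
  assumes miss: "\<P>(\<omega> in M. X 2 \<omega> \<inter> cball 0 t = {}) \<noteq> 0"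
  shows "\<P>(\<omega> in M. X 2 \<omega> \<inter> cball 0 t = {} \<bar> 0 \<in> X 1 \<omega>) / \<P>(\<omega> in M. X 2 \<omega> \<inter> cball 0 t = {}) =
    (LINT \<omega>|uniform_measure M {\<omega>\<in>space M. X 2 \<omega> \<inter> cball 0 t = {}}. of_bool (0 \<in> X 1 \<omega>) / v 1)"
proof -
  let ?A = "{\<omega>\<in>space M. 0 \<in> X 1 \<omega>}" and ?C = "{\<omega>\<in>space M. X 2 \<omega> \<inter> cball 0 t = {}}"
  have C [measurable]: "?C \<in> events" by measurable
  have "(LINT \<omega>|uniform_measure M ?C. of_bool (0 \<in> X 1 \<omega>) / v 1) =
      (LINT \<omega>|M. indicator ?C \<omega> * (of_bool (0 \<in> X 1 \<omega>) / v 1)) / prob ?C"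
    using miss by (intro integral_uniform_measure C) (auto simp: zero_less_measure_iff)
  also have "(LINT \<omega>|M. indicator ?C \<omega> * (of_bool (0 \<in> X 1 \<omega>) / v 1)) = (LINT \<omega>|M. indicator (?C \<inter> ?A) \<omega> / v 1)"
    by (intro Bochner_Integration.integral_cong refl) (auto simp: indicator_def)
  also have "\<dots> = prob (?C \<inter> ?A) / v 1" by simp
  also have "?C \<inter> ?A = {\<omega>\<in>space M. X 2 \<omega> \<inter> cball 0 t = {} \<and> 0 \<in> X 1 \<omega>}" by auto
  finally show ?thesis by (simp add: cond_prob_def prob_mem)
qed

end

theorem theorem6:
  fixes M :: "'w measure"
    and X :: "2 \<Rightarrow> 'w \<Rightarrow> 'a::euclidean_space set"
    and p :: "('a \<times> 2) list \<Rightarrow> real"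
  assumes "prob_space M"
    and "random_closed_pair M X"
    and "stationary M X"
    and "\<And>i. \<P>(\<omega> in M. 0 \<in> X i \<omega>) > 0"
    and "p = cover_prob M X"
  shows "crm_stationary M (coverage_measure X) p \<and>
    (\<forall>t\<ge>0. K12 p t =
      (LINT \<omega>|uniform_measure M {\<omega> \<in> space M. 0 \<in> X 1 \<omega>}. measure lborel (X 2 \<omega> \<inter> cball 0 t))
        / p [(0, 2)]) \<and>
    (\<forall>t\<ge>0. J12_defined p t \<longrightarrow> J12 p t =
      (LINT \<omega>|M. of_bool (0 \<in> X 1 \<omega>) * exp (- (measure lborel (X 2 \<omega> \<inter> cball 0 t) / p [(0, 2)])))
        / (p [(0, 1)] * (LINT \<omega>|M. exp (- (measure lborel (X 2 \<omega> \<inter> cball 0 t) / p [(0, 2)]))))) \<and>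
    palm_family M (coverage_measure X) (palm_by_conditioning M X) \<and>
    translation_covariant (palm_by_conditioning M X) \<and>
    (\<forall>t>0. \<forall>Q B.
      locally_charged M (X 2) \<longrightarrow>
      palm_family M (coverage_measure X) Q \<longrightarrow> translation_covariant Q \<longrightarrow>
      B \<in> sets borel \<longrightarrow> bounded B \<longrightarrow> 0 < measure lborel B \<longrightarrow>
      ((\<lambda>s. laplace (Q (0, 1)) (\<lambda>z. s ^ DIM('a) * u0 p t z))
        \<longlongrightarrow> 1 - T12 M X B t / p [(0, 1)]) at_top) \<and>
    (\<forall>t>0. \<P>(\<omega> in M. X 2 \<omega> \<inter> cball 0 t = {}) \<noteq> 0 \<longrightarrow>
      (locally_charged M (X 2) \<longrightarrow>
        (\<forall>\<^sub>F s in at_top. J12_defined (cover_prob M (scaled s X)) (s * t)) \<longrightarrow>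
        ((\<lambda>s. J12 (cover_prob M (scaled s X)) (s * t))
          \<longlongrightarrow> \<P>(\<omega> in M. X 2 \<omega> \<inter> cball 0 t = {} \<bar> 0 \<in> X 1 \<omega>)
            / \<P>(\<omega> in M. X 2 \<omega> \<inter> cball 0 t = {})) at_top) \<and>
      \<P>(\<omega> in M. X 2 \<omega> \<inter> cball 0 t = {} \<bar> 0 \<in> X 1 \<omega>) / \<P>(\<omega> in M. X 2 \<omega> \<inter> cball 0 t = {}) =
        (LINT \<omega>|uniform_measure M {\<omega> \<in> space M. X 2 \<omega> \<inter> cball 0 t = {}}.
          of_bool (0 \<in> X 1 \<omega>) / p [(0, 1)]))"
proof -
  interpret stationary_closed_pair M X
    using assms(1-4)
    by (intro stationary_closed_pair.intro closed_pair_space.intro closed_pair_space_axioms.intro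
        stationary_closed_pair_axioms.intro)
  show ?thesis
    unfolding assms(5) volume_fraction
    by (intro conjI allI impI crm_stationary_cover_prob K12_conditional J12_quotient
        palm_family_palm_by_conditioning translation_covariant_palm_by_conditioning
        laplace_palm_tendsto J12_scaled_tendsto cond_prob_miss_quotient)
qed

end
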